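(* Let $S\subset\mathbb P^4$ be a general K3 surface of degree $6$ and genus $4$, let $Y_S$ be the set of fixed points of the extended Beauville involution $\widetilde{\beta_S}:\widetilde{S[3]}\to\widetilde{S[3]}$ lying on the exceptional divisor $E_S$, and let $X_S$ be the closure in $\widetilde{S[3]}$ of the remaining set of fixed points of $\widetilde{\beta_S}$. Then $X_S\cap Y_S=\emptyset$.
   Context: Everything is over the complex numbers. A K3 surface $S\subset\mathbb P^4$ of degree $6$ and genus $4$ is a smooth, irreducible, linearly normal K3 surface of degree $6$ in $\mathbb P^4$; "general" means general in the family of all such surfaces, so that in particular $\mathrm{Pic}(S)=\mathbb Z\langle\mathcal O_S(1)\rangle$ and $S$ is the complete intersection of a unique smooth quadric $\mathbb Q$ and a smooth cubic hypersurface. $S[3]$ is the Hilbert scheme of $0$-dimensional subschemes of length $3$ of $S$. $\langle Z\rangle$ denotes the linear span of $Z$. The Beauville involution is the birational involution $\beta_S:S[3]\dashrightarrow S[3]$ sending a general $Z$ to the scheme $Z'$ such that the union of $Z$ and $Z'$ (i.e. $Z'$ is residual to $Z$) is the scheme-theoretic intersection $S\cap\langle Z\rangle$. Its indeterminacy locus $\mathrm{Ind}(\beta_S)$ is the set of $Z$ such that $\langle Z\rangle$ is a line; these lines are exactly the lines contained in $\mathbb Q$. Let $\widetilde{S[3]}\to S[3]$ be the blow-up along $\mathrm{Ind}(\beta_S)$, with exceptional divisor $E_S$, identified with the set of pairs $(Z,\pi)$ with $Z\in\mathrm{Ind}(\beta_S)$ and $\pi$ a plane containing the line $\langle Z\rangle$.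 Then $\beta_S$ extends to an involution $\widetilde{\beta_S}$ of $\widetilde{S[3]}$, acting on $E_S$ by $(Z,\pi)\mapsto(Z',\pi)$, where the union of $Z$ and $Z'$ is $S\cap\pi$. A pair $(Z,\pi)\in E_S$ is in $Y_S$ if and only if $\pi$ is tangent to $\mathbb Q$ along the line $\langle Z\rangle$. The general point of $X_S$ is a scheme $Z$ of three distinct points spanning a plane that intersects $S$ in a curvilinear scheme of length $6$ supported on $Z$, with length $2$ at each point of $Z$. *)

theory Defs
  imports "HOL-Analysis.Analysis" "HOL-Library.Poly_Mapping"
begin

section \<open>Complex polynomials and homogeneous ideals\<close>

text \<open>Polynomials with complex coefficients in variables indexed by \<^typ>\<open>'v\<close>; the ring structure is
  the convolution product of the library. The homogeneous coordinate ring of projective 4-space is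
  \<open>5 mpoly\<close>, and points of projective 4-space are nonzero vectors of \<open>complex^5\<close>.\<close>

type_synonym 'v mono = "'v \<Rightarrow>\<^sub>0 nat"
type_synonym 'v mpoly = "'v mono \<Rightarrow>\<^sub>0 complex"

definition meval :: "('v \<Rightarrow> complex) \<Rightarrow> 'v mpoly \<Rightarrow> complex" where
  "meval x p = (\<Sum>m\<in>Poly_Mapping.keys p. Poly_Mapping.lookup p m *
      (\<Prod>v\<in>Poly_Mapping.keys m. x v ^ Poly_Mapping.lookup m v))"

definition mono_degree :: "'v mono \<Rightarrow> nat" where
  "mono_degree m = (\<Sum>v\<in>Poly_Mapping.keys m. Poly_Mapping.lookup m v)"

definition forms :: "nat \<Rightarrow> 'v mpoly set" where
  "forms d = {p. \<forall>m\<in>Poly_Mapping.keys p. mono_degree m = d}"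

definition hcomponent :: "nat \<Rightarrow> 'v mpoly \<Rightarrow> 'v mpoly" where
  "hcomponent d p = (\<Sum>m\<in>{m \<in> Poly_Mapping.keys p. mono_degree m = d}.
      Poly_Mapping.single m (Poly_Mapping.lookup p m))"

definition partial_deriv :: "'v \<Rightarrow> 'v mpoly \<Rightarrow> 'v mpoly" where
  "partial_deriv v p = (\<Sum>m\<in>Poly_Mapping.keys p. Poly_Mapping.single (m - Poly_Mapping.single v 1)
      (of_nat (Poly_Mapping.lookup m v) * Poly_Mapping.lookup p m))"

definition gradient :: "5 mpoly \<Rightarrow> complex^5 \<Rightarrow> complex^5" where
  "gradient p x = (\<chi> i. meval (($) x) (partial_deriv i p))"

text \<open>Ideals are submodules of the ring over itself.\<close>

abbreviation is_ideal :: "'v mpoly set \<Rightarrow> bool" where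
  "is_ideal \<equiv> module.subspace (*)"

abbreviation ideal_generated :: "'v mpoly set \<Rightarrow> 'v mpoly set" where
  "ideal_generated \<equiv> module.span (*)"

definition homogeneous_ideal :: "'v mpoly set \<Rightarrow> bool" where
  "homogeneous_ideal I \<longleftrightarrow> is_ideal I \<and> (\<forall>p\<in>I. \<forall>d. hcomponent d p \<in> I)"

definition prime_ideal :: "'v mpoly set \<Rightarrow> bool" where
  "prime_ideal P \<longleftrightarrow> is_ideal P \<and> P \<noteq> UNIV \<and> (\<forall>a b. a * b \<in> P \<longrightarrow> a \<in> P \<or> b \<in> P)"

primrec ideal_power :: "'v mpoly set \<Rightarrow> nat \<Rightarrow> 'v mpoly set" where
  "ideal_power I 0 = UNIV"
| "ideal_power I (Suc n) = ideal_generated {a * b | a b. a \<in> I \<and> b \<in> ideal_power I n}"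

definition ideal_sum :: "'v mpoly set \<Rightarrow> 'v mpoly set \<Rightarrow> 'v mpoly set" where
  "ideal_sum I J = {a + b | a b. a \<in> I \<and> b \<in> J}"

definition ideal_quotient :: "'v mpoly set \<Rightarrow> 'v mpoly set \<Rightarrow> 'v mpoly set" where
  "ideal_quotient I J = {p. \<forall>g\<in>J. p * g \<in> I}"

definition saturation :: "'v mpoly set \<Rightarrow> 'v mpoly set" where
  "saturation I = {p. \<exists>k. \<forall>m. mono_degree m = k \<longrightarrow> Poly_Mapping.single m 1 * p \<in> I}"

text \<open>The dimension is taken over the complex numbers.\<close>

definition hilbert_function :: "'v mpoly set \<Rightarrow> nat \<Rightarrow> nat" where
  "hilbert_function I d =
     vector_space.dim (\<lambda>c p. Poly_Mapping.single 0 c * p) (forms d :: 'v mpoly set) -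
     vector_space.dim (\<lambda>c p. Poly_Mapping.single 0 c * p) (I \<inter> forms d)"

section \<open>Subschemes of projective 4-space\<close>

text \<open>A closed subscheme is represented by its saturated homogeneous ideal, so that inclusion of
  schemes is reverse inclusion of ideals.\<close>

definition closed_subscheme :: "5 mpoly set \<Rightarrow> bool" where
  "closed_subscheme I \<longleftrightarrow> homogeneous_ideal I \<and> saturation I = I"

text \<open>Dimension 0 and length \<open>n > 0\<close>: the Hilbert polynomial is the constant \<open>n\<close>.\<close>

definition finite_length_scheme :: "nat \<Rightarrow> 5 mpoly set \<Rightarrow> bool" where
  "finite_length_scheme n I \<longleftrightarrow>
     closed_subscheme I \<and> (\<forall>\<^sub>F d in sequentially. hilbert_function I d = n)"

text \<open>Linear subspaces of projective 4-space are linear subspaces of \<open>complex^5\<close>, of dimension one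
  higher.\<close>

definition linear_subspace_ideal :: "(complex^5) set \<Rightarrow> 5 mpoly set" where
  "linear_subspace_ideal L = {p. \<forall>x\<in>L. meval (($) x) p = 0}"

definition linear_span :: "5 mpoly set \<Rightarrow> (complex^5) set" where
  "linear_span I = {x. \<forall>p \<in> I \<inter> forms 1. meval (($) x) p = 0}"

definition is_line :: "(complex^5) set \<Rightarrow> bool" where
  "is_line L \<longleftrightarrow> vec.subspace L \<and> vec.dim L = 2"

definition is_plane :: "(complex^5) set \<Rightarrow> bool" where
  "is_plane L \<longleftrightarrow> vec.subspace L \<and> vec.dim L = 3"

definition scheme_intersection :: "5 mpoly set \<Rightarrow> 5 mpoly set \<Rightarrow> 5 mpoly set" where
  "scheme_intersection I J = saturation (ideal_sum I J)"

section \<open>Picard group of a smooth surface\<close>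

text \<open>Below, \<open>S\<close> is the homogeneous prime ideal of a smooth surface, on which line bundles are the
  same as Weil divisors up to linear equivalence. A prime divisor is a homogeneous prime of height
  one over \<open>S\<close>.\<close>

definition prime_divisors :: "5 mpoly set \<Rightarrow> 5 mpoly set set" where
  "prime_divisors S = {P. prime_ideal P \<and> homogeneous_ideal P \<and> S \<subset> P \<and>
     (\<forall>P'. prime_ideal P' \<and> homogeneous_ideal P' \<and> S \<subset> P' \<and> P' \<subseteq> P \<longrightarrow> P' = P)}"

text \<open>The valuation of a form \<open>g \<notin> S\<close> in the discrete valuation ring obtained by localizing the
  coordinate ring of \<open>S\<close> at \<open>P\<close>: the largest \<open>n\<close> such that \<open>g\<close> lies in the \<open>n\<close>-th power of the
  maximal ideal.\<close>

definition vanishing_order :: "5 mpoly set \<Rightarrow> 5 mpoly set \<Rightarrow> 5 mpoly \<Rightarrow> nat" where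
  "vanishing_order S P g =
     (GREATEST n. \<exists>h. h \<notin> P \<and> h * g \<in> ideal_sum S (ideal_power P n))"

text \<open>A nonzero rational section of \<open>O(n)\<close> is a quotient of forms \<open>g / h\<close> with
  \<open>n = deg g - deg h\<close>; this says that \<open>D\<close> is its divisor, so that the line bundle of \<open>D\<close> is
  \<open>O(n)\<close>.\<close>

definition divisor_class_is_hyperplane_multiple ::
    "5 mpoly set \<Rightarrow> (5 mpoly set \<Rightarrow> int) \<Rightarrow> int \<Rightarrow> bool" where
  "divisor_class_is_hyperplane_multiple S D n \<longleftrightarrow>
     (\<exists>d e g h. g \<in> forms d - S \<and> h \<in> forms e - S \<and> n = int d - int e \<and>
        (\<forall>P\<in>prime_divisors S.
           D P = int (vanishing_order S P g) - int (vanishing_order S P h)))"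

text \<open>The Picard group is infinite cyclic, generated by \<open>O(1)\<close>.\<close>

definition Picard_group_generated_by_hyperplane :: "5 mpoly set \<Rightarrow> bool" where
  "Picard_group_generated_by_hyperplane S \<longleftrightarrow>
     (\<forall>D. finite {P \<in> prime_divisors S. D P \<noteq> 0} \<longrightarrow>
        (\<exists>!n. divisor_class_is_hyperplane_multiple S D n))"

section \<open>K3 surfaces of degree 6 and genus 4\<close>

definition smooth_hypersurface :: "5 mpoly \<Rightarrow> bool" where
  "smooth_hypersurface p \<longleftrightarrow> (\<forall>x. x \<noteq> 0 \<and> meval (($) x) p = 0 \<longrightarrow> gradient p x \<noteq> 0)"

definition smooth_complete_intersection :: "5 mpoly \<Rightarrow> 5 mpoly \<Rightarrow> bool" where
  "smooth_complete_intersection q f \<longleftrightarrow>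
     (\<forall>x. x \<noteq> 0 \<and> meval (($) x) q = 0 \<and> meval (($) x) f = 0 \<longrightarrow>
        (\<forall>a b. a *s gradient q x + b *s gradient f x = 0 \<longrightarrow> a = 0 \<and> b = 0))"

definition surface_ideal :: "5 mpoly \<Rightarrow> 5 mpoly \<Rightarrow> 5 mpoly set" where
  "surface_ideal q f = ideal_generated {q, f}"

text \<open>The K3 surfaces of degree 6 cut out by a smooth quadric \<open>q\<close> and a smooth cubic \<open>f\<close>, with
  Picard group generated by the hyperplane class. Smooth complete intersections of type (2,3) are
  automatically linearly normal, and K3 surfaces by adjunction.\<close>

definition K3_degree6 :: "5 mpoly \<Rightarrow> 5 mpoly \<Rightarrow> bool" where
  "K3_degree6 q f \<longleftrightarrow> q \<in> forms 2 \<and> f \<in> forms 3 \<and>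
     smooth_hypersurface q \<and> smooth_hypersurface f \<and>
     smooth_complete_intersection q f \<and> prime_ideal (surface_ideal q f) \<and>
     Picard_group_generated_by_hyperplane (surface_ideal q f)"

text \<open>Smooth complete intersections of type (2,3) are parametrized by a dense open subset of the
  affine space of pairs \<open>(q, f)\<close> of a quadratic and a cubic form. A polynomial \<open>G\<close> in the
  coefficients of \<open>q\<close> and \<open>f\<close>, not identically zero on this irreducible space, again defines a
  dense open subset. A property holds for the general surface if it holds for all surfaces
  (with the above properties) in such an open subset.\<close>

definition coefficients :: "5 mpoly \<Rightarrow> 5 mpoly \<Rightarrow> (5 mono + 5 mono) \<Rightarrow> complex" where
  "coefficients q f = case_sum (Poly_Mapping.lookup q) (Poly_Mapping.lookup f)"

definition general_locus :: "(5 mono + 5 mono) mpoly \<Rightarrow> (5 mpoly \<times> 5 mpoly) set" where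
  "general_locus G = {(q, f). q \<in> forms 2 \<and> f \<in> forms 3 \<and> meval (coefficients q f) G \<noteq> 0}"

section \<open>The Beauville involution\<close>

definition Hilb3 :: "5 mpoly set \<Rightarrow> 5 mpoly set set" where
  "Hilb3 S = {Z. finite_length_scheme 3 Z \<and> S \<subseteq> Z}"

definition Ind :: "5 mpoly set \<Rightarrow> 5 mpoly set set" where
  "Ind S = {Z \<in> Hilb3 S. is_line (linear_span Z)}"

text \<open>The subscheme residual to \<open>Z\<close> in the finite scheme cut out on \<open>S\<close> by the plane \<open>L\<close>, in the
  sense of liaison. If this finite scheme is reduced, it is the complement of \<open>Z\<close>.\<close>

definition residual :: "5 mpoly set \<Rightarrow> (complex^5) set \<Rightarrow> 5 mpoly set \<Rightarrow> 5 mpoly set" where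
  "residual S L Z = ideal_quotient (scheme_intersection S (linear_subspace_ideal L)) Z"

definition beauville :: "5 mpoly set \<Rightarrow> 5 mpoly set \<Rightarrow> 5 mpoly set" where
  "beauville S Z = residual S (linear_span Z) Z"

text \<open>The blow-up of \<open>Hilb3 S\<close> along \<open>Ind S\<close>. The span of \<open>Z\<close> is a plane exactly when \<open>Z\<close> is not in
  \<open>Ind S\<close>, and the exceptional divisor consists of the pairs of \<open>Z \<in> Ind S\<close> and a plane containing
  the line spanned by \<open>Z\<close>; so the blow-up, which is the closure of the graph of the rational map
  sending \<open>Z\<close> to its span, is the set of all pairs of \<open>Z\<close> and a plane containing \<open>Z\<close>.\<close>

definition blowup_Hilb3 :: "5 mpoly set \<Rightarrow> (5 mpoly set \<times> (complex^5) set) set" where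
  "blowup_Hilb3 S = {(Z, L). Z \<in> Hilb3 S \<and> is_plane L \<and> linear_subspace_ideal L \<subseteq> Z}"

definition exceptional_divisor :: "5 mpoly set \<Rightarrow> (5 mpoly set \<times> (complex^5) set) set" where
  "exceptional_divisor S = {(Z, L) \<in> blowup_Hilb3 S. Z \<in> Ind S}"

definition beauville_ext ::
    "5 mpoly set \<Rightarrow> 5 mpoly set \<times> (complex^5) set \<Rightarrow> 5 mpoly set \<times> (complex^5) set" where
  "beauville_ext S = (\<lambda>(Z, L). (if Z \<in> Ind S then residual S L Z else beauville S Z, L))"

definition fixed_points :: "5 mpoly set \<Rightarrow> (5 mpoly set \<times> (complex^5) set) set" where
  "fixed_points S = {p \<in> blowup_Hilb3 S. beauville_ext S p = p}"

text \<open>A scheme \<open>Z\<close> of length 3 is determined by its cubic equations, a subspace of codimension 3 in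
  the space of cubic forms, and the Hilbert scheme thereby is a closed subvariety of a Grassmannian
  (3 is the Gotzmann number of the Hilbert polynomial 3). A frame of \<open>(Z, L)\<close> consists of three
  linear forms on cubics (given by their values on monomials, and necessarily independent) whose
  common kernel is the space of cubic equations of \<open>Z\<close>, and three vectors spanning \<open>L\<close>.\<close>

type_synonym frame_index = "(3 \<times> 5 mono) + (3 \<times> 5)"

definition is_frame ::
    "(frame_index \<Rightarrow> complex) \<Rightarrow> 5 mpoly set \<times> (complex^5) set \<Rightarrow> bool" where
  "is_frame x = (\<lambda>(Z, L).
     Z \<inter> forms 3 = {p \<in> forms 3. \<forall>i::3.
        (\<Sum>m\<in>Poly_Mapping.keys p. x (Inl (i, m)) * Poly_Mapping.lookup p m) = 0} \<and>
     L = vec.span (range (\<lambda>i::3. \<chi> j. x (Inr (i, j)))))"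

text \<open>The Zariski topology of a product of two Grassmannians is the quotient of the Zariski topology
  on frames under the action of two general linear groups. The image of the open set of frames
  where a polynomial \<open>g\<close> does not vanish is open, and these images generate the topology.\<close>

definition zariski_blowup :: "5 mpoly set \<Rightarrow> (5 mpoly set \<times> (complex^5) set) topology" where
  "zariski_blowup S = topology_generated_by
     (range (\<lambda>g :: frame_index mpoly.
        {p \<in> blowup_Hilb3 S. \<exists>x. is_frame x p \<and> meval x g \<noteq> 0}))"

definition Y_locus :: "5 mpoly set \<Rightarrow> (5 mpoly set \<times> (complex^5) set) set" where
  "Y_locus S = fixed_points S \<inter> exceptional_divisor S"

definition X_locus :: "5 mpoly set \<Rightarrow> (5 mpoly set \<times> (complex^5) set) set" where
  "X_locus S = zariski_blowup S closure_of (fixed_points S - Y_locus S)"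

end

theory Submission
  imports Defs "HOL-Computational_Algebra.Fundamental_Theorem_Algebra"
begin

text \<open>The claim is local: every point \<open>(Z0, L0)\<close> of the locus \<open>Y\<close> has a Zariski neighbourhood
  in which every fixed point \<open>(Z, L)\<close> of the involution has a collinear \<open>Z\<close>. The fixed points outside
  \<open>Y\<close> are the non-collinear ones, so such a neighbourhood separates \<open>(Z0, L0)\<close> from them.

  Choose linear forms \<open>T\<close>, \<open>X\<close>, \<open>Y\<close> that restrict to coordinates on \<open>L0\<close>, such that \<open>Y = 0\<close> is the
  line of \<open>Z0\<close> and \<open>T\<close> has no zero on \<open>Z0\<close> (\<open>adapted_frame\<close>). For \<open>(Z, L)\<close> near \<open>(Z0, L0)\<close> these are
  still coordinates on \<open>L\<close>, and \<open>1\<close>, \<open>x\<close>, \<open>x^2\<close> are still a basis of the functions on \<open>Z\<close> in the chart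
  \<open>T = 1\<close>. Hence \<open>Z\<close> is the graph \<open>y = a + b x + c x^2\<close> over the zeros of a monic cubic \<open>p(x)\<close>
  (\<open>plane_scheme_of_frame\<close>), and \<open>Z\<close> is collinear exactly if \<open>c = 0\<close>. With
  \<open>w = y - a - b x - c x^2\<close>, the ideal of \<open>Z\<close> in the chart is \<open>(w, p)\<close>.

  Write the equations of the surface as \<open>q = \<alpha> w + \<beta> p\<close> and \<open>f = \<gamma> w + \<delta> p\<close>. By Cramer's rule, the
  determinant \<open>\<alpha> \<delta> - \<beta> \<gamma>\<close> multiplies \<open>(w, p)\<close> into \<open>(q, f)\<close>. If \<open>Z\<close> is its own residual, the
  determinant thus vanishes on \<open>Z\<close> (\<open>determinant_mem_Z\<close>). Now reduce it modulo \<open>(w, p)\<close>. Comparing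
  degrees shows that \<open>\<beta>\<close> is \<open>c\<close> times a linear polynomial, that \<open>\<delta>\<close> is a constant \<open>d0\<close> modulo \<open>c\<close>,
  and that the coefficient of \<open>x^2\<close> in \<open>\<alpha>\<close> is \<open>2 A c\<close>, where \<open>A\<close> is the coefficient of \<open>y^2\<close> in \<open>q\<close>.
  The coefficient of \<open>x^2\<close> in the determinant therefore gives an equation
  \<open>c (2 A d0 - \<theta>) = 0\<close> (\<open>linkage_equations\<close>), in which \<open>\<theta>\<close> is a regular function of \<open>(Z, L)\<close>.

  At \<open>(Z0, L0)\<close> self-residuality forces \<open>q\<close> to be \<open>A Y^2\<close> on \<open>L0\<close>, which is the tangency of \<open>L0\<close> to the
  quadric along the line; moreover \<open>A\<close> and \<open>d0\<close> are not zero, while \<open>\<theta>\<close> is zero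
  (\<open>nondegenerate_at_collinear_scheme\<close>). So \<open>2 A d0 - \<theta>\<close> is a regular function that does not vanish
  at \<open>(Z0, L0)\<close>, and where it does not vanish, \<open>c = 0\<close> (\<open>self_residual_near_Y_is_collinear\<close>).\<close>

section \<open>Ideals, evaluation and forms\<close>

lemma module_times: "module ((*) :: 'a::comm_ring_1 \<Rightarrow> 'a \<Rightarrow> 'a)"
  by unfold_locales (simp_all add: algebra_simps)

lemmas ideal_0 = module.subspace_0[OF module_times]
  and ideal_add = module.subspace_add[OF module_times]
  and ideal_diff = module.subspace_diff[OF module_times]
  and ideal_scale = module.subspace_scale[OF module_times]
  and ideal_sum = module.subspace_sum[OF module_times]
  and idealI = module.subspaceI[OF module_times]
  and ideal_span_minimal = module.span_minimal[OF module_times]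
  and ideal_subspace_span = module.subspace_span[OF module_times]
  and ideal_span_superset = module.span_superset[OF module_times]

lemma ideal_mult_right: "module.subspace (*) I \<Longrightarrow> a \<in> I \<Longrightarrow> a * b \<in> I"
  for a b :: "'a::comm_ring_1"
  using ideal_scale[of I a b] by (simp add: mult.commute)

lemma ideal_cong: "module.subspace (*) I \<Longrightarrow> a - b \<in> I \<Longrightarrow> a \<in> I \<longleftrightarrow> b \<in> I"
  for a b :: "'a::comm_ring_1"
  using ideal_add[of I "a - b" b] ideal_diff[of I a "a - b"] by auto

definition monomial_value :: "('v \<Rightarrow> complex) \<Rightarrow> 'v mono \<Rightarrow> complex" where
  "monomial_value x m = (\<Prod>v\<in>Poly_Mapping.keys m. x v ^ Poly_Mapping.lookup m v)"

lemma monomial_value_superset: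
  assumes "finite A" "Poly_Mapping.keys m \<subseteq> A"
  shows "monomial_value x m = (\<Prod>v\<in>A. x v ^ Poly_Mapping.lookup m v)"
  unfolding monomial_value_def
  by (rule prod.mono_neutral_left) (use assms in \<open>auto simp: in_keys_iff\<close>)

lemma monomial_value_add: "monomial_value x (m + n) = monomial_value x m * monomial_value x n"
proof -
  define A where "A = Poly_Mapping.keys m \<union> Poly_Mapping.keys n"
  have "finite A" "Poly_Mapping.keys m \<subseteq> A" "Poly_Mapping.keys n \<subseteq> A" "Poly_Mapping.keys (m + n) \<subseteq> A"
    using keys_add[of m n] by (auto simp: A_def)
  then show ?thesis
    by (simp add: monomial_value_superset[of A] lookup_add power_add prod.distrib)
qed

lemma monomial_value_0 [simp]: "monomial_value x 0 = 1"
  by (simp add: monomial_value_def)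

lemma monomial_value_single [simp]: "monomial_value x (Poly_Mapping.single v n) = x v ^ n"
  by (cases "n = 0") (simp_all add: monomial_value_def)

lemma meval_superset:
  assumes "finite A" "Poly_Mapping.keys p \<subseteq> A"
  shows "meval x p = (\<Sum>m\<in>A. Poly_Mapping.lookup p m * monomial_value x m)"
  unfolding meval_def monomial_value_def[symmetric]
  by (rule sum.mono_neutral_left) (use assms in \<open>auto simp: in_keys_iff\<close>)

lemma meval_0 [simp]: "meval x 0 = 0"
  by (simp add: meval_def)

lemma meval_single [simp]: "meval x (Poly_Mapping.single m c) = c * monomial_value x m"
  by (subst meval_superset[of "{m}"]) auto

lemma meval_1 [simp]: "meval x 1 = 1"
  using meval_single[of x 0 1] by simp

lemma meval_add [simp]: "meval x (p + q) = meval x p + meval x q"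
proof -
  define A where "A = Poly_Mapping.keys p \<union> Poly_Mapping.keys q"
  have "finite A" "Poly_Mapping.keys p \<subseteq> A" "Poly_Mapping.keys q \<subseteq> A" "Poly_Mapping.keys (p + q) \<subseteq> A"
    using keys_add[of p q] by (auto simp: A_def)
  then show ?thesis
    by (simp add: meval_superset[of A] lookup_add distrib_right sum.distrib)
qed

lemma meval_sum: "meval x (\<Sum>i\<in>A. f i) = (\<Sum>i\<in>A. meval x (f i))"
  by (induction A rule: infinite_finite_induct) auto

lemma mpoly_eq_sum_monomials:
  "p = (\<Sum>m\<in>Poly_Mapping.keys p. Poly_Mapping.single m (Poly_Mapping.lookup p m))"
  by (rule poly_mapping_eqI) (auto simp: lookup_sum lookup_single when_def in_keys_iff)

lemma meval_mult [simp]: "meval x (p * q) = meval x p * meval x q"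
proof -
  have "meval x (Poly_Mapping.single m c * Poly_Mapping.single n d) =
    meval x (Poly_Mapping.single m c) * meval x (Poly_Mapping.single n d)" for m n c d
    by (simp add: mult_single monomial_value_add)
  then have monomials: "meval x ((\<Sum>m\<in>A. Poly_Mapping.single m (f m)) * (\<Sum>n\<in>B. Poly_Mapping.single n (g n))) =
     meval x (\<Sum>m\<in>A. Poly_Mapping.single m (f m)) * meval x (\<Sum>n\<in>B. Poly_Mapping.single n (g n))"
    for A B f g
    by (simp only: sum_product meval_sum)
  obtain A f where p: "p = (\<Sum>m\<in>A. Poly_Mapping.single m (f m))"
    using mpoly_eq_sum_monomials[of p] by blast
  obtain B g where q: "q = (\<Sum>m\<in>B. Poly_Mapping.single m (g m))"
    using mpoly_eq_sum_monomials[of q] by blast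
  show ?thesis unfolding p q by (rule monomials)
qed

lemma meval_uminus [simp]: "meval x (- p) = - meval x p"
  by (metis add.right_inverse meval_0 meval_add minus_unique)

lemma meval_diff [simp]: "meval x (p - q) = meval x p - meval x q"
  using meval_add[of x p "- q"] by simp

lemma meval_power [simp]: "meval x (p ^ n) = meval x p ^ n"
  by (induction n) simp_all

lemma is_ideal_linear_subspace_ideal: "is_ideal (linear_subspace_ideal L)"
  by (rule idealI) (auto simp: linear_subspace_ideal_def)

abbreviation scalar :: "complex \<Rightarrow> 'v mpoly" where
  "scalar c \<equiv> Poly_Mapping.single 0 c"

abbreviation var :: "'v \<Rightarrow> 'v mpoly" where
  "var i \<equiv> Poly_Mapping.single (Poly_Mapping.single i 1) 1"

lemma scalar_mult: "scalar (a * b) = scalar a * scalar b"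
  by (simp add: mult_single)

lemma scalar_power: "scalar (a ^ n) = scalar a ^ n"
  by (induction n) (simp_all add: scalar_mult)

lemma scalar_sum: "scalar (\<Sum>i\<in>A. h i) = (\<Sum>i\<in>A. scalar (h i))"
  by (induction A rule: infinite_finite_induct) (simp_all add: single_add)

lemma mono_degree_superset:
  assumes "finite A" "Poly_Mapping.keys m \<subseteq> A"
  shows "mono_degree m = (\<Sum>v\<in>A. Poly_Mapping.lookup m v)"
  unfolding mono_degree_def
  by (rule sum.mono_neutral_left) (use assms in \<open>auto simp: in_keys_iff\<close>)

lemma mono_degree_add: "mono_degree (m + n) = mono_degree m + mono_degree n"
proof -
  define A where "A = Poly_Mapping.keys m \<union> Poly_Mapping.keys n"
  have "finite A" "Poly_Mapping.keys m \<subseteq> A" "Poly_Mapping.keys n \<subseteq> A" "Poly_Mapping.keys (m + n) \<subseteq> A"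
    using keys_add[of m n] by (auto simp: A_def)
  then show ?thesis
    by (simp add: mono_degree_superset[of A] lookup_add sum.distrib)
qed

lemma mono_degree_single [simp]: "mono_degree (Poly_Mapping.single v n) = n"
  by (cases "n = 0") (simp_all add: mono_degree_def)

lemma mono_degree_0 [simp]: "mono_degree 0 = 0"
  by (simp add: mono_degree_def)

lemma mono_degree_eq_0 [simp]: "mono_degree m = 0 \<longleftrightarrow> m = 0"
proof
  assume "mono_degree m = 0"
  then have "Poly_Mapping.lookup m v = 0" for v
    by (cases "v \<in> Poly_Mapping.keys m") (auto simp: mono_degree_def in_keys_iff)
  then show "m = 0" by (intro poly_mapping_eqI) simp
qed simp

lemma mono_degree_SucE:
  assumes "mono_degree m = Suc d"
  obtains i m' where "m = Poly_Mapping.single i 1 + m'" "mono_degree m' = d"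
proof -
  have "m \<noteq> 0" using assms by auto
  then obtain i where i: "Poly_Mapping.lookup m i \<noteq> 0"
    by (metis lookup_zero poly_mapping_eqI)
  define m' where "m' = m - Poly_Mapping.single i 1"
  have m: "m = Poly_Mapping.single i 1 + m'"
    by (rule poly_mapping_eqI) (use i in \<open>auto simp: m'_def lookup_add lookup_minus lookup_single when_def\<close>)
  have "mono_degree m' = d"
    using assms mono_degree_add[of "Poly_Mapping.single i 1" m'] m by simp
  with m that show ?thesis by blast
qed

lemma forms_0 [simp]: "0 \<in> forms d"
  by (simp add: forms_def)

lemma forms_add: "p \<in> forms d \<Longrightarrow> q \<in> forms d \<Longrightarrow> p + q \<in> forms d"
  using keys_add[of p q] unfolding forms_def by blast

lemma forms_uminus: "p \<in> forms d \<Longrightarrow> - p \<in> forms d"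
  by (simp add: forms_def in_keys_iff)

lemma forms_diff: "p \<in> forms d \<Longrightarrow> q \<in> forms d \<Longrightarrow> p - q \<in> forms d"
  using forms_add[of p d "- q"] forms_uminus[of q d] by simp

lemma forms_single: "mono_degree m = d \<Longrightarrow> Poly_Mapping.single m c \<in> forms d"
  by (simp add: forms_def)

lemma forms_scalar: "scalar c \<in> forms 0"
  by (simp add: forms_single)

lemma forms_mult: "p \<in> forms d \<Longrightarrow> q \<in> forms e \<Longrightarrow> p * q \<in> forms (d + e)"
proof -
  assume p: "p \<in> forms d" and q: "q \<in> forms e"
  have "mono_degree m = d + e" if "m \<in> Poly_Mapping.keys (p * q)" for m
  proof -
    from that keys_mult[of p q] obtain a b where
      "m = a + b" "a \<in> Poly_Mapping.keys p" "b \<in> Poly_Mapping.keys q" by blast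
    then show ?thesis using p q by (simp add: forms_def mono_degree_add)
  qed
  then show ?thesis by (simp add: forms_def)
qed

lemma forms_smult: "p \<in> forms d \<Longrightarrow> scalar c * p \<in> forms d"
  using forms_mult[OF forms_scalar, of p d c] by simp

lemma forms_power: "p \<in> forms d \<Longrightarrow> p ^ n \<in> forms (n * d)"
proof (induction n)
  case 0
  then show ?case using forms_scalar[of 1] by simp
next
  case (Suc n)
  then show ?case using forms_mult[of p d "p ^ n" "n * d"] by simp
qed

lemma forms_sum: "(\<And>i. i \<in> A \<Longrightarrow> f i \<in> forms d) \<Longrightarrow> (\<Sum>i\<in>A. f i) \<in> forms d"
  by (induction A rule: infinite_finite_induct) (auto intro: forms_add)

lemma forms_0_scalar: "p \<in> forms 0 \<Longrightarrow> p = scalar (Poly_Mapping.lookup p 0)"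
  by (rule poly_mapping_eqI) (auto simp: forms_def lookup_single when_def in_keys_iff)

lemma forms_induct [consumes 1, case_names zero add single]:
  assumes "p \<in> forms d" "P 0" "\<And>p q. P p \<Longrightarrow> P q \<Longrightarrow> P (p + q)"
    and "\<And>m c. mono_degree m = d \<Longrightarrow> P (Poly_Mapping.single m c)"
  shows "P p"
proof -
  have "P (\<Sum>m\<in>A. Poly_Mapping.single m (Poly_Mapping.lookup p m))"
    if "finite A" "A \<subseteq> Poly_Mapping.keys p" for A
    using that by (induction A) (use assms in \<open>auto simp: forms_def\<close>)
  from this[OF finite_keys subset_refl] show ?thesis
    by (simp only: mpoly_eq_sum_monomials[symmetric])
qed

text \<open>Forms are generated degree by degree by products with variables; the coordinates of a
  plane enter all later inductions through such a product.\<close>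

lemma forms_Suc_induct [consumes 1, case_names zero add mult]:
  assumes "p \<in> forms (Suc d)" "P 0" "\<And>p q. P p \<Longrightarrow> P q \<Longrightarrow> P (p + q)"
    and mult: "\<And>i g. g \<in> forms d \<Longrightarrow> P (var i * g)"
  shows "P p"
  using assms(1)
proof (induction rule: forms_induct)
  case (single m c)
  then obtain i m' where m: "m = Poly_Mapping.single i 1 + m'" "mono_degree m' = d"
    by (metis mono_degree_SucE)
  have "P (var i * Poly_Mapping.single m' c)"
    by (rule mult) (simp add: forms_single m)
  then show ?case by (simp add: mult_single m)
qed (use assms in auto)

definition linear_form :: "complex^5 \<Rightarrow> 5 mpoly" where
  "linear_form \<phi> = (\<Sum>i\<in>UNIV. Poly_Mapping.single (Poly_Mapping.single i 1) (\<phi> $ i))"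

lemma linear_form_forms: "linear_form \<phi> \<in> forms 1"
  unfolding linear_form_def by (intro forms_sum forms_single) simp

lemma meval_linear_form: "meval (($) y) (linear_form \<phi>) = (\<Sum>i\<in>UNIV. \<phi> $ i * y $ i)"
  by (simp add: linear_form_def meval_sum)

lemma linear_form_add: "linear_form (\<phi> + \<psi>) = linear_form \<phi> + linear_form \<psi>"
  by (simp add: linear_form_def single_add sum.distrib)

lemma linear_form_scale: "linear_form (c *s \<phi>) = scalar c * linear_form \<phi>"
  by (simp add: linear_form_def sum_distrib_left mult_single)

lemma var_eq_linear_form: "var i = linear_form (axis i 1)"
proof -
  have "linear_form (axis i 1) = (\<Sum>j\<in>UNIV. if j = i then var i else 0)"
    unfolding linear_form_def by (intro sum.cong) (auto simp: axis_def)
  then show ?thesis by simp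
qed

lemma forms_1E:
  assumes "p \<in> forms 1"
  obtains \<phi> where "p = linear_form \<phi>"
proof -
  have "p \<in> forms (Suc 0)" using assms by simp
  then have "\<exists>\<phi>. p = linear_form \<phi>"
  proof (induction rule: forms_Suc_induct)
    case zero
    have "linear_form 0 = 0" by (simp add: linear_form_def)
    then show ?case by metis
  next
    case (add p q)
    then obtain \<phi> \<psi> where "p = linear_form \<phi>" "q = linear_form \<psi>" by blast
    then have "p + q = linear_form (\<phi> + \<psi>)" by (simp only: linear_form_add)
    then show ?case by blast
  next
    case (mult i g)
    then obtain c where "g = scalar c" using forms_0_scalar by blast
    then have "var i * g = linear_form (c *s axis i 1)"
      by (simp only: linear_form_scale var_eq_linear_form mult.commute)
    then show ?case by blast
  qed
  with that show ?thesis by blast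
qed

lemma meval_forms_1_add: "(p :: 5 mpoly) \<in> forms 1 \<Longrightarrow> meval (($) (x + y)) p = meval (($) x) p + meval (($) y) p"
  by (erule forms_1E) (simp add: meval_linear_form distrib_left sum.distrib)

lemma meval_forms_1_scale: "(p :: 5 mpoly) \<in> forms 1 \<Longrightarrow> meval (($) (k *s x)) p = k * meval (($) x) p"
  by (erule forms_1E) (simp add: meval_linear_form sum_distrib_left mult_ac)

lemma meval_forms_1_0: "(p :: 5 mpoly) \<in> forms 1 \<Longrightarrow> meval (($) 0) p = 0"
  by (erule forms_1E) (simp add: meval_linear_form)

lemma forms_1_vanish_on_span:
  fixes g :: "5 mpoly"
  assumes g: "g \<in> forms 1" and B: "\<And>b. b \<in> B \<Longrightarrow> meval (($) b) g = 0" and y: "y \<in> vec.span B"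
  shows "meval (($) y) g = 0"
proof -
  have "vec.subspace {y. meval (($) y) g = 0}"
    by (intro vec.subspaceI CollectI)
      (simp_all only: mem_Collect_eq meval_forms_1_0[OF g] meval_forms_1_add[OF g]
        meval_forms_1_scale[OF g] add_0_left mult_zero_right)
  then have "vec.span B \<subseteq> {y. meval (($) y) g = 0}"
    using B by (intro vec.span_minimal) auto
  with y show ?thesis by blast
qed

lemma hcomponent_forms: "hcomponent d p \<in> forms d"
  unfolding hcomponent_def by (intro forms_sum forms_single) auto

lemma sum_hcomponent: "p = (\<Sum>d\<in>mono_degree ` Poly_Mapping.keys p. hcomponent d p)"
proof -
  have "p = (\<Sum>m\<in>Poly_Mapping.keys p. Poly_Mapping.single m (Poly_Mapping.lookup p m))"
    by (rule mpoly_eq_sum_monomials)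
  also have "\<dots> = (\<Sum>d\<in>mono_degree ` Poly_Mapping.keys p. hcomponent d p)"
    unfolding hcomponent_def by (rule sum.image_gen) simp
  finally show ?thesis .
qed

lemma finite_monomials_of_degree: "finite {m :: 'v::finite mono. mono_degree m = d}"
proof (induction d)
  case (Suc d)
  have "{m :: 'v mono. mono_degree m = Suc d} \<subseteq>
    (\<Union>i\<in>UNIV. (+) (Poly_Mapping.single i 1) ` {m. mono_degree m = d})"
  proof
    fix m :: "'v mono" assume "m \<in> {m. mono_degree m = Suc d}"
    then obtain i m' where "m = Poly_Mapping.single i 1 + m'" "mono_degree m' = d"
      by (auto elim: mono_degree_SucE)
    then show "m \<in> (\<Union>i\<in>UNIV. (+) (Poly_Mapping.single i 1) ` {m. mono_degree m = d})" by blast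
  qed
  then show ?case
    by (rule finite_subset) (intro finite_UN_I finite_imageI Suc finite)
qed simp

section \<open>Saturation\<close>

lemma all_forms_multiplier_Suc:
  assumes "is_ideal I" "\<forall>g\<in>forms k. g * p \<in> I"
  shows "\<forall>g\<in>forms (Suc k). g * p \<in> I"
proof
  fix g :: "'a mpoly" assume "g \<in> forms (Suc k)"
  then show "g * p \<in> I"
  proof (induction rule: forms_Suc_induct)
    case (add g h)
    then show ?case by (simp add: distrib_right ideal_add[OF assms(1)])
  next
    case (mult i g)
    then have "var i * (g * p) \<in> I" using assms(2) ideal_scale[OF assms(1)] by blast
    then show ?case by (simp only: mult.assoc)
  qed (simp add: ideal_0[OF assms(1)])
qed

lemma all_forms_multiplier_mono:
  assumes "is_ideal I" "\<forall>g\<in>forms k. g * p \<in> I" "k \<le> l"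
  shows "\<forall>g\<in>forms l. g * p \<in> I"
  using assms(3,2)
proof (induction rule: dec_induct)
  case (step n)
  from all_forms_multiplier_Suc[OF assms(1) step.IH[OF step.prems]] show ?case .
qed

lemma mem_saturation_iff:
  assumes "is_ideal I"
  shows "p \<in> saturation I \<longleftrightarrow> (\<exists>k. \<forall>g\<in>forms k. g * p \<in> I)"
proof -
  have equiv: "(\<forall>m. mono_degree m = k \<longrightarrow> Poly_Mapping.single m 1 * p \<in> I) \<longleftrightarrow> (\<forall>g\<in>forms k. g * p \<in> I)" for k
  proof safe
    fix g :: "'a mpoly" assume *: "\<forall>m. mono_degree m = k \<longrightarrow> Poly_Mapping.single m 1 * p \<in> I" and "g \<in> forms k"
    from \<open>g \<in> forms k\<close> show "g * p \<in> I"
    proof (induction rule: forms_induct)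
      case (add g h)
      then show ?case by (simp add: distrib_right ideal_add[OF assms])
    next
      case (single m c)
      have "Poly_Mapping.single m c = scalar c * Poly_Mapping.single m 1"
        by (simp add: mult_single)
      then have "Poly_Mapping.single m c * p = scalar c * (Poly_Mapping.single m 1 * p)"
        by (simp only: mult.assoc)
      also have "\<dots> \<in> I" using * single ideal_scale[OF assms] by blast
      finally show ?case .
    qed (simp add: ideal_0[OF assms])
  next
    fix m :: "'a mono" assume "\<forall>g\<in>forms (mono_degree m). g * p \<in> I"
    then show "Poly_Mapping.single m 1 * p \<in> I" using forms_single by blast
  qed
  then show ?thesis by (simp only: saturation_def mem_Collect_eq equiv)
qed

lemma is_ideal_saturation:
  assumes I: "is_ideal I"
  shows "is_ideal (saturation I)"
proof (rule idealI)
  show "0 \<in> saturation I"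
    using I by (auto simp: mem_saturation_iff ideal_0)
next
  fix p q assume "p \<in> saturation I" "q \<in> saturation I"
  then obtain k l where "\<forall>g\<in>forms k. g * p \<in> I" "\<forall>g\<in>forms l. g * q \<in> I"
    using I by (auto simp: mem_saturation_iff)
  then have "\<forall>g\<in>forms (max k l). g * (p + q) \<in> I"
    using all_forms_multiplier_mono[OF I, of k p "max k l"]
      all_forms_multiplier_mono[OF I, of l q "max k l"]
    by (simp add: distrib_left ideal_add[OF I])
  then show "p + q \<in> saturation I" using I by (auto simp: mem_saturation_iff)
next
  fix c p assume "p \<in> saturation I"
  then obtain k where "\<forall>g\<in>forms k. g * p \<in> I"
    using I by (auto simp: mem_saturation_iff)
  then have "\<forall>g\<in>forms k. g * (c * p) \<in> I"
    using ideal_scale[OF I] by (metis mult.left_commute)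
  then show "c * p \<in> saturation I"
    using I by (auto simp: mem_saturation_iff)
qed

lemma subset_saturation: "is_ideal I \<Longrightarrow> I \<subseteq> saturation I"
  using ideal_scale[of I] by (auto simp: mem_saturation_iff)

text \<open>Saturating twice gives nothing new: there are finitely many monomials of degree k, so one
  exponent serves for all of them.\<close>

lemma mem_saturationI:
  fixes I :: "'v::finite mpoly set"
  assumes I: "is_ideal I" and *: "\<And>g. g \<in> forms k \<Longrightarrow> g * p \<in> saturation I"
  shows "p \<in> saturation I"
proof -
  let ?M = "{m :: 'v mono. mono_degree m = k}"
  have "\<exists>l. \<forall>g\<in>forms l. g * (Poly_Mapping.single m 1 * p) \<in> I" if "m \<in> ?M" for m
    using *[of "Poly_Mapping.single m 1"] that I by (auto simp: mem_saturation_iff forms_single)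
  then obtain l where l: "\<And>m g. m \<in> ?M \<Longrightarrow> g \<in> forms (l m) \<Longrightarrow> g * (Poly_Mapping.single m 1 * p) \<in> I"
    by metis
  define N where "N = Max (insert 0 (l ` ?M))"
  have N: "g * (Poly_Mapping.single m 1 * p) \<in> I" if "m \<in> ?M" "g \<in> forms N" for m g
  proof -
    have "l m \<le> N" unfolding N_def using that finite_monomials_of_degree by (intro Max_ge) auto
    then show ?thesis using all_forms_multiplier_mono[OF I, of "l m"] l that by blast
  qed
  have "h * (g * p) \<in> saturation I \<and> (\<forall>h\<in>forms N. h * (g * p) \<in> I)" if "g \<in> forms k" for g h
    using that
  proof (induction rule: forms_induct)
    case zero
    then show ?case using I is_ideal_saturation[OF I] by (simp add: ideal_0)
  next
    case (add g g')
    then show ?case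
      by (simp add: distrib_left distrib_right ideal_add[OF I]
          ideal_add[OF is_ideal_saturation[OF I]])
  next
    case (single m c)
    then have "h * (Poly_Mapping.single m c * p) \<in> saturation I" for h
      by (intro ideal_scale[OF is_ideal_saturation[OF I]] * forms_single)
    moreover have "h * (Poly_Mapping.single m c * p) \<in> I" if "h \<in> forms N" for h
    proof -
      have split: "Poly_Mapping.single m c = scalar c * Poly_Mapping.single m 1"
        by (simp add: mult_single)
      have "h * (Poly_Mapping.single m c * p) = scalar c * (h * (Poly_Mapping.single m 1 * p))"
        by (simp only: split mult_ac)
      also have "\<dots> \<in> I" using N[of m h] single that ideal_scale[OF I] by blast
      finally show ?thesis .
    qed
    ultimately show ?case by blast
  qed
  then have N: "\<forall>g\<in>forms k. \<forall>h\<in>forms N. h * (g * p) \<in> I" by blast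
  have "\<forall>g\<in>forms (k + N). g * p \<in> I"
  proof
    fix g :: "'v mpoly" assume g: "g \<in> forms (k + N)"
    have "\<forall>g\<in>forms (j + N). \<forall>h\<in>forms (k - j). g * (h * p) \<in> I" if "j \<le> k" for j
      using that
    proof (induction j)
      case (Suc j)
      show ?case
      proof (intro ballI)
        fix g h :: "'v mpoly" assume g: "g \<in> forms (Suc j + N)" and h: "h \<in> forms (k - Suc j)"
        have "g \<in> forms (Suc (j + N))" using g by simp
        then show "g * (h * p) \<in> I"
        proof (induction rule: forms_Suc_induct)
          case (mult i g)
          have "var i * h \<in> forms (1 + (k - Suc j))"
            using h by (intro forms_mult forms_single) auto
          then have "var i * h \<in> forms (k - j)" using Suc.prems by (simp add: Suc_diff_Suc)
          moreover have "\<forall>g\<in>forms (j + N). \<forall>h\<in>forms (k - j). g * (h * p) \<in> I"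
            using Suc by simp
          ultimately have "g * ((var i * h) * p) \<in> I" using mult by blast
          then show ?case by (simp only: mult_ac)
        next
          case (add g g')
          then show ?case by (simp add: distrib_right ideal_add[OF I])
        qed (simp add: ideal_0[OF I])
      qed
    qed (use N in simp)
    then have "g * (scalar 1 * p) \<in> I"
      using g forms_scalar[of 1] by (metis diff_self_eq_0 order_refl)
    then show "g * p \<in> I" by simp
  qed
  then show ?thesis using I by (auto simp: mem_saturation_iff)
qed

text \<open>A form \<open>t\<close> without zeros on the scheme of a saturated ideal is no zero divisor modulo the
  ideal. That \<open>t\<close> has no zeros is expressed by the divisibility by \<open>t\<close> of all forms of some
  degree: then all of them multiply \<open>g\<close> into the ideal as soon as \<open>t\<close> does.\<close>

lemma saturated_cancel:
  fixes I :: "'a mpoly set"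
  assumes I: "is_ideal I" and saturated: "saturation I = I"
    and cover: "\<forall>g\<in>forms k. \<exists>h. g - t * h \<in> I" and tg: "t * g \<in> I"
  shows "g \<in> I"
proof -
  have "\<forall>e\<in>forms k. e * g \<in> I"
  proof
    fix e :: "'a mpoly" assume "e \<in> forms k"
    then obtain h where h: "e - t * h \<in> I" using cover by blast
    have "e * g = g * (e - t * h) + h * (t * g)" by (simp add: algebra_simps)
    also have "\<dots> \<in> I"
      by (intro ideal_add[OF I] ideal_scale[OF I] h tg)
    finally show "e * g \<in> I" .
  qed
  then show ?thesis using mem_saturation_iff[OF I] saturated by blast
qed

section \<open>Normal forms in a plane and the linkage determinant\<close>

text \<open>The structure constants of a scheme that is, in the chart \<open>T = 1\<close> of a plane, the graph
  \<open>y = a + b x + c x^2\<close> over the zeros of \<open>x^3 - p2 x^2 - p1 x - p0\<close>. Modulo the scheme, the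
  products \<open>T Y\<close>, \<open>X Y\<close> and \<open>Y^2\<close> are quadratic forms in \<open>X\<close> and \<open>T\<close>, with the coefficients
  \<open>c, b, a\<close>, then \<open>n12, n11, n10\<close>, and then \<open>n22, n21, n20\<close>. The constants live in an
  arbitrary domain because they are used both as numbers and as constant polynomials.\<close>

locale plane_chart =
  fixes a b c p0 p1 p2 :: "'r::idom"
begin

definition "n12 = b + c * p2"
definition "n11 = a + c * p1"
definition "n10 = c * p0"
definition "n22 = a * c + b^2 + c * n11 + c * (b + n12) * p2"
definition "n21 = 2 * a * b + c * n10 + c * (b + n12) * p1"
definition "n20 = a^2 + c * (b + n12) * p0"

definition "cubic T X = X^3 - p2 * X^2 * T - p1 * X * T^2 - p0 * T^3"
definition "quad0 T X Y = T * Y - (c * X^2 + b * X * T + a * T^2)"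
definition "quad1 T X Y = X * Y - (n12 * X^2 + n11 * X * T + n10 * T^2)"
definition "quad2 T X Y = Y^2 - (n22 * X^2 + n21 * X * T + n20 * T^2)"

text \<open>Besides multiples of \<open>quad0\<close>, the right-hand sides here and in the next lemma only have
  terms divisible by \<open>c\<close>. All factors \<open>c\<close> in the linkage equations come from this.\<close>

lemma T_quad1: "T * quad1 T X Y = X * quad0 T X Y + c * cubic T X"
  unfolding quad1_def quad0_def cubic_def n12_def n11_def n10_def by algebra

lemma T_quad2:
  "T * quad2 T X Y = (Y + a * T + b * X) * quad0 T X Y + c * X * quad1 T X Y
     + c * (b + n12) * cubic T X"
  unfolding quad1_def quad2_def quad0_def cubic_def n22_def n21_def n20_def by algebra

lemma quads_mem:
  assumes I: "module.subspace (*) I" and cancel: "\<And>g. T * g \<in> I \<Longrightarrow> g \<in> I"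
    and q0: "quad0 T X Y \<in> I" and P: "cubic T X \<in> I"
  shows "quad1 T X Y \<in> I" "quad2 T X Y \<in> I"
proof -
  show q1: "quad1 T X Y \<in> I"
    by (rule cancel, subst T_quad1) (intro ideal_add[OF I] ideal_scale[OF I] q0 P)
  show "quad2 T X Y \<in> I"
    by (rule cancel, subst T_quad2) (intro ideal_add[OF I] ideal_scale[OF I] q0 P q1)
qed

text \<open>The multiplication table of the normal forms: by repeated use of it, every form becomes a
  power of \<open>T\<close> times a quadratic form in \<open>X\<close> and \<open>T\<close>.\<close>

lemma linear_times_normal_form:
  "(s * T + u * X + v * Y) * (r2 * X^2 + r1 * X * T + r0 * T^2) -
   T * ((s * r2 + u * r1 + u * r2 * p2 + v * (r2 * (n12 * p2 + n11) + r1 * n12 + r0 * c)) * X^2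
      + (s * r1 + u * r0 + u * r2 * p1 + v * (r2 * (n12 * p1 + n10) + r1 * n11 + r0 * b)) * X * T
      + (s * r0 + u * r2 * p0 + v * (r2 * n12 * p0 + r1 * n10 + r0 * a)) * T^2)
   = (u * r2 + v * r2 * n12) * cubic T X + (v * r2 * X + v * r1 * T) * quad1 T X Y + v * r0 * T * quad0 T X Y"
  unfolding quad1_def quad0_def cubic_def by algebra

end

text \<open>The restrictions to the plane of a quadric and a cubic through the scheme: \<open>A, B, D\<close> are
  the coefficients of \<open>Y^2, X Y, T Y\<close> in the quadric, and \<open>y3, y2x, y2t, yxx, yxt, ytt, f3\<close>
  are those of \<open>Y^3, X Y^2, T Y^2, X^2 Y, X T Y, T^2 Y, X^3\<close> in the cubic. The remaining
  coefficients are determined by the condition that both contain the scheme.\<close>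

locale plane_section = plane_chart a b c p0 p1 p2
  for a b c p0 p1 p2 :: "'r::idom" +
  fixes A B D y3 y2x y2t yxx yxt ytt f3 :: 'r
begin

text \<open>Division of the cubic form by \<open>quad2\<close>, \<open>quad1\<close> and \<open>quad0\<close> has the linear quotients
  \<open>lin2\<close>, \<open>lin1\<close> and \<open>lin0\<close>, and \<open>d0\<close> is the coefficient of \<open>X^3\<close> in the remainder.\<close>

definition "m11 = yxx + y3 * n22"
definition "m01 = yxt + y3 * n21"
definition "m00 = ytt + y3 * n20"
definition "lin0 T X = m01 * X + m00 * T"
definition "lin1 X = m11 * X"
definition "lin2 T X Y = y3 * Y + y2x * X + y2t * T"
definition "d0 = f3 + y2x * n22 + m11 * n12 + m01 * c"

lemma quadric_normal_form:
  "A * Y^2 + B * X * Y + D * T * Y + C * X^2 + E * X * T + F * T^2 -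
     (A * quad2 T X Y + B * quad1 T X Y + D * quad0 T X Y) =
   (A * n22 + B * n12 + D * c + C) * X^2 + (A * n21 + B * n11 + D * b + E) * X * T
     + (A * n20 + B * n10 + D * a + F) * T^2"
  unfolding quad2_def quad1_def quad0_def by algebra

lemma cubic_normal_form:
  "y3 * Y^3 + y2x * X * Y^2 + y2t * T * Y^2 + yxx * X^2 * Y + yxt * X * T * Y + ytt * T^2 * Y +
     f3 * X^3 + f2 * X^2 * T + f1 * X * T^2 + f0 * T^3 -
     (d0 * cubic T X + lin0 T X * quad0 T X Y + lin1 X * quad1 T X Y + lin2 T X Y * quad2 T X Y) =
   T * ((f2 + y2x * n21 + y2t * n22 + m11 * n11 + m01 * b + m00 * c + d0 * p2) * X^2
     + (f1 + y2x * n20 + y2t * n21 + m11 * n10 + m01 * a + m00 * b + d0 * p1) * X * T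
     + (f0 + y2t * n20 + m00 * a + d0 * p0) * T^2)"
  unfolding quad2_def quad1_def quad0_def cubic_def lin0_def lin1_def lin2_def d0_def m11_def m01_def m00_def
  by algebra

text \<open>The normal forms, modulo the scheme, of the four entries of the determinant below: \<open>qW\<close> is
  \<open>r2 X^2 + r1 X T + r0 T^2\<close>, \<open>qP\<close> is \<open>c (e1 X + e0 T)\<close>, \<open>fW\<close> is
  \<open>T (g2 X^2 + g1 X T + g0 T^2)\<close>, and \<open>fP\<close> is \<open>d0 T^2 + c (k2 X^2 + k1 X T + k0 T^2)\<close>. The
  coefficients of the normal form of \<open>(e1 X + e0 T) fW - qW (fP - d0 T^2) / c\<close> are
  \<open>theta2, theta1, theta0\<close>.\<close>

definition "e1 = A * c"
definition "e0 = A * (b + n12) + B"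
definition "r2 = 2 * A * c"
definition "r1 = 2 * A * b + B"
definition "r0 = 2 * A * a + D"
definition "g2 = m11 + 2 * (y2x * c * p2 + y2x * b + y2t * c) + 2 * y3 * (a * c + b * n12 + c * (n12 * p2 + n11))"
definition "g1 = m01 + 2 * (y2x * c * p1 + y2x * a + y2t * b) + 2 * y3 * (a * b + b * n11 + c * (n12 * p1 + n10))"
definition "g0 = m00 + 2 * (y2x * c * p0 + y2t * a) + 2 * y3 * (a^2 + b * n10 + c * n12 * p0)"
definition "k2 = y2x * c + y3 * (c * n12 + (b + n12) * c)"
definition "k1 = m11 + y2x * (b + n12) + y2t * c + y3 * (c * n11 + (b + n12) * b)"
definition "k0 = y2t * (b + n12) + y3 * (c * n10 + (b + n12) * a)"
definition "theta2 = e1 * g2 * p2 + e1 * g1 + e0 * g2 -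
   (r2 * k2 * (p2^2 + p1) + (r2 * k1 + r1 * k2) * p2 + (r2 * k0 + r1 * k1 + r0 * k2))"
definition "theta1 = e1 * g2 * p1 + e1 * g0 + e0 * g1 -
   (r2 * k2 * (p2 * p1 + p0) + (r2 * k1 + r1 * k2) * p1 + (r1 * k0 + r0 * k1))"
definition "theta0 = e1 * g2 * p0 + e0 * g0 -
   (r2 * k2 * (p2 * p0) + (r2 * k1 + r1 * k2) * p0 + r0 * k0)"

text \<open>The coefficients of \<open>quad0\<close> and \<open>cubic\<close> in the equations of the surface, multiplied by
  \<open>T^2\<close> to clear denominators.\<close>

definition "qW T X Y = A * (T * Y + a * T^2 + b * X * T + c * X^2) + B * T * X + D * T^2"
definition "qP T X = c * (e1 * X + e0 * T)"
definition "fW T X Y = lin0 T X * T^2 + lin1 X * T * X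
   + lin2 T X Y * (T * Y + a * T^2 + b * X * T + c * X^2)"
definition "fP T X Y = d0 * T^2 + c * (lin1 X * T + lin2 T X Y * (c * X + (b + n12) * T))"
definition "determinant T X Y = qW T X Y * fP T X Y - qP T X * fW T X Y"

lemma T2_quadric:
  "T^2 * (A * quad2 T X Y + B * quad1 T X Y + D * quad0 T X Y) =
   qW T X Y * quad0 T X Y + qP T X * cubic T X"
proof -
  have "T^2 * (A * quad2 T X Y + B * quad1 T X Y + D * quad0 T X Y) =
     A * T * (T * quad2 T X Y) + B * T * (T * quad1 T X Y) + D * T^2 * quad0 T X Y"
    by algebra
  also have "\<dots> = A * (T * ((Y + a * T + b * X) * quad0 T X Y) + c * X * (T * quad1 T X Y)
     + T * (c * (b + n12) * cubic T X)) + B * T * (T * quad1 T X Y) + D * T^2 * quad0 T X Y"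
    unfolding T_quad2 by algebra
  also have "\<dots> = qW T X Y * quad0 T X Y + qP T X * cubic T X"
    unfolding T_quad1 qW_def qP_def e1_def e0_def by algebra
  finally show ?thesis .
qed

lemma T2_cubic:
  "T^2 * (d0 * cubic T X + lin0 T X * quad0 T X Y + lin1 X * quad1 T X Y + lin2 T X Y * quad2 T X Y) =
   fW T X Y * quad0 T X Y + fP T X Y * cubic T X"
proof -
  have "T^2 * (d0 * cubic T X + lin0 T X * quad0 T X Y + lin1 X * quad1 T X Y + lin2 T X Y * quad2 T X Y) =
     d0 * T^2 * cubic T X + lin0 T X * T^2 * quad0 T X Y + lin1 X * T * (T * quad1 T X Y) +
     lin2 T X Y * T * (T * quad2 T X Y)"
    by algebra
  also have "\<dots> = d0 * T^2 * cubic T X + lin0 T X * T^2 * quad0 T X Y + lin1 X * T * (T * quad1 T X Y) +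
     lin2 T X Y * (T * ((Y + a * T + b * X) * quad0 T X Y) + c * X * (T * quad1 T X Y)
     + T * (c * (b + n12) * cubic T X))"
    unfolding T_quad2 by algebra
  also have "\<dots> = fW T X Y * quad0 T X Y + fP T X Y * cubic T X"
    unfolding T_quad1 fW_def fP_def by algebra
  finally show ?thesis .
qed

text \<open>This is Cramer's rule.\<close>

lemma determinant_multiplies_into:
  assumes J: "module.subspace (*) J"
    and q: "A * quad2 T X Y + B * quad1 T X Y + D * quad0 T X Y \<in> J" (is "?q \<in> J")
    and f: "d0 * cubic T X + lin0 T X * quad0 T X Y + lin1 X * quad1 T X Y + lin2 T X Y * quad2 T X Y \<in> J"
      (is "?f \<in> J")
  shows "determinant T X Y * quad0 T X Y \<in> J" "determinant T X Y * cubic T X \<in> J"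
proof -
  have "determinant T X Y * quad0 T X Y = fP T X Y * T^2 * ?q - qP T X * T^2 * ?f"
    using T2_quadric[of T X Y] T2_cubic[of T X Y] unfolding determinant_def by algebra
  also have "\<dots> \<in> J" by (intro ideal_diff[OF J] ideal_scale[OF J] q f)
  finally show "determinant T X Y * quad0 T X Y \<in> J" .
  have "determinant T X Y * cubic T X = qW T X Y * T^2 * ?f - fW T X Y * T^2 * ?q"
    using T2_quadric[of T X Y] T2_cubic[of T X Y] unfolding determinant_def by algebra
  also have "\<dots> \<in> J" by (intro ideal_diff[OF J] ideal_scale[OF J] q f)
  finally show "determinant T X Y * cubic T X \<in> J" .
qed

lemma fW_normal_form:
  "fW T X Y - T * (g2 * X^2 + g1 * X * T + g0 * T^2) =
   (lin2 T X Y + 2 * y3 * a * T) * quad0 T X Y + 2 * y3 * (c * X + b * T) * quad1 T X Y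
   + (2 * y3 * c * n12 + 2 * y2x * c) * cubic T X"
  unfolding fW_def g2_def g1_def g0_def lin0_def lin1_def lin2_def quad0_def quad1_def cubic_def
  by algebra

lemma fP_normal_form:
  "fP T X Y - (d0 * T^2 + c * (k2 * X^2 + k1 * X * T + k0 * T^2)) =
   c * y3 * c * quad1 T X Y + c * y3 * (b + n12) * quad0 T X Y"
  unfolding fP_def k2_def k1_def k0_def lin1_def lin2_def quad0_def quad1_def
  by algebra

lemma qW_normal_form: "qW T X Y - (r2 * X^2 + r1 * X * T + r0 * T^2) = A * quad0 T X Y"
  unfolding qW_def r2_def r1_def r0_def quad0_def by algebra

lemma product_normal_form:
  "(r2 * X^2 + r1 * X * T + r0 * T^2) * (d0 * T^2 + c * (k2 * X^2 + k1 * X * T + k0 * T^2))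
   - c * (e1 * X + e0 * T) * (T * (g2 * X^2 + g1 * X * T + g0 * T^2))
   - T^2 * ((d0 * r2 - c * theta2) * X^2 + (d0 * r1 - c * theta1) * X * T + (d0 * r0 - c * theta0) * T^2)
   = (c * r2 * k2 * (X + p2 * T) + c * (r2 * k1 + r1 * k2) * T - c * e1 * g2 * T) * cubic T X"
  unfolding theta2_def theta1_def theta0_def cubic_def by algebra

text \<open>Reduction of the four entries to normal form, and then of their products with the equation
  of \<open>cubic\<close>.\<close>

lemma determinant_normal_form:
  assumes I: "module.subspace (*) I"
    and mem: "quad0 T X Y \<in> I" "quad1 T X Y \<in> I" "cubic T X \<in> I"
  shows "determinant T X Y - T^2 * ((d0 * r2 - c * theta2) * X^2
     + (d0 * r1 - c * theta1) * X * T + (d0 * r0 - c * theta0) * T^2) \<in> I" (is "_ - ?N \<in> I")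
proof -
  let ?g = "T * (g2 * X^2 + g1 * X * T + g0 * T^2)"
  let ?k = "d0 * T^2 + c * (k2 * X^2 + k1 * X * T + k0 * T^2)"
  let ?r = "r2 * X^2 + r1 * X * T + r0 * T^2"
  note closed = ideal_add[OF I] ideal_diff[OF I] ideal_scale[OF I]
  have 1: "fW T X Y - ?g \<in> I" unfolding fW_normal_form by (intro closed mem)
  have 2: "fP T X Y - ?k \<in> I" unfolding fP_normal_form by (intro closed mem)
  have 3: "qW T X Y - ?r \<in> I" unfolding qW_normal_form by (intro closed mem)
  have 4: "?r * ?k - c * (e1 * X + e0 * T) * ?g - ?N \<in> I"
    unfolding product_normal_form by (intro closed mem)
  have "determinant T X Y - ?N = fP T X Y * (qW T X Y - ?r) + ?r * (fP T X Y - ?k)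
     - c * (e1 * X + e0 * T) * (fW T X Y - ?g) + (?r * ?k - c * (e1 * X + e0 * T) * ?g - ?N)"
    unfolding determinant_def qP_def by algebra
  also have "\<dots> \<in> I" by (intro closed 1 2 3 4)
  finally show ?thesis .
qed

end

section \<open>Schemes of length 3 in a plane\<close>

lemma is_ideal_ideal_sum:
  assumes I: "is_ideal I" and J: "is_ideal J"
  shows "is_ideal (ideal_sum I J)"
proof (rule idealI)
  show "0 \<in> ideal_sum I J"
    unfolding ideal_sum_def using ideal_0[OF I] ideal_0[OF J] by force
next
  fix x y assume "x \<in> ideal_sum I J" "y \<in> ideal_sum I J"
  then obtain a b a' b' where "x = a + b" "y = a' + b'" "a \<in> I" "a' \<in> I" "b \<in> J" "b' \<in> J"
    unfolding ideal_sum_def by blast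
  moreover have "(a + b) + (a' + b') = (a + a') + (b + b')" by (simp add: algebra_simps)
  ultimately show "x + y \<in> ideal_sum I J"
    unfolding ideal_sum_def using ideal_add[OF I] ideal_add[OF J] by blast
next
  fix k x assume "x \<in> ideal_sum I J"
  then obtain a b where "x = a + b" "a \<in> I" "b \<in> J"
    unfolding ideal_sum_def by blast
  moreover have "k * (a + b) = k * a + k * b" by (rule distrib_left)
  ultimately show "k * x \<in> ideal_sum I J"
    unfolding ideal_sum_def using ideal_scale[OF I] ideal_scale[OF J] by blast
qed

lemma is_ideal_surface_ideal: "is_ideal (surface_ideal q f)"
  unfolding surface_ideal_def by (rule ideal_subspace_span)

lemma surface_ideal_generators: "q \<in> surface_ideal q f" "f \<in> surface_ideal q f"
  unfolding surface_ideal_def using ideal_span_superset by blast+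

text \<open>A scheme \<open>Z\<close> of length 3 in a plane \<open>L\<close>, with coordinates \<open>T, X, Y\<close> on \<open>L\<close>, the dual basis
  \<open>uT, uX, uY\<close> of \<open>L\<close>, and \<open>T^3, X T^2, X^2 T\<close> as a basis of the cubic forms modulo \<open>Z\<close>.
  Independence of this basis and divisibility by \<open>T\<close> of all cubic forms stand for the
  Hilbert function of \<open>Z\<close>.\<close>

locale plane_scheme =
  fixes Z :: "5 mpoly set" and L :: "(complex^5) set"
    and T X Y :: "5 mpoly" and uT uX uY :: "complex^5"
    and a b c p0 p1 p2 :: complex
  assumes homogeneous: "homogeneous_ideal Z" and saturated: "saturation Z = Z"
    and plane: "linear_subspace_ideal L \<subseteq> Z"
    and linear: "T \<in> forms 1" "X \<in> forms 1" "Y \<in> forms 1"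
    and subspace: "vec.subspace L" and basis_mem: "uT \<in> L" "uX \<in> L" "uY \<in> L"
    and dual: "meval (($) uT) T = 1" "meval (($) uT) X = 0" "meval (($) uT) Y = 0"
      "meval (($) uX) T = 0" "meval (($) uX) X = 1" "meval (($) uX) Y = 0"
      "meval (($) uY) T = 0" "meval (($) uY) X = 0" "meval (($) uY) Y = 1"
    and coordinates: "\<And>y. y \<in> L \<Longrightarrow>
      y = meval (($) y) T *s uT + meval (($) y) X *s uX + meval (($) y) Y *s uY"
    and independent: "\<And>r2 r1 r0. T * (scalar r2 * X^2 + scalar r1 * X * T + scalar r0 * T^2) \<in> Z
      \<Longrightarrow> r2 = 0 \<and> r1 = 0 \<and> r0 = 0"
    and cover: "\<forall>g\<in>forms 3. \<exists>h. g - T * h \<in> Z"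
    and quad0_mem: "T * plane_chart.quad0 (scalar a) (scalar b) (scalar c) T X Y \<in> Z"
    and cubic_mem: "plane_chart.cubic (scalar p0) (scalar p1) (scalar p2) T X \<in> Z"
begin

sublocale R: plane_chart "scalar a" "scalar b" "scalar c" "scalar p0" "scalar p1" "scalar p2" .

abbreviation K where "K \<equiv> linear_subspace_ideal L"

lemma ideal_Z: "is_ideal Z"
  using homogeneous by (simp add: homogeneous_ideal_def)

lemma ideal_K: "is_ideal K"
  by (rule is_ideal_linear_subspace_ideal)

lemma T_cancel_Z: "T * g \<in> Z \<Longrightarrow> g \<in> Z"
  by (rule saturated_cancel[OF ideal_Z saturated cover])

lemma T_power_cancel_Z: "T^n * g \<in> Z \<Longrightarrow> g \<in> Z"
  by (induction n) (auto simp: mult.assoc intro: T_cancel_Z)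

lemma normal_form_zero:
  assumes "scalar r2 * X^2 + scalar r1 * X * T + scalar r0 * T^2 \<in> Z"
  shows "r2 = 0" "r1 = 0" "r0 = 0"
  using independent[OF ideal_scale[OF ideal_Z assms]] by blast+

lemma quads_mem_Z: "R.quad0 T X Y \<in> Z" "R.quad1 T X Y \<in> Z" "R.quad2 T X Y \<in> Z"
  using T_cancel_Z quad0_mem R.quads_mem[OF ideal_Z T_cancel_Z _ cubic_mem] by blast+

lemmas scalar_hom = scalar_mult scalar_power single_add single_diff

lemma var_mod_K: "var i - (scalar (uT $ i) * T + scalar (uX $ i) * X + scalar (uY $ i) * Y) \<in> K"
  unfolding linear_subspace_ideal_def
proof safe
  fix y assume "y \<in> L"
  from arg_cong[OF coordinates[OF this], of "\<lambda>y. y $ i"]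
  show "meval (($) y) (var i - (scalar (uT $ i) * T + scalar (uX $ i) * X + scalar (uY $ i) * Y)) = 0"
    by (simp add: mult.commute)
qed

lemma linear_form_mod_K:
  assumes g: "g \<in> forms 1"
  shows "g - (scalar (meval (($) uT) g) * T + scalar (meval (($) uX) g) * X
    + scalar (meval (($) uY) g) * Y) \<in> K"
  unfolding linear_subspace_ideal_def
proof safe
  fix y assume "y \<in> L"
  from arg_cong[OF coordinates[OF this], of "\<lambda>y. meval (($) y) g"]
  show "meval (($) y) (g - (scalar (meval (($) uT) g) * T + scalar (meval (($) uX) g) * X
      + scalar (meval (($) uY) g) * Y)) = 0"
    by (simp add: meval_forms_1_add[OF g] meval_forms_1_scale[OF g] mult.commute)
qed

text \<open>On \<open>L\<close> the form \<open>g\<close> is a combination of \<open>T, X, Y\<close>, and the normal form of \<open>T g\<close> has to be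
  zero.\<close>

lemma linear_form_mem_Z:
  assumes g: "g \<in> forms 1" "g \<in> Z"
  defines "v \<equiv> meval (($) uY) g"
  shows "v * c = 0" "meval (($) uX) g + v * b = 0" "meval (($) uT) g + v * a = 0"
proof -
  define s u where su: "s = meval (($) uT) g" "u = meval (($) uX) g"
  have "scalar s * T + scalar u * X + scalar v * Y \<in> Z"
    using ideal_cong[OF ideal_Z] linear_form_mod_K[OF g(1)] plane g(2) unfolding su v_def by blast
  then have "T * (scalar s * T + scalar u * X + scalar v * Y) - scalar v * R.quad0 T X Y \<in> Z"
    by (intro ideal_diff[OF ideal_Z] ideal_scale[OF ideal_Z] quads_mem_Z)
  also have "T * (scalar s * T + scalar u * X + scalar v * Y) - scalar v * R.quad0 T X Y
    = scalar (v * c) * X^2 + scalar (u + v * b) * X * T + scalar (s + v * a) * T^2"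
    unfolding R.quad0_def scalar_hom by algebra
  finally show "v * c = 0" "meval (($) uX) g + v * b = 0" "meval (($) uT) g + v * a = 0"
    using normal_form_zero su by blast+
qed

lemma linear_span_subset: "linear_span Z \<subseteq> L"
proof
  fix x assume x: "x \<in> linear_span Z"
  have "x = meval (($) x) T *s uT + meval (($) x) X *s uX + meval (($) x) Y *s uY"
  proof (subst vec_eq_iff, rule allI)
    fix i
    let ?g = "var i - (scalar (uT $ i) * T + scalar (uX $ i) * X + scalar (uY $ i) * Y)"
    have "?g \<in> forms 1"
      by (intro forms_diff forms_add forms_smult linear forms_single) simp
    then have "meval (($) x) ?g = 0"
      using x var_mod_K[of i] plane unfolding linear_span_def by blast
    then show "x $ i = (meval (($) x) T *s uT + meval (($) x) X *s uX + meval (($) x) Y *s uY) $ i"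
      by (simp add: mult.commute)
  qed
  also have "\<dots> \<in> L"
    by (intro vec.subspace_add[OF subspace] vec.subspace_scale[OF subspace] basis_mem)
  finally show "x \<in> L" .
qed

text \<open>By \<open>linear_form_mem_Z\<close>, a linear form in \<open>Z\<close> that is not zero on \<open>L\<close> would force \<open>c = 0\<close>.\<close>

lemma linear_span_eq_plane:
  assumes "c \<noteq> 0"
  shows "linear_span Z = L"
proof
  show "L \<subseteq> linear_span Z"
    unfolding linear_span_def
  proof safe
    fix y g assume y: "y \<in> L" and g: "g \<in> Z" "g \<in> forms 1"
    have "g \<in> K" using linear_form_mem_Z[OF g(2,1)] linear_form_mod_K[OF g(2)] assms by simp
    then show "meval (($) y) g = 0" using y by (simp add: linear_subspace_ideal_def)
  qed
qed (rule linear_span_subset)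

lemma linear_span_is_line:
  assumes c: "c = 0"
  shows "is_line (linear_span Z)"
proof -
  define w1 w2 where w: "w1 = uT + a *s uY" "w2 = uX + b *s uY"
  have T0: "meval (($) x) T = 0" if "x \<in> vec.span {w2}" for x
    using that by (auto simp: vec.span_singleton w meval_forms_1_scale[OF linear(1)]
        meval_forms_1_add[OF linear(1)] dual)
  have "meval (($) w1) T = 1" "meval (($) w2) X = 1"
    by (simp_all add: w meval_forms_1_scale[OF linear(1)] meval_forms_1_scale[OF linear(2)]
        meval_forms_1_add[OF linear(1)] meval_forms_1_add[OF linear(2)] dual)
  then have "w1 \<notin> vec.span {w2}" "w2 \<noteq> 0"
    using T0 meval_forms_1_0[OF linear(2)] by auto
  then have ind: "vec.independent {w1, w2}" and "w1 \<noteq> w2"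
    using vec.span_base[of w2 "{w2}"] by (auto simp: vec.independent_insert)
  have "linear_span Z = vec.span {w1, w2}"
  proof
    have L: "T * (Y - scalar b * X - scalar a * T) = R.quad0 T X Y"
      unfolding R.quad0_def unfolding c by (simp add: algebra_simps power2_eq_square)
    have mem: "Y - scalar b * X - scalar a * T \<in> Z"
      by (rule T_cancel_Z) (simp only: L quads_mem_Z)
    have form: "Y - scalar b * X - scalar a * T \<in> forms 1"
      by (intro forms_diff forms_smult linear)
    show "linear_span Z \<subseteq> vec.span {w1, w2}"
    proof
      fix x assume x: "x \<in> linear_span Z"
      then have "meval (($) x) (Y - scalar b * X - scalar a * T) = 0"
        using mem form unfolding linear_span_def by blast
      then have "meval (($) x) Y = b * meval (($) x) X + a * meval (($) x) T"
        by (simp add: algebra_simps)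
      with coordinates[of x] x linear_span_subset
      have "x = meval (($) x) T *s w1 + meval (($) x) X *s w2"
        unfolding w by (auto simp: vec_eq_iff algebra_simps)
      also have "\<dots> \<in> vec.span {w1, w2}"
        by (intro vec.span_add vec.span_scale vec.span_base) auto
      finally show "x \<in> vec.span {w1, w2}" .
    qed
    have "meval (($) y) g = 0" if g: "g \<in> Z" "g \<in> forms 1" and y: "y \<in> vec.span {w1, w2}" for g y
    proof -
      have w0: "meval (($) w1) g = 0" "meval (($) w2) g = 0"
        using linear_form_mem_Z[OF g(2,1)]
        by (simp_all add: w meval_forms_1_add[OF g(2)] meval_forms_1_scale[OF g(2)] mult.commute)
      show ?thesis
        by (rule forms_1_vanish_on_span[OF g(2) _ y]) (use w0 in auto)
    qed
    then show "vec.span {w1, w2} \<subseteq> linear_span Z"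
      unfolding linear_span_def by blast
  qed
  moreover have "vec.dim (vec.span {w1, w2}) = 2"
    using vec.dim_span_eq_card_independent[OF ind] \<open>w1 \<noteq> w2\<close> by simp
  ultimately show ?thesis by (simp add: is_line_def vec.subspace_span)
qed

end

section \<open>Self-residual schemes\<close>

text \<open>A scheme in a plane that is linked to itself by a quadric and a cubic, with the expansions
  of both on the plane.\<close>

locale self_residual_scheme = plane_scheme +
  fixes q f :: "5 mpoly"
    and A B D C E F y3 y2x y2t yxx yxt ytt f3 f2 f1 f0 :: complex
  assumes surface: "surface_ideal q f \<subseteq> Z"
    and self_residual: "residual (surface_ideal q f) L Z = Z"
    and quadric_expansion: "q - (scalar A * Y^2 + scalar B * X * Y + scalar D * T * Y
      + scalar C * X^2 + scalar E * X * T + scalar F * T^2) \<in> linear_subspace_ideal L"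
    and cubic_expansion: "f - (scalar y3 * Y^3 + scalar y2x * X * Y^2 + scalar y2t * T * Y^2
      + scalar yxx * X^2 * Y + scalar yxt * X * T * Y + scalar ytt * T^2 * Y
      + scalar f3 * X^3 + scalar f2 * X^2 * T + scalar f1 * X * T^2 + scalar f0 * T^3)
      \<in> linear_subspace_ideal L"
begin

sublocale R: plane_section "scalar a" "scalar b" "scalar c" "scalar p0" "scalar p1" "scalar p2"
  "scalar A" "scalar B" "scalar D" "scalar y3" "scalar y2x" "scalar y2t" "scalar yxx"
  "scalar yxt" "scalar ytt" "scalar f3" .

sublocale C: plane_section a b c p0 p1 p2 A B D y3 y2x y2t yxx yxt ytt f3 .

definition J where "J = scheme_intersection (surface_ideal q f) K"

lemma ideal_sum_SK: "is_ideal (ideal_sum (surface_ideal q f) K)"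
  by (intro is_ideal_ideal_sum is_ideal_surface_ideal ideal_K)

lemma ideal_J: "is_ideal J"
  unfolding J_def scheme_intersection_def by (intro is_ideal_saturation ideal_sum_SK)

lemma saturated_J: "(\<And>g. g \<in> forms k \<Longrightarrow> g * p \<in> J) \<Longrightarrow> p \<in> J"
  unfolding J_def scheme_intersection_def by (rule mem_saturationI[OF ideal_sum_SK])

lemma ideal_sum_subset_J: "ideal_sum (surface_ideal q f) K \<subseteq> J"
  unfolding J_def scheme_intersection_def by (rule subset_saturation[OF ideal_sum_SK])

lemma K_subset_J: "K \<subseteq> J"
proof
  fix x assume "x \<in> K"
  moreover have "x = 0 + x" by simp
  ultimately have "x \<in> ideal_sum (surface_ideal q f) K"
    unfolding ideal_sum_def using ideal_0[OF is_ideal_surface_ideal[of q f]] by blast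
  then show "x \<in> J" using ideal_sum_subset_J by blast
qed

lemma surface_subset_J: "surface_ideal q f \<subseteq> J"
proof
  fix x assume "x \<in> surface_ideal q f"
  moreover have "x = x + 0" by simp
  ultimately have "x \<in> ideal_sum (surface_ideal q f) K"
    unfolding ideal_sum_def using ideal_0[OF ideal_K] by blast
  then show "x \<in> J" using ideal_sum_subset_J by blast
qed

lemma Z_eq_quotient: "x \<in> Z \<longleftrightarrow> (\<forall>g\<in>Z. x * g \<in> J)"
  using self_residual unfolding residual_def ideal_quotient_def J_def by blast

text \<open>Self-residuality says \<open>Z Z \<subseteq> J\<close>, so the intersection of the surface with the
  plane is supported on \<open>Z\<close>, where \<open>T\<close> has no zeros. Algebraically: all cubic forms are
  divisible by \<open>T\<close> modulo \<open>Z\<close>; using this once shows that \<open>Z\<close> multiplies \<open>g\<close> into \<open>J\<close>, and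
  using it again shows \<open>g \<in> J\<close>.\<close>

lemma T_cancel_J:
  assumes g: "T * g \<in> J"
  shows "g \<in> J"
proof -
  have times_Z: "z * g \<in> J" if z: "z \<in> Z" for z
  proof (rule saturated_J[of 3])
    fix e :: "5 mpoly" assume "e \<in> forms 3"
    then obtain h where h: "e - T * h \<in> Z" using cover by blast
    have "e * (z * g) = g * ((e - T * h) * z) + (h * z) * (T * g)" by algebra
    also have "\<dots> \<in> J"
      using ideal_add[OF ideal_J] ideal_scale[OF ideal_J] g Z_eq_quotient h z by metis
    finally show "e * (z * g) \<in> J" .
  qed
  show ?thesis
  proof (rule saturated_J[of 3])
    fix e :: "5 mpoly" assume "e \<in> forms 3"
    then obtain h where h: "e - T * h \<in> Z" using cover by blast
    have "e * g = (e - T * h) * g + h * (T * g)" by algebra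
    also have "\<dots> \<in> J"
      using ideal_add[OF ideal_J] ideal_scale[OF ideal_J] g times_Z[OF h] by metis
    finally show "e * g \<in> J" .
  qed
qed

lemma scalar_n:
  "R.n12 = scalar C.n12" "R.n11 = scalar C.n11" "R.n10 = scalar C.n10"
  "R.n22 = scalar C.n22" "R.n21 = scalar C.n21" "R.n20 = scalar C.n20"
  by (simp_all add: R.n12_def C.n12_def R.n11_def C.n11_def R.n10_def C.n10_def
      R.n22_def C.n22_def R.n21_def C.n21_def R.n20_def C.n20_def scalar_hom)

lemma scalar_m:
  "R.m11 = scalar C.m11" "R.m01 = scalar C.m01" "R.m00 = scalar C.m00" "R.d0 = scalar C.d0"
  by (simp_all add: R.m11_def C.m11_def R.m01_def C.m01_def R.m00_def C.m00_def
      R.d0_def C.d0_def scalar_n scalar_hom)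

lemma scalar_coefficients:
  "R.e1 = scalar C.e1" "R.e0 = scalar C.e0"
  "R.r2 = scalar C.r2" "R.r1 = scalar C.r1" "R.r0 = scalar C.r0"
  "R.g2 = scalar C.g2" "R.g1 = scalar C.g1" "R.g0 = scalar C.g0"
  "R.k2 = scalar C.k2" "R.k1 = scalar C.k1" "R.k0 = scalar C.k0"
  by (simp_all add: R.e1_def C.e1_def R.e0_def C.e0_def R.r2_def C.r2_def R.r1_def C.r1_def
      R.r0_def C.r0_def R.g2_def C.g2_def R.g1_def C.g1_def R.g0_def C.g0_def
      R.k2_def C.k2_def R.k1_def C.k1_def R.k0_def C.k0_def scalar_m scalar_n scalar_hom)

lemma scalar_theta:
  "R.theta2 = scalar C.theta2" "R.theta1 = scalar C.theta1" "R.theta0 = scalar C.theta0"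
  by (simp_all add: R.theta2_def C.theta2_def R.theta1_def C.theta1_def R.theta0_def C.theta0_def
      scalar_coefficients scalar_hom)

text \<open>The quadric minus its combination of \<open>quad2, quad1, quad0\<close> is a normal form in \<open>Z\<close>, hence
  zero.\<close>

lemma quadric_coefficients:
  "A * C.n22 + B * C.n12 + D * c + C = 0" (is ?c1) "A * C.n21 + B * C.n11 + D * b + E = 0" (is ?c2)
  "A * C.n20 + B * C.n10 + D * a + F = 0" (is ?c3)
  and normal_quadric_mem_J:
  "scalar A * R.quad2 T X Y + scalar B * R.quad1 T X Y + scalar D * R.quad0 T X Y \<in> J" (is ?nJ)
proof -
  let ?q = "scalar A * Y^2 + scalar B * X * Y + scalar D * T * Y
      + scalar C * X^2 + scalar E * X * T + scalar F * T^2"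
  let ?n = "scalar A * R.quad2 T X Y + scalar B * R.quad1 T X Y + scalar D * R.quad0 T X Y"
  have q: "q \<in> Z" "q \<in> J" using surface surface_subset_J surface_ideal_generators by blast+
  have "?q \<in> Z"
    using ideal_cong[OF ideal_Z, of q ?q] quadric_expansion plane q by blast
  moreover have "?n \<in> Z"
    by (intro ideal_add[OF ideal_Z] ideal_scale[OF ideal_Z] quads_mem_Z)
  ultimately have "?q - ?n \<in> Z" by (rule ideal_diff[OF ideal_Z])
  note Z_mem = this[unfolded R.quadric_normal_form, unfolded scalar_n, folded scalar_mult single_add]
  note coeffs = normal_form_zero[OF Z_mem]
  have "?q - ?n = 0"
    unfolding R.quadric_normal_form
    by (simp only: scalar_n scalar_mult[symmetric] single_add[symmetric] coeffs) simp
  moreover have "?q \<in> J"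
    using ideal_cong[OF ideal_J, of q ?q] quadric_expansion K_subset_J q by blast
  ultimately show ?nJ by simp
  show ?c1 ?c2 ?c3 by (fact coeffs)+
qed

lemma cubic_coefficients:
  "f2 + y2x * C.n21 + y2t * C.n22 + C.m11 * C.n11 + C.m01 * b + C.m00 * c + C.d0 * p2 = 0" (is ?c1)
  "f1 + y2x * C.n20 + y2t * C.n21 + C.m11 * C.n10 + C.m01 * a + C.m00 * b + C.d0 * p1 = 0" (is ?c2)
  "f0 + y2t * C.n20 + C.m00 * a + C.d0 * p0 = 0" (is ?c3)
  and normal_cubic_mem_J:
  "R.d0 * R.cubic T X + R.lin0 T X * R.quad0 T X Y + R.lin1 X * R.quad1 T X Y
     + R.lin2 T X Y * R.quad2 T X Y \<in> J" (is ?nJ)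
proof -
  let ?f = "scalar y3 * Y^3 + scalar y2x * X * Y^2 + scalar y2t * T * Y^2
      + scalar yxx * X^2 * Y + scalar yxt * X * T * Y + scalar ytt * T^2 * Y
      + scalar f3 * X^3 + scalar f2 * X^2 * T + scalar f1 * X * T^2 + scalar f0 * T^3"
  let ?n = "R.d0 * R.cubic T X + R.lin0 T X * R.quad0 T X Y + R.lin1 X * R.quad1 T X Y
     + R.lin2 T X Y * R.quad2 T X Y"
  have f: "f \<in> Z" "f \<in> J" using surface surface_subset_J surface_ideal_generators by blast+
  have "?f \<in> Z"
    using ideal_cong[OF ideal_Z, of f ?f] cubic_expansion plane f by blast
  moreover have "?n \<in> Z"
    by (intro ideal_add[OF ideal_Z] ideal_scale[OF ideal_Z] quads_mem_Z cubic_mem)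
  ultimately have diff: "?f - ?n \<in> Z" by (rule ideal_diff[OF ideal_Z])
  note expansion = R.cubic_normal_form[of Y X T "scalar f2" "scalar f1" "scalar f0"]
  note Z_mem = T_cancel_Z[OF diff[unfolded expansion, unfolded scalar_n scalar_m], folded scalar_mult single_add]
  note coeffs = normal_form_zero[OF Z_mem]
  have "?f - ?n = 0"
    unfolding expansion
    by (simp only: scalar_n scalar_m scalar_mult[symmetric] single_add[symmetric] coeffs) simp
  moreover have "?f \<in> J"
    using ideal_cong[OF ideal_J, of f ?f] cubic_expansion K_subset_J f by blast
  ultimately show ?nJ by simp
  show ?c1 ?c2 ?c3 by (fact coeffs)+
qed

lemma form_normal_form:
  assumes N: "is_ideal N" and K: "K \<subseteq> N"
    and mem: "R.quad0 T X Y \<in> N" "R.quad1 T X Y \<in> N" "R.cubic T X \<in> N" and g: "g \<in> forms d"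
  shows "\<exists>r2 r1 r0. T^2 * g - T^d * (scalar r2 * X^2 + scalar r1 * X * T + scalar r0 * T^2) \<in> N"
  using g
proof (induction d arbitrary: g)
  case 0
  then have "T^2 * g - T^0 * (scalar 0 * X^2 + scalar 0 * X * T + scalar (Poly_Mapping.lookup g 0) * T^2) = 0"
    using forms_0_scalar[OF 0] by (simp add: mult.commute)
  then show ?case using ideal_0[OF N] by metis
next
  case (Suc d)
  from Suc.prems show ?case
  proof (induction rule: forms_Suc_induct)
    case zero
    have "T^2 * 0 - T^Suc d * (scalar 0 * X^2 + scalar 0 * X * T + scalar 0 * T^2) = 0" by simp
    then show ?case using ideal_0[OF N] by metis
  next
    case (add g h)
    then obtain r2 r1 r0 s2 s1 s0 where
      "T^2 * g - T^Suc d * (scalar r2 * X^2 + scalar r1 * X * T + scalar r0 * T^2) \<in> N"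
      "T^2 * h - T^Suc d * (scalar s2 * X^2 + scalar s1 * X * T + scalar s0 * T^2) \<in> N" by blast
    from ideal_add[OF N this]
    have "T^2 * (g + h) - T^Suc d * (scalar (r2 + s2) * X^2 + scalar (r1 + s1) * X * T
       + scalar (r0 + s0) * T^2) \<in> N"
      by (simp only: single_add algebra_simps)
    then show ?case by blast
  next
    case (mult i g)
    then obtain r2 r1 r0 where
      r: "T^2 * g - T^d * (scalar r2 * X^2 + scalar r1 * X * T + scalar r0 * T^2) \<in> N" (is "_ - T^d * ?r \<in> N")
      using Suc.IH by blast
    define s u v where suv: "s = uT $ i" "u = uX $ i" "v = uY $ i"
    let ?l = "scalar s * T + scalar u * X + scalar v * Y"
    have v: "var i - ?l \<in> N" using var_mod_K K unfolding suv by blast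
    let ?n = "scalar (s * r2 + u * r1 + u * r2 * p2 + v * (r2 * (C.n12 * p2 + C.n11) + r1 * C.n12 + r0 * c)) * X^2
      + scalar (s * r1 + u * r0 + u * r2 * p1 + v * (r2 * (C.n12 * p1 + C.n10) + r1 * C.n11 + r0 * b)) * X * T
      + scalar (s * r0 + u * r2 * p0 + v * (r2 * C.n12 * p0 + r1 * C.n10 + r0 * a)) * T^2"
    have "?l * ?r - T * ?n \<in> N"
      unfolding single_add scalar_mult scalar_n[symmetric] R.linear_times_normal_form
      by (intro ideal_add[OF N] ideal_scale[OF N] mem)
    moreover have "T^2 * (var i * g) - T^Suc d * ?n
      = T^2 * g * (var i - ?l) + ?l * (T^2 * g - T^d * ?r) + T^d * (?l * ?r - T * ?n)"
      unfolding power_Suc by (simp only: algebra_simps)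
    ultimately have "T^2 * (var i * g) - T^Suc d * ?n \<in> N"
      using ideal_add[OF N] ideal_scale[OF N] v r by metis
    then show ?case by blast
  qed
qed

text \<open>As \<open>Z = J : Z\<close>, it is enough that the determinant multiplies \<open>Z\<close> into \<open>J\<close>. It does so for
  the two equations of the chart. As \<open>T\<close> can be cancelled modulo \<open>J\<close> and modulo \<open>Z\<close>, this
  extends from these equations to all of \<open>Z\<close>.\<close>

lemma determinant_mem_Z: "R.determinant T X Y \<in> Z"
proof -
  let ?d = "R.determinant T X Y"
  \<comment> \<open>An ideal in which \<open>T\<close> can be cancelled, to be shown equal to \<open>Z\<close>.\<close>
  define N where "N = {g \<in> Z. ?d * g \<in> J}"
  have N: "is_ideal N"
    by (rule idealI)
      (auto simp: N_def distrib_left mult.left_commute[of ?d] ideal_0 ideal_add ideal_scale ideal_Z ideal_J)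
  have cancel: "g \<in> N" if "T * g \<in> N" for g
    using that T_cancel_Z[of g] T_cancel_J[of "?d * g"] by (simp add: N_def mult.left_commute)
  have quad0: "R.quad0 T X Y \<in> N" and cubic: "R.cubic T X \<in> N"
    using quads_mem_Z cubic_mem R.determinant_multiplies_into[OF ideal_J normal_quadric_mem_J normal_cubic_mem_J]
    by (auto simp: N_def)
  note quads = R.quads_mem[OF N cancel quad0 cubic]
  have K: "K \<subseteq> N" using K_subset_J plane ideal_scale[OF ideal_J] by (auto simp: N_def)
  have form: "g \<in> N" if g: "g \<in> Z" "g \<in> forms d" for g d
  proof -
    obtain r2 r1 r0 where
      r: "T^2 * g - T^d * (scalar r2 * X^2 + scalar r1 * X * T + scalar r0 * T^2) \<in> N" (is "_ - ?r \<in> N")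
      using form_normal_form[OF N K quad0 quads(1) cubic g(2)] by blast
    then have "?r \<in> Z"
      using ideal_cong[OF ideal_Z, of "T^2 * g" ?r] ideal_scale[OF ideal_Z g(1)] by (auto simp: N_def)
    from normal_form_zero[OF T_power_cancel_Z[OF this]] have "T * (T * g) \<in> N"
      using r by (simp add: power2_eq_square mult.assoc)
    then show ?thesis using cancel by blast
  qed
  have "g \<in> N" if "g \<in> Z" for g
  proof -
    have "(\<Sum>d\<in>mono_degree ` Poly_Mapping.keys g. hcomponent d g) \<in> N"
      using that homogeneous form[OF _ hcomponent_forms]
      by (intro ideal_sum[OF N]) (auto simp: homogeneous_ideal_def)
    then show ?thesis by (simp only: sum_hcomponent[symmetric])
  qed
  then have "\<forall>g\<in>Z. ?d * g \<in> J" by (simp add: N_def)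
  then show ?thesis by (simp only: Z_eq_quotient[of ?d])
qed

text \<open>The determinant vanishes on \<open>Z\<close>, so its normal form has zero coefficients.\<close>

lemma linkage_equations:
  "C.d0 * C.r2 = c * C.theta2" "C.d0 * C.r1 = c * C.theta1" "C.d0 * C.r0 = c * C.theta0"
proof -
  have "T^2 * ((R.d0 * R.r2 - scalar c * R.theta2) * X^2 + (R.d0 * R.r1 - scalar c * R.theta1) * X * T
    + (R.d0 * R.r0 - scalar c * R.theta0) * T^2) \<in> Z"
    using ideal_cong[OF ideal_Z R.determinant_normal_form[OF ideal_Z quads_mem_Z(1,2) cubic_mem]]
      determinant_mem_Z by blast
  from normal_form_zero[OF T_power_cancel_Z[OF this,
      unfolded scalar_m scalar_coefficients scalar_theta, folded scalar_mult single_diff]]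
  show "C.d0 * C.r2 = c * C.theta2" "C.d0 * C.r1 = c * C.theta1" "C.d0 * C.r0 = c * C.theta0"
    by simp_all
qed

lemma surface_plus_plane_vanishes:
  assumes "y \<in> L" "meval (($) y) q = 0" "meval (($) y) f = 0" "p \<in> J"
  obtains k where "\<And>g. g \<in> forms k \<Longrightarrow> meval (($) y) g * meval (($) y) p = 0"
proof -
  have "is_ideal {p. meval (($) y) p = 0}" by (rule idealI) auto
  then have "surface_ideal q f \<subseteq> {p. meval (($) y) p = 0}"
    unfolding surface_ideal_def using assms by (intro ideal_span_minimal) auto
  then have vanish: "meval (($) y) h = 0" if "h \<in> ideal_sum (surface_ideal q f) K" for h
    using that assms(1) by (auto simp: ideal_sum_def linear_subspace_ideal_def)
  obtain k where "\<forall>g\<in>forms k. g * p \<in> ideal_sum (surface_ideal q f) K"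
    using assms(4) mem_saturation_iff[OF ideal_sum_SK] unfolding J_def scheme_intersection_def by blast
  with vanish that show ?thesis by (metis meval_mult)
qed

lemma meval_point:
  "meval (($) (t *s uT + (s *s uX + r *s uY))) T = t"
  "meval (($) (t *s uT + (s *s uX + r *s uY))) X = s"
  "meval (($) (t *s uT + (s *s uX + r *s uY))) Y = r"
  by (simp_all add: meval_forms_1_add[OF linear(1)] meval_forms_1_add[OF linear(2)]
      meval_forms_1_add[OF linear(3)] meval_forms_1_scale[OF linear(1)]
      meval_forms_1_scale[OF linear(2)] meval_forms_1_scale[OF linear(3)] dual)

lemma point_mem_L: "t *s uT + (s *s uX + r *s uY) \<in> L"
  by (intro vec.subspace_add[OF subspace] vec.subspace_scale[OF subspace] basis_mem)

lemma meval_mod_K: "g - h \<in> K \<Longrightarrow> y \<in> L \<Longrightarrow> meval (($) y) g = meval (($) y) h"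
  by (auto simp: linear_subspace_ideal_def)

text \<open>The support of \<open>J\<close> contains the points of the surface in the plane. They are normalised to
  \<open>T = 1\<close>, so that a power of \<open>T\<close> can undo the saturation.\<close>

lemma J_vanishes:
  assumes "meval (($) (1 *s uT + (s *s uX + r *s uY))) q = 0"
    "meval (($) (1 *s uT + (s *s uX + r *s uY))) f = 0" "p \<in> J"
  shows "meval (($) (1 *s uT + (s *s uX + r *s uY))) p = 0"
proof -
  obtain k where k: "\<And>g. g \<in> forms k \<Longrightarrow> meval (($) (1 *s uT + (s *s uX + r *s uY))) g *
     meval (($) (1 *s uT + (s *s uX + r *s uY))) p = 0"
    using surface_plus_plane_vanishes[OF point_mem_L assms] by blast
  have "T ^ k \<in> forms k" using forms_power[OF linear(1), of k] by simp
  from k[OF this] show ?thesis by (simp only: meval_power meval_point) simp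
qed

text \<open>If the cubic vanished on the line \<open>Y = 0\<close>, then \<open>J\<close> would vanish on this line; but the
  square of the cubic equation of \<open>Z\<close> is in \<open>J\<close>. So \<open>d0 \<noteq> 0\<close>, and the linkage
  equations with \<open>c = 0\<close> give \<open>B = D = 0\<close>. If in addition \<open>A\<close> were zero, the quadric would
  vanish on the plane, and \<open>J\<close> would vanish on the plane curve \<open>f = 0\<close>, which has points
  outside of the line; but \<open>Y^2\<close> is in \<open>J\<close>.\<close>

lemma nondegenerate_at_collinear_scheme:
  assumes abc: "a = 0" "b = 0" "c = 0"
  shows "2 * A * C.d0 - C.theta2 \<noteq> 0"
proof -
  have n: "C.n12 = 0" "C.n11 = 0" "C.n10 = 0" "C.n22 = 0" "C.n21 = 0" "C.n20 = 0"
    unfolding C.n22_def C.n21_def C.n20_def unfolding C.n12_def C.n11_def C.n10_def unfolding abc by simp_all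
  have d0: "C.d0 = f3" unfolding C.d0_def n unfolding abc by simp
  have "R.quad0 T X Y = T * Y" unfolding R.quad0_def unfolding abc by simp
  then have Y_mem: "Y \<in> Z" using T_cancel_Z quads_mem_Z(1) by metis
  have on_Z: "C = 0" "E = 0" "F = 0" "f2 + f3 * p2 = 0" "f1 + f3 * p1 = 0" "f0 + f3 * p0 = 0"
    using quadric_coefficients cubic_coefficients unfolding n d0 unfolding abc by simp_all
  \<comment> \<open>Coordinates \<open>(1, s, r)\<close> of the affine part of the plane.\<close>
  define pt where "pt s r = 1 *s uT + (s *s uX + r *s uY)" for s r
  have eval_q: "meval (($) (pt s r)) q = A * r^2 + B * s * r + D * r" for s r
    unfolding meval_mod_K[OF quadric_expansion point_mem_L] pt_def
    by (simp only: meval_add meval_mult meval_power meval_point meval_single monomial_value_0 on_Z) simp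
  have eval_f: "meval (($) (pt s r)) f = y3 * r^3 + y2x * s * r^2 + y2t * r^2 + yxx * s^2 * r
      + yxt * s * r + ytt * r + f3 * s^3 + f2 * s^2 + f1 * s + f0" for s r
    unfolding meval_mod_K[OF cubic_expansion point_mem_L] pt_def
    by (simp only: meval_add meval_mult meval_power meval_point meval_single monomial_value_0) simp
  have f3: "f3 \<noteq> 0"
  proof
    assume f3: "f3 = 0"
    have J: "R.cubic T X * R.cubic T X \<in> J"
      using Z_eq_quotient cubic_mem by blast
    have "poly [:- p0, - p1, - p2, 1:] s = 0" for s
    proof -
      have "meval (($) (pt s 0)) q = 0" "meval (($) (pt s 0)) f = 0"
        using on_Z f3 by (simp_all add: eval_q eval_f)
      from J_vanishes[OF this[unfolded pt_def] J] have "meval (($) (pt s 0)) (R.cubic T X) = 0"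
        unfolding pt_def by simp
      then show ?thesis
        unfolding pt_def R.cubic_def
        by (simp only: meval_diff meval_mult meval_power meval_point meval_single monomial_value_0)
          (simp add: algebra_simps power2_eq_square power3_eq_cube)
    qed
    then show False using poly_all_0_iff_0[of "[:- p0, - p1, - p2, 1:]"] by auto
  qed
  have BD: "B = 0" "D = 0"
    using linkage_equations(2,3) f3 unfolding d0 C.r1_def C.r0_def unfolding abc by simp_all
  have A: "A \<noteq> 0"
  proof
    assume A: "A = 0"
    have "Y * Y \<in> J" using Z_eq_quotient Y_mem by blast
    \<comment> \<open>The restriction of the cubic to the line \<open>Y = T\<close> has degree 3, so it has a zero
      there.\<close>
    let ?p = "[:y3 + y2t + ytt + f0, y2x + yxt + f1, yxx + f2, f3:]"
    have "degree ?p = 3" using f3 by simp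
    then have "\<not> constant (poly ?p)" by (simp add: constant_degree)
    then obtain s where s: "poly ?p s = 0" using fundamental_theorem_of_algebra by blast
    have "meval (($) (pt s 1)) q = 0" by (simp add: eval_q A BD)
    moreover have "meval (($) (pt s 1)) f = 0"
      using s by (simp add: eval_f algebra_simps power2_eq_square power3_eq_cube)
    ultimately have "meval (($) (pt s 1)) (Y * Y) = 0"
      using J_vanishes \<open>Y * Y \<in> J\<close> unfolding pt_def by blast
    then show False by (simp only: meval_mult pt_def meval_point) simp
  qed
  have "C.theta2 = 0"
    unfolding C.theta2_def C.e1_def C.e0_def C.r2_def C.r1_def C.r0_def n unfolding abc BD by simp
  with A f3 d0 show ?thesis by simp
qed

end

section \<open>Regular functions\<close>

text \<open>Functions that are quotients of a polynomial by a power of \<open>M\<close>, regular where \<open>M\<close> does not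
  vanish. Coordinates obtained by solving linear equations are of this kind, with the
  determinants in the denominator.\<close>

definition regular_on :: "'v mpoly \<Rightarrow> (('v \<Rightarrow> complex) \<Rightarrow> complex) \<Rightarrow> bool" where
  "regular_on M h \<longleftrightarrow> (\<exists>g N. \<forall>x. meval x M \<noteq> 0 \<longrightarrow> h x * meval x M ^ N = meval x g)"

lemma regular_onI: "(\<And>x. meval x M \<noteq> 0 \<Longrightarrow> h x * meval x M ^ N = meval x g) \<Longrightarrow> regular_on M h"
  unfolding regular_on_def by blast

lemma regular_on_meval: "regular_on M (\<lambda>x. meval x g)"
  by (rule regular_onI[of _ _ 0]) simp

lemma regular_on_const: "regular_on M (\<lambda>x. k)"
  using regular_on_meval[of M "scalar k"] by simp

lemma regular_on_coordinate: "regular_on M (\<lambda>x. x v)"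
  using regular_on_meval[of M "var v"] by simp

lemma regular_on_add:
  assumes "regular_on M h" "regular_on M h'"
  shows "regular_on M (\<lambda>x. h x + h' x)"
proof -
  obtain g N g' N' where 1: "\<And>x. meval x M \<noteq> 0 \<Longrightarrow> h x * meval x M ^ N = meval x g"
    and 2: "\<And>x. meval x M \<noteq> 0 \<Longrightarrow> h' x * meval x M ^ N' = meval x g'"
    using assms unfolding regular_on_def by blast
  have "(h x + h' x) * meval x M ^ (N + N') = meval x (g * M ^ N' + g' * M ^ N)"
    if "meval x M \<noteq> 0" for x
  proof -
    have "(h x + h' x) * meval x M ^ (N + N') =
      (h x * meval x M ^ N) * meval x M ^ N' + (h' x * meval x M ^ N') * meval x M ^ N"
      by (simp add: power_add algebra_simps)
    also have "\<dots> = meval x (g * M ^ N' + g' * M ^ N)" by (simp add: 1[OF that] 2[OF that])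
    finally show ?thesis .
  qed
  then show ?thesis by (rule regular_onI)
qed

lemma regular_on_mult:
  assumes "regular_on M h" "regular_on M h'"
  shows "regular_on M (\<lambda>x. h x * h' x)"
proof -
  obtain g N g' N' where 1: "\<And>x. meval x M \<noteq> 0 \<Longrightarrow> h x * meval x M ^ N = meval x g"
    and 2: "\<And>x. meval x M \<noteq> 0 \<Longrightarrow> h' x * meval x M ^ N' = meval x g'"
    using assms unfolding regular_on_def by blast
  have "(h x * h' x) * meval x M ^ (N + N') = meval x (g * g')"
    if "meval x M \<noteq> 0" for x
  proof -
    have "(h x * h' x) * meval x M ^ (N + N') = (h x * meval x M ^ N) * (h' x * meval x M ^ N')"
      by (simp add: power_add algebra_simps)
    also have "\<dots> = meval x (g * g')" by (simp add: 1[OF that] 2[OF that])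
    finally show ?thesis .
  qed
  then show ?thesis by (rule regular_onI)
qed

lemma regular_on_uminus: "regular_on M h \<Longrightarrow> regular_on M (\<lambda>x. - h x)"
  using regular_on_mult[OF regular_on_const[of M "-1"], of h] by simp

lemma regular_on_diff:
  "regular_on M h \<Longrightarrow> regular_on M h' \<Longrightarrow> regular_on M (\<lambda>x. h x - h' x)"
  using regular_on_add[of M h "\<lambda>x. - h' x"] regular_on_uminus[of M h'] by simp

lemma regular_on_power: "regular_on M h \<Longrightarrow> regular_on M (\<lambda>x. h x ^ n)"
  by (induction n) (simp_all add: regular_on_const regular_on_mult)

lemma regular_on_sum:
  "(\<And>i. i \<in> I \<Longrightarrow> regular_on M (h i)) \<Longrightarrow> regular_on M (\<lambda>x. \<Sum>i\<in>I. h i x)"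
  by (induction I rule: infinite_finite_induct) (simp_all add: regular_on_const regular_on_add)

lemma regular_on_inverse_left:
  assumes "regular_on (P * Q) h"
  shows "regular_on (P * Q) (\<lambda>x. h x / meval x P)"
proof -
  have "regular_on (P * Q) (\<lambda>x. 1 / meval x P)"
    by (rule regular_onI[of _ _ 1 Q]) auto
  from regular_on_mult[OF assms this] show ?thesis by simp
qed

lemma regular_on_inverse_right:
  assumes "regular_on (P * Q) h"
  shows "regular_on (P * Q) (\<lambda>x. h x / meval x Q)"
  using regular_on_inverse_left[of Q P h] assms by (simp add: mult.commute)

text \<open>The reason for the notion: a regular function that is not zero at a point cuts out a basic
  open neighbourhood of it.\<close>

lemma regular_on_nonvanishing:
  assumes "regular_on M h" "meval x0 M \<noteq> 0" "h x0 \<noteq> 0"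
  obtains g where "meval x0 g \<noteq> 0" "\<And>x. meval x g \<noteq> 0 \<Longrightarrow> meval x M \<noteq> 0 \<and> h x \<noteq> 0"
proof -
  obtain g N where g: "\<And>x. meval x M \<noteq> 0 \<Longrightarrow> h x * meval x M ^ N = meval x g"
    using assms(1) unfolding regular_on_def by blast
  have "meval x0 (g * M) \<noteq> 0" using assms g[OF assms(2), symmetric] by simp
  moreover have "meval x M \<noteq> 0 \<and> h x \<noteq> 0" if "meval x (g * M) \<noteq> 0" for x
    using that g[of x, symmetric] by auto
  ultimately show ?thesis using that by blast
qed

definition polynomial_function :: "(('v \<Rightarrow> complex) \<Rightarrow> complex) \<Rightarrow> bool" where
  "polynomial_function h \<longleftrightarrow> regular_on 1 h"

lemma polynomial_functionE:
  assumes "polynomial_function h"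
  obtains g where "h = (\<lambda>x. meval x g)"
proof -
  from assms obtain g N where "\<And>x. h x * 1 ^ N = meval x g"
    unfolding polynomial_function_def regular_on_def by auto
  then have "h = (\<lambda>x. meval x g)" by (intro ext) simp
  with that show ?thesis .
qed

definition cyc :: "3 \<Rightarrow> 3" where "cyc i = (if i = 1 then 2 else if i = 2 then 3 else 1)"

text \<open>The entries of the adjugate matrix. With cyclic successors of the indices, the minors need
  no signs.\<close>

definition adj3 :: "(3 \<Rightarrow> 3 \<Rightarrow> complex) \<Rightarrow> 3 \<Rightarrow> 3 \<Rightarrow> complex" where
  "adj3 N i j = N (cyc j) (cyc i) * N (cyc (cyc j)) (cyc (cyc i))
     - N (cyc j) (cyc (cyc i)) * N (cyc (cyc j)) (cyc i)"

definition det3 :: "(3 \<Rightarrow> 3 \<Rightarrow> complex) \<Rightarrow> complex" where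
  "det3 N = (\<Sum>l\<in>UNIV. N 1 l * adj3 N l 1)"

lemma cyc_simps [simp]: "cyc 1 = 2" "cyc 2 = 3" "cyc 3 = 1"
  by (simp_all add: cyc_def)

lemma adj3_right: "(\<Sum>l\<in>UNIV. N i l * adj3 N l j) = (if i = j then det3 N else 0)"
proof -
  have "\<forall>i j. (\<Sum>l\<in>UNIV. N i l * adj3 N l j) = (if i = j then det3 N else 0)"
    by (simp add: forall_3 sum_3 det3_def adj3_def algebra_simps)
  then show ?thesis by blast
qed

lemma adj3_left: "(\<Sum>l\<in>UNIV. adj3 N i l * N l j) = (if i = j then det3 N else 0)"
proof -
  have "\<forall>i j. (\<Sum>l\<in>UNIV. adj3 N i l * N l j) = (if i = j then det3 N else 0)"
    by (simp add: forall_3 sum_3 det3_def adj3_def algebra_simps)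
  then show ?thesis by blast
qed

lemma det3_identity: "det3 (\<lambda>i j. if i = j then 1 else 0) = 1"
  by (simp add: det3_def sum_3 adj3_def)

lemma regular_on_adj3:
  assumes "\<And>i j. regular_on M (\<lambda>x. N x i j)"
  shows "regular_on M (\<lambda>x. adj3 (N x) i j)"
  unfolding adj3_def by (intro regular_on_diff regular_on_mult assms)

lemma regular_on_det3:
  assumes "\<And>i j. regular_on M (\<lambda>x. N x i j)"
  shows "regular_on M (\<lambda>x. det3 (N x))"
  unfolding det3_def by (intro regular_on_sum regular_on_mult assms regular_on_adj3)

text \<open>This says that \<open>uT, uX, uY\<close> is the basis of \<open>L\<close> dual to \<open>T, X, Y\<close>, in the form in which it
  is used for products of linear forms.\<close>

definition expands_linear_forms :: "(complex^5) set \<Rightarrow> 5 mpoly \<Rightarrow> 5 mpoly \<Rightarrow> 5 mpoly \<Rightarrow>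
    complex^5 \<Rightarrow> complex^5 \<Rightarrow> complex^5 \<Rightarrow> bool" where
  "expands_linear_forms L T X Y uT uX uY \<longleftrightarrow> (\<forall>g\<in>forms 1.
     g - (scalar (meval (($) uT) g) * T + scalar (meval (($) uX) g) * X
       + scalar (meval (($) uY) g) * Y) \<in> linear_subspace_ideal L)"

lemma regular_on_linear_form:
  fixes g :: "5 mpoly"
  assumes "\<And>j. regular_on M (\<lambda>x. u x $ j)" "g \<in> forms 1"
  shows "regular_on M (\<lambda>x. meval (($) (u x)) g)"
proof -
  obtain \<phi> where "g = linear_form \<phi>" using assms(2) by (rule forms_1E)
  then show ?thesis
    by (simp only: meval_linear_form) (intro regular_on_sum regular_on_mult regular_on_const assms)
qed

definition ternary_quadric :: "(nat \<Rightarrow> complex) \<Rightarrow> 5 mpoly \<Rightarrow> 5 mpoly \<Rightarrow> 5 mpoly \<Rightarrow> 5 mpoly" where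
  "ternary_quadric k T X Y = scalar (k 0) * Y^2 + scalar (k 1) * X * Y + scalar (k 2) * T * Y
    + scalar (k 3) * X^2 + scalar (k 4) * X * T + scalar (k 5) * T^2"

definition ternary_cubic :: "(nat \<Rightarrow> complex) \<Rightarrow> 5 mpoly \<Rightarrow> 5 mpoly \<Rightarrow> 5 mpoly \<Rightarrow> 5 mpoly" where
  "ternary_cubic k T X Y = scalar (k 0) * Y^3 + scalar (k 1) * X * Y^2 + scalar (k 2) * T * Y^2
    + scalar (k 3) * X^2 * Y + scalar (k 4) * X * T * Y + scalar (k 5) * T^2 * Y
    + scalar (k 6) * X^3 + scalar (k 7) * X^2 * T + scalar (k 8) * X * T^2 + scalar (k 9) * T^3"

lemma ternary_quadric_add:
  "ternary_quadric (\<lambda>i. k i + l i) T X Y = ternary_quadric k T X Y + ternary_quadric l T X Y"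
  unfolding ternary_quadric_def by (simp only: single_add algebra_simps)

lemma ternary_cubic_add:
  "ternary_cubic (\<lambda>i. k i + l i) T X Y = ternary_cubic k T X Y + ternary_cubic l T X Y"
  unfolding ternary_cubic_def by (simp only: single_add algebra_simps)

text \<open>Padding by zeros makes all indices regular, so that no bound on the index has to be
  carried along.\<close>

definition coefficient_list :: "('x \<Rightarrow> complex) list \<Rightarrow> nat \<Rightarrow> 'x \<Rightarrow> complex" where
  "coefficient_list hs i = (if i < length hs then hs ! i else (\<lambda>_. 0))"

lemma regular_on_coefficient_list:
  "(\<And>h. h \<in> set hs \<Longrightarrow> regular_on M h) \<Longrightarrow> regular_on M (coefficient_list hs i)"
  by (simp add: coefficient_list_def regular_on_const)

context
  fixes M :: "'v mpoly" and uT uX uY :: "('v \<Rightarrow> complex) \<Rightarrow> complex^5" and T X Y :: "5 mpoly"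
  assumes u: "\<And>j. regular_on M (\<lambda>x. uT x $ j)" "\<And>j. regular_on M (\<lambda>x. uX x $ j)"
    "\<And>j. regular_on M (\<lambda>x. uY x $ j)"
begin

abbreviation expands :: "('v \<Rightarrow> complex) \<Rightarrow> (complex^5) set \<Rightarrow> bool" where
  "expands x L \<equiv> expands_linear_forms L T X Y (uT x) (uX x) (uY x)"

lemma expands_var:
  "expands x L \<Longrightarrow>
    var i - (scalar (uT x $ i) * T + scalar (uX x $ i) * X + scalar (uY x $ i) * Y) \<in> linear_subspace_ideal L"
proof -
  assume L: "expands x L"
  have "var i \<in> forms 1" by (simp add: forms_single)
  with L have "var i - (scalar (meval (($) (uT x)) (var i)) * T + scalar (meval (($) (uX x)) (var i)) * X
       + scalar (meval (($) (uY x)) (var i)) * Y) \<in> linear_subspace_ideal L"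
    unfolding expands_linear_forms_def by blast
  then show ?thesis by simp
qed

text \<open>By induction it is enough to expand products of linear forms, and the coefficients of
  these are polynomials in the coordinates of the dual basis.\<close>

lemma regular_quadric_expansion:
  assumes "q \<in> forms 2"
  shows "\<exists>k. (\<forall>i. regular_on M (k i)) \<and>
    (\<forall>x L. expands x L \<longrightarrow> q - ternary_quadric (\<lambda>i. k i x) T X Y \<in> linear_subspace_ideal L)"
proof -
  note K = is_ideal_linear_subspace_ideal
  have "q \<in> forms (Suc 1)" using assms by (simp add: numeral_2_eq_2)
  then show ?thesis
  proof (induction rule: forms_Suc_induct)
    case zero
    have "0 - ternary_quadric (\<lambda>i. 0) T X Y \<in> linear_subspace_ideal L" for L
      by (simp add: ternary_quadric_def ideal_0[OF K])
    then show ?case using regular_on_const[of M 0] by (intro exI[of _ "\<lambda>i x. 0"]) blast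
  next
    case (add g h)
    then obtain k l where kl: "\<And>i. regular_on M (k i)" "\<And>i. regular_on M (l i)"
      "\<And>x L. expands x L \<Longrightarrow> g - ternary_quadric (\<lambda>i. k i x) T X Y \<in> linear_subspace_ideal L"
      "\<And>x L. expands x L \<Longrightarrow> h - ternary_quadric (\<lambda>i. l i x) T X Y \<in> linear_subspace_ideal L"
      by blast
    have "g + h - ternary_quadric (\<lambda>i. k i x + l i x) T X Y \<in> linear_subspace_ideal L"
      if "expands x L" for x L
      using ideal_add[OF K kl(3)[OF that] kl(4)[OF that]]
      by (simp add: ternary_quadric_add algebra_simps)
    then show ?case using regular_on_add[OF kl(1,2)] by (intro exI[of _ "\<lambda>i x. k i x + l i x"]) blast
  next
    case (mult i g)
    define s r v where suv: "s = (\<lambda>x. uT x $ i)" "r = (\<lambda>x. uX x $ i)" "v = (\<lambda>x. uY x $ i)"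
    define s' r' v' where suv': "s' = (\<lambda>x. meval (($) (uT x)) g)" "r' = (\<lambda>x. meval (($) (uX x)) g)"
      "v' = (\<lambda>x. meval (($) (uY x)) g)"
    have reg: "regular_on M s" "regular_on M r" "regular_on M v"
      "regular_on M s'" "regular_on M r'" "regular_on M v'"
      unfolding suv suv' by (intro regular_on_linear_form u mult)+
    define k where "k = coefficient_list [\<lambda>x. v x * v' x, \<lambda>x. r x * v' x + v x * r' x,
      \<lambda>x. s x * v' x + v x * s' x, \<lambda>x. r x * r' x, \<lambda>x. s x * r' x + r x * s' x, \<lambda>x. s x * s' x]"
    have "regular_on M (k i)" for i
      unfolding k_def by (rule regular_on_coefficient_list)
        (auto intro!: regular_on_add regular_on_mult reg)
    moreover have "var i * g - ternary_quadric (\<lambda>i. k i x) T X Y \<in> linear_subspace_ideal L"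
      if L: "expands x L" for x L
    proof -
      let ?l = "scalar (s x) * T + scalar (r x) * X + scalar (v x) * Y"
      let ?l' = "scalar (s' x) * T + scalar (r' x) * X + scalar (v' x) * Y"
      have 1: "var i - ?l \<in> linear_subspace_ideal L"
        unfolding suv by (rule expands_var[OF L])
      have 2: "g - ?l' \<in> linear_subspace_ideal L"
        using L mult unfolding expands_linear_forms_def suv' by blast
      have "ternary_quadric (\<lambda>i. k i x) T X Y = scalar (v x * v' x) * Y^2
        + scalar (r x * v' x + v x * r' x) * X * Y + scalar (s x * v' x + v x * s' x) * T * Y
        + scalar (r x * r' x) * X^2 + scalar (s x * r' x + r x * s' x) * X * T + scalar (s x * s' x) * T^2"
        unfolding ternary_quadric_def k_def coefficient_list_def by simp
      also have "\<dots> = ?l * ?l'" unfolding single_add scalar_mult by algebra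
      finally have "var i * g - ternary_quadric (\<lambda>i. k i x) T X Y = g * (var i - ?l) + ?l * (g - ?l')"
        by algebra
      also have "\<dots> \<in> linear_subspace_ideal L"
        by (intro ideal_add[OF K] ideal_scale[OF K] 1 2)
      finally show ?thesis .
    qed
    ultimately show ?case by blast
  qed
qed

lemma regular_cubic_expansion:
  assumes "f \<in> forms 3"
  shows "\<exists>k. (\<forall>i. regular_on M (k i)) \<and>
    (\<forall>x L. expands x L \<longrightarrow> f - ternary_cubic (\<lambda>i. k i x) T X Y \<in> linear_subspace_ideal L)"
proof -
  note K = is_ideal_linear_subspace_ideal
  have "f \<in> forms (Suc 2)" using assms by (simp add: numeral_3_eq_3 numeral_2_eq_2)
  then show ?thesis
  proof (induction rule: forms_Suc_induct)
    case zero
    have "0 - ternary_cubic (\<lambda>i. 0) T X Y \<in> linear_subspace_ideal L" for L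
      by (simp add: ternary_cubic_def ideal_0[OF K])
    then show ?case using regular_on_const[of M 0] by (intro exI[of _ "\<lambda>i x. 0"]) blast
  next
    case (add g h)
    then obtain k l where kl: "\<And>i. regular_on M (k i)" "\<And>i. regular_on M (l i)"
      "\<And>x L. expands x L \<Longrightarrow> g - ternary_cubic (\<lambda>i. k i x) T X Y \<in> linear_subspace_ideal L"
      "\<And>x L. expands x L \<Longrightarrow> h - ternary_cubic (\<lambda>i. l i x) T X Y \<in> linear_subspace_ideal L"
      by blast
    have "g + h - ternary_cubic (\<lambda>i. k i x + l i x) T X Y \<in> linear_subspace_ideal L"
      if "expands x L" for x L
      using ideal_add[OF K kl(3)[OF that] kl(4)[OF that]]
      by (simp add: ternary_cubic_add algebra_simps)
    then show ?case using regular_on_add[OF kl(1,2)] by (intro exI[of _ "\<lambda>i x. k i x + l i x"]) blast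
  next
    case (mult i g)
    define s r v where suv: "s = (\<lambda>x. uT x $ i)" "r = (\<lambda>x. uX x $ i)" "v = (\<lambda>x. uY x $ i)"
    have reg: "regular_on M s" "regular_on M r" "regular_on M v"
      unfolding suv by (intro u)+
    from regular_quadric_expansion[OF mult] obtain l where l: "\<And>i. regular_on M (l i)"
      "\<And>x L. expands x L \<Longrightarrow> g - ternary_quadric (\<lambda>i. l i x) T X Y \<in> linear_subspace_ideal L"
      by blast
    define k where "k = coefficient_list [\<lambda>x. v x * l 0 x, \<lambda>x. r x * l 0 x + v x * l 1 x,
      \<lambda>x. s x * l 0 x + v x * l 2 x, \<lambda>x. r x * l 1 x + v x * l 3 x,
      \<lambda>x. s x * l 1 x + r x * l 2 x + v x * l 4 x, \<lambda>x. s x * l 2 x + v x * l 5 x,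
      \<lambda>x. r x * l 3 x, \<lambda>x. s x * l 3 x + r x * l 4 x, \<lambda>x. s x * l 4 x + r x * l 5 x,
      \<lambda>x. s x * l 5 x]"
    have "regular_on M (k i)" for i
      unfolding k_def by (rule regular_on_coefficient_list)
        (auto intro!: regular_on_add regular_on_mult reg l(1))
    moreover have "var i * g - ternary_cubic (\<lambda>i. k i x) T X Y \<in> linear_subspace_ideal L"
      if L: "expands x L" for x L
    proof -
      let ?l = "scalar (s x) * T + scalar (r x) * X + scalar (v x) * Y"
      let ?q = "ternary_quadric (\<lambda>i. l i x) T X Y"
      have 1: "var i - ?l \<in> linear_subspace_ideal L"
        unfolding suv by (rule expands_var[OF L])
      have "ternary_cubic (\<lambda>i. k i x) T X Y =
        scalar (v x * l 0 x) * Y^3 + scalar (r x * l 0 x + v x * l 1 x) * X * Y^2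
        + scalar (s x * l 0 x + v x * l 2 x) * T * Y^2
        + scalar (r x * l 1 x + v x * l 3 x) * X^2 * Y
        + scalar (s x * l 1 x + r x * l 2 x + v x * l 4 x) * X * T * Y
        + scalar (s x * l 2 x + v x * l 5 x) * T^2 * Y
        + scalar (r x * l 3 x) * X^3 + scalar (s x * l 3 x + r x * l 4 x) * X^2 * T
        + scalar (s x * l 4 x + r x * l 5 x) * X * T^2 + scalar (s x * l 5 x) * T^3"
        unfolding ternary_cubic_def k_def coefficient_list_def by simp
      also have "\<dots> = ?l * ?q" unfolding ternary_quadric_def single_add scalar_mult by algebra
      finally have "var i * g - ternary_cubic (\<lambda>i. k i x) T X Y = g * (var i - ?l) + ?l * (g - ?q)"
        by algebra
      also have "\<dots> \<in> linear_subspace_ideal L"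
        by (intro ideal_add[OF K] ideal_scale[OF K] 1 l(2)[OF L])
      finally show ?thesis .
    qed
    ultimately show ?case by blast
  qed
qed

end

text \<open>The cofactor of \<open>c\<close> in the first linkage equation, with the coefficients of quadric and
  cubic in the order of \<open>ternary_quadric\<close> and \<open>ternary_cubic\<close>.\<close>

definition linkage_obstruction :: "complex \<Rightarrow> complex \<Rightarrow> complex \<Rightarrow> complex \<Rightarrow> complex \<Rightarrow> complex \<Rightarrow>
    (nat \<Rightarrow> complex) \<Rightarrow> (nat \<Rightarrow> complex) \<Rightarrow> complex" where
  "linkage_obstruction a b c p0 p1 p2 k l =
     2 * k 0 * plane_section.d0 a b c p0 p1 p2 (l 0) (l 1) (l 3) (l 4) (l 6) -
     plane_section.theta2 a b c p0 p1 p2 (k 0) (k 1) (k 2) (l 0) (l 1) (l 2) (l 3) (l 4)"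

lemma regular_on_linkage_obstruction:
  assumes "regular_on M a" "regular_on M b" "regular_on M c"
    "regular_on M p0" "regular_on M p1" "regular_on M p2"
    "\<And>i. regular_on M (k i)" "\<And>i. regular_on M (l i)"
  shows "regular_on M (\<lambda>x. linkage_obstruction (a x) (b x) (c x) (p0 x) (p1 x) (p2 x)
    (\<lambda>i. k i x) (\<lambda>i. l i x))"
  unfolding linkage_obstruction_def plane_section.theta2_def plane_section.d0_def
    plane_section.m11_def plane_section.m01_def plane_section.e1_def plane_section.e0_def
    plane_section.r2_def plane_section.r1_def plane_section.r0_def plane_section.g2_def
    plane_section.g1_def plane_section.k2_def plane_section.k1_def plane_section.k0_def
  unfolding plane_section.m11_def plane_section.m01_def plane_chart.n22_def plane_chart.n21_def
  unfolding plane_chart.n12_def plane_chart.n11_def plane_chart.n10_def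
  by (intro regular_on_add regular_on_diff regular_on_mult regular_on_power assms regular_on_const)

section \<open>Coordinates attached to a frame\<close>

definition frame_functional :: "(frame_index \<Rightarrow> complex) \<Rightarrow> 3 \<Rightarrow> 5 mpoly \<Rightarrow> complex" where
  "frame_functional x i g = (\<Sum>m\<in>Poly_Mapping.keys g. x (Inl (i, m)) * Poly_Mapping.lookup g m)"

definition frame_vector :: "(frame_index \<Rightarrow> complex) \<Rightarrow> 3 \<Rightarrow> complex^5" where
  "frame_vector x i = (\<chi> j. x (Inr (i, j)))"

lemma frame_functional_superset:
  assumes "finite A" "Poly_Mapping.keys g \<subseteq> A"
  shows "frame_functional x i g = (\<Sum>m\<in>A. x (Inl (i, m)) * Poly_Mapping.lookup g m)"
  unfolding frame_functional_def
  by (rule sum.mono_neutral_left) (use assms in \<open>auto simp: in_keys_iff\<close>)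

lemma frame_functional_add:
  "frame_functional x i (g + h) = frame_functional x i g + frame_functional x i h"
proof -
  define A where "A = Poly_Mapping.keys g \<union> Poly_Mapping.keys h"
  have "finite A" "Poly_Mapping.keys g \<subseteq> A" "Poly_Mapping.keys h \<subseteq> A" "Poly_Mapping.keys (g + h) \<subseteq> A"
    using keys_add[of g h] by (auto simp: A_def)
  then show ?thesis
    by (simp add: frame_functional_superset[of A] lookup_add distrib_left sum.distrib)
qed

lemma lookup_scalar_mult:
  fixes g :: "5 mpoly"
  shows "Poly_Mapping.lookup (scalar k * g) m = k * Poly_Mapping.lookup g m"
  unfolding mult_map_scale_conv_mult[symmetric]
  by (simp add: Poly_Mapping.map.rep_eq when_def)

lemma frame_functional_scale:
  "frame_functional x i (scalar k * g) = k * frame_functional x i g"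
proof -
  have "Poly_Mapping.keys (scalar k * g) \<subseteq> Poly_Mapping.keys g"
    by (auto simp: in_keys_iff lookup_scalar_mult)
  then have "frame_functional x i (scalar k * g) =
    (\<Sum>m\<in>Poly_Mapping.keys g. x (Inl (i, m)) * Poly_Mapping.lookup (scalar k * g) m)"
    by (rule frame_functional_superset[OF finite_keys])
  then show ?thesis
    by (simp only: frame_functional_def lookup_scalar_mult sum_distrib_left mult.left_commute)
qed

lemma frame_functional_diff:
  "frame_functional x i (g - h) = frame_functional x i g - frame_functional x i h"
  using frame_functional_add[of x i "g - h" h] by simp

lemma regular_on_frame_functional: "regular_on M (\<lambda>x. frame_functional x i g)"
  unfolding frame_functional_def
  by (intro regular_on_sum regular_on_mult regular_on_coordinate regular_on_const)

lemma regular_on_frame_vector: "regular_on M (\<lambda>x. frame_vector x i $ j)"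
  by (simp add: frame_vector_def regular_on_coordinate)

lemma is_frame_iff:
  "is_frame x (Z, L) \<longleftrightarrow>
     Z \<inter> forms 3 = {g \<in> forms 3. \<forall>i. frame_functional x i g = 0} \<and>
     L = vec.span (range (frame_vector x))"
  by (simp add: is_frame_def frame_functional_def frame_vector_def[abs_def])

text \<open>Linear forms \<open>T, X, Y\<close> that are kept fixed while the frame varies. Normal forms modulo \<open>Z\<close>
  and the dual basis of \<open>L\<close> are found from the frame by Cramer's rule.\<close>

locale plane_coordinates =
  fixes T X Y :: "5 mpoly"
  assumes linear: "T \<in> forms 1" "X \<in> forms 1" "Y \<in> forms 1"
begin

definition coordinate :: "3 \<Rightarrow> 5 mpoly" where
  "coordinate j = (if j = 1 then T else if j = 2 then X else Y)"

text \<open>The products are written with a factor \<open>T\<close> in front, because they arise from quadratic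
  normal forms multiplied by \<open>T\<close>.\<close>

definition cubic_basis :: "3 \<Rightarrow> 5 mpoly" where
  "cubic_basis k = (if k = 1 then T * X^2 else if k = 2 then T * (X * T) else T * T^2)"

definition functional_matrix :: "(frame_index \<Rightarrow> complex) \<Rightarrow> 3 \<Rightarrow> 3 \<Rightarrow> complex" where
  "functional_matrix x i k = frame_functional x i (cubic_basis k)"

definition vector_matrix :: "(frame_index \<Rightarrow> complex) \<Rightarrow> 3 \<Rightarrow> 3 \<Rightarrow> complex" where
  "vector_matrix x j l = meval (($) (frame_vector x l)) (coordinate j)"

definition normal_coefficient :: "5 mpoly \<Rightarrow> 3 \<Rightarrow> (frame_index \<Rightarrow> complex) \<Rightarrow> complex" where
  "normal_coefficient g k x =
     (\<Sum>l\<in>UNIV. adj3 (functional_matrix x) k l * frame_functional x l g) / det3 (functional_matrix x)"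

definition dual_vector :: "3 \<Rightarrow> (frame_index \<Rightarrow> complex) \<Rightarrow> complex^5" where
  "dual_vector j x = (\<chi> i. (\<Sum>l\<in>UNIV. adj3 (vector_matrix x) l j * frame_vector x l $ i)
     / det3 (vector_matrix x))"

lemma coordinate_forms: "coordinate j \<in> forms 1"
  using linear by (simp add: coordinate_def)

lemma cubic_basis_forms: "cubic_basis k \<in> forms 3"
proof -
  have "X^2 \<in> forms 2" "T^2 \<in> forms 2"
    using forms_power[OF linear(2), of 2] forms_power[OF linear(1), of 2] by simp_all
  moreover have "X * T \<in> forms 2"
    using forms_mult[OF linear(2,1)] unfolding one_add_one .
  ultimately have squares: "X^2 \<in> forms 2" "T^2 \<in> forms 2" "X * T \<in> forms 2" by blast+
  have "(1::nat) + 2 = 3" by simp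
  from squares[THEN forms_mult[OF linear(1)], unfolded this] show ?thesis
    by (simp add: cubic_basis_def)
qed

lemma regular_on_functional_matrix: "regular_on M (\<lambda>x. functional_matrix x i k)"
  unfolding functional_matrix_def by (rule regular_on_frame_functional)

lemma regular_on_vector_matrix: "regular_on M (\<lambda>x. vector_matrix x j l)"
  unfolding vector_matrix_def
  by (intro regular_on_linear_form regular_on_frame_vector coordinate_forms)

lemma dual_vector_eq:
  "dual_vector j x = (1 / det3 (vector_matrix x)) *s (\<Sum>l\<in>UNIV. adj3 (vector_matrix x) l j *s frame_vector x l)"
  by (simp add: vec_eq_iff dual_vector_def)

lemma meval_coordinate_sum:
  fixes g :: "5 mpoly"
  assumes "g \<in> forms 1"
  shows "meval (($) (\<Sum>l\<in>A. c l *s y l)) g = (\<Sum>l\<in>A. c l * meval (($) (y l)) g)"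
proof (induction A rule: infinite_finite_induct)
  case (insert l A)
  then show ?case
    by (simp only: sum.insert meval_forms_1_add[OF assms] meval_forms_1_scale[OF assms] not_False_eq_True)
qed (simp_all only: sum.infinite sum.empty meval_forms_1_0[OF assms] not_False_eq_True)

lemma coordinate_dual_vector:
  assumes "det3 (vector_matrix x) \<noteq> 0"
  shows "meval (($) (dual_vector k x)) (coordinate j) = (if j = k then 1 else 0)"
proof -
  have "meval (($) (dual_vector k x)) (coordinate j) =
     (1 / det3 (vector_matrix x)) * (\<Sum>l\<in>UNIV. vector_matrix x j l * adj3 (vector_matrix x) l k)"
    unfolding dual_vector_eq
    by (simp add: meval_forms_1_scale[OF coordinate_forms] meval_coordinate_sum[OF coordinate_forms]
        vector_matrix_def mult.commute)
  then show ?thesis using assms by (simp add: adj3_right)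
qed

text \<open>Both sides are linear in \<open>y\<close>, and they agree on the vectors of the frame.\<close>

lemma dual_vector_expansion:
  assumes "det3 (vector_matrix x) \<noteq> 0" "y \<in> vec.span (range (frame_vector x))"
  shows "y = (\<Sum>j\<in>UNIV. meval (($) y) (coordinate j) *s dual_vector j x)"
proof -
  let ?V = "{y. y = (\<Sum>j\<in>UNIV. meval (($) y) (coordinate j) *s dual_vector j x)}"
  have "vec.subspace ?V"
  proof (rule vec.subspaceI)
    show "0 \<in> ?V" by (simp add: meval_forms_1_0[OF coordinate_forms])
  next
    fix y z assume y: "y \<in> ?V" and z: "z \<in> ?V"
    have "(\<Sum>j\<in>UNIV. meval (($) (y + z)) (coordinate j) *s dual_vector j x) =
      (\<Sum>j\<in>UNIV. meval (($) y) (coordinate j) *s dual_vector j x) +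
      (\<Sum>j\<in>UNIV. meval (($) z) (coordinate j) *s dual_vector j x)"
      by (simp add: meval_forms_1_add[OF coordinate_forms] vec.scale_left_distrib sum.distrib)
    with y z show "y + z \<in> ?V" by simp
  next
    fix c y assume y: "y \<in> ?V"
    have "(\<Sum>j\<in>UNIV. meval (($) (c *s y)) (coordinate j) *s dual_vector j x) =
      c *s (\<Sum>j\<in>UNIV. meval (($) y) (coordinate j) *s dual_vector j x)"
      by (simp add: meval_forms_1_scale[OF coordinate_forms] vec.scale_sum_right)
    with y show "c *s y \<in> ?V" by simp
  qed
  moreover have "frame_vector x l \<in> ?V" for l
  proof -
    have "(\<Sum>j\<in>UNIV. vector_matrix x j l *s dual_vector j x) = frame_vector x l"
    proof (subst vec_eq_iff, rule allI)
      fix i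
      have "(\<Sum>j\<in>UNIV. vector_matrix x j l *s dual_vector j x) $ i =
        (\<Sum>j\<in>UNIV. \<Sum>m\<in>UNIV. vector_matrix x j l * adj3 (vector_matrix x) m j * frame_vector x m $ i)
          / det3 (vector_matrix x)"
        by (simp add: dual_vector_def sum_distrib_left sum_divide_distrib mult.assoc)
      also have "\<dots> = (\<Sum>m\<in>UNIV. (\<Sum>j\<in>UNIV. adj3 (vector_matrix x) m j * vector_matrix x j l) * frame_vector x m $ i)
          / det3 (vector_matrix x)"
        by (subst sum.swap) (simp only: sum_distrib_left mult.commute)
      also have "\<dots> = frame_vector x l $ i"
        using assms(1) by (simp add: adj3_left if_distrib[of "\<lambda>z. z * _"] cong: if_cong)
      finally show "(\<Sum>j\<in>UNIV. vector_matrix x j l *s dual_vector j x) $ i = frame_vector x l $ i" .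
    qed
    then show ?thesis by (simp add: vector_matrix_def)
  qed
  ultimately have "vec.span (range (frame_vector x)) \<subseteq> ?V"
    by (intro vec.span_minimal) auto
  with assms(2) show ?thesis by blast
qed

lemma dual_vector_mem: "dual_vector j x \<in> vec.span (range (frame_vector x))"
  unfolding dual_vector_eq
  by (intro vec.span_scale vec.span_sum vec.span_base) auto

lemma frame_functional_basis_sum:
  "frame_functional x i (\<Sum>k\<in>UNIV. scalar (r k) * cubic_basis k) = (\<Sum>k\<in>UNIV. functional_matrix x i k * r k)"
  by (simp add: sum_3 frame_functional_add frame_functional_scale functional_matrix_def mult.commute[of _ "r _"])

lemma basis_sum_forms: "(\<Sum>k\<in>UNIV. scalar (r k) * cubic_basis k) \<in> forms 3"
  by (intro forms_sum forms_smult cubic_basis_forms)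

lemma normal_coefficient_mem:
  assumes frame: "is_frame x (Z, L)" and det: "det3 (functional_matrix x) \<noteq> 0" and g: "g \<in> forms 3"
  shows "g - (\<Sum>k\<in>UNIV. scalar (normal_coefficient g k x) * cubic_basis k) \<in> Z"
proof -
  let ?n = "\<Sum>k\<in>UNIV. scalar (normal_coefficient g k x) * cubic_basis k"
  have "frame_functional x i (g - ?n) = 0" for i
  proof -
    have "frame_functional x i ?n = (\<Sum>k\<in>UNIV. \<Sum>l\<in>UNIV. functional_matrix x i k *
      (adj3 (functional_matrix x) k l * frame_functional x l g)) / det3 (functional_matrix x)"
      unfolding frame_functional_basis_sum normal_coefficient_def
      by (simp add: sum_distrib_left sum_divide_distrib)
    also have "\<dots> = (\<Sum>l\<in>UNIV. (\<Sum>k\<in>UNIV. functional_matrix x i k * adj3 (functional_matrix x) k l)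
       * frame_functional x l g) / det3 (functional_matrix x)"
      by (subst sum.swap) (simp add: sum_distrib_right mult.assoc)
    also have "\<dots> = frame_functional x i g"
      using det by (simp add: adj3_right if_distrib[of "\<lambda>z. z * _"] cong: if_cong)
    finally show ?thesis by (simp add: frame_functional_diff)
  qed
  moreover have "g - ?n \<in> forms 3" by (intro forms_diff g basis_sum_forms)
  ultimately have "g - ?n \<in> Z \<inter> forms 3" using frame unfolding is_frame_iff by blast
  then show ?thesis by blast
qed

lemma basis_independent:
  assumes frame: "is_frame x (Z, L)" and det: "det3 (functional_matrix x) \<noteq> 0"
    and mem: "(\<Sum>k\<in>UNIV. scalar (r k) * cubic_basis k) \<in> Z"
  shows "r k = 0"
proof -
  have "(\<Sum>k\<in>UNIV. functional_matrix x i k * r k) = 0" for i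
    using mem basis_sum_forms[of r] frame unfolding is_frame_iff frame_functional_basis_sum[symmetric] by blast
  then have "(\<Sum>i\<in>UNIV. adj3 (functional_matrix x) k i * (\<Sum>l\<in>UNIV. functional_matrix x i l * r l)) = 0"
    by simp
  also have "(\<Sum>i\<in>UNIV. adj3 (functional_matrix x) k i * (\<Sum>l\<in>UNIV. functional_matrix x i l * r l))
    = (\<Sum>l\<in>UNIV. (\<Sum>i\<in>UNIV. adj3 (functional_matrix x) k i * functional_matrix x i l) * r l)"
    unfolding sum_distrib_left sum_distrib_right by (subst sum.swap) (simp add: mult.assoc)
  also have "\<dots> = det3 (functional_matrix x) * r k"
    by (simp add: adj3_left if_distrib[of "\<lambda>z. z * _"] cong: if_cong)
  finally show ?thesis using det by simp
qed

lemma plane_scheme_of_frame: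
  assumes blowup: "(Z, L) \<in> blowup_Hilb3 S" and frame: "is_frame x (Z, L)"
    and det: "det3 (functional_matrix x) \<noteq> 0" "det3 (vector_matrix x) \<noteq> 0"
  shows "plane_scheme Z L T X Y (dual_vector 1 x) (dual_vector 2 x) (dual_vector 3 x)
    (normal_coefficient (Y * T^2) 3 x) (normal_coefficient (Y * T^2) 2 x) (normal_coefficient (Y * T^2) 1 x)
    (normal_coefficient (X^3) 3 x) (normal_coefficient (X^3) 2 x) (normal_coefficient (X^3) 1 x)"
proof -
  have Z: "closed_subscheme Z" "is_plane L" "linear_subspace_ideal L \<subseteq> Z"
    using blowup by (auto simp: blowup_Hilb3_def Hilb3_def finite_length_scheme_def)
  have L: "L = vec.span (range (frame_vector x))" using frame by (simp add: is_frame_iff)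
  have dual: "meval (($) (dual_vector 1 x)) T = 1" "meval (($) (dual_vector 1 x)) X = 0"
    "meval (($) (dual_vector 1 x)) Y = 0" "meval (($) (dual_vector 2 x)) T = 0"
    "meval (($) (dual_vector 2 x)) X = 1" "meval (($) (dual_vector 2 x)) Y = 0"
    "meval (($) (dual_vector 3 x)) T = 0" "meval (($) (dual_vector 3 x)) X = 0"
    "meval (($) (dual_vector 3 x)) Y = 1"
    using coordinate_dual_vector[OF det(2), of 1 1] coordinate_dual_vector[OF det(2), of 1 2]
      coordinate_dual_vector[OF det(2), of 1 3] coordinate_dual_vector[OF det(2), of 2 1]
      coordinate_dual_vector[OF det(2), of 2 2] coordinate_dual_vector[OF det(2), of 2 3]
      coordinate_dual_vector[OF det(2), of 3 1] coordinate_dual_vector[OF det(2), of 3 2]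
      coordinate_dual_vector[OF det(2), of 3 3]
    by (simp_all add: coordinate_def)
  have forms: "Y * T^2 \<in> forms 3" "X^3 \<in> forms 3"
    using forms_mult[OF linear(3) forms_power[OF linear(1), of 2]] forms_power[OF linear(2), of 3]
    by (simp_all add: numeral_3_eq_3)
  show ?thesis
  proof (unfold_locales)
    show "homogeneous_ideal Z" "saturation Z = Z" using Z by (auto simp: closed_subscheme_def)
    show "linear_subspace_ideal L \<subseteq> Z" by fact
    show "T \<in> forms 1" "X \<in> forms 1" "Y \<in> forms 1" by (fact linear)+
    show "vec.subspace L" using Z by (simp add: is_plane_def)
    show "dual_vector 1 x \<in> L" "dual_vector 2 x \<in> L" "dual_vector 3 x \<in> L"
      unfolding L by (rule dual_vector_mem)+
    show "meval (($) (dual_vector 1 x)) T = 1" "meval (($) (dual_vector 1 x)) X = 0"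
      "meval (($) (dual_vector 1 x)) Y = 0" "meval (($) (dual_vector 2 x)) T = 0"
      "meval (($) (dual_vector 2 x)) X = 1" "meval (($) (dual_vector 2 x)) Y = 0"
      "meval (($) (dual_vector 3 x)) T = 0" "meval (($) (dual_vector 3 x)) X = 0"
      "meval (($) (dual_vector 3 x)) Y = 1" by (fact dual)+
    show "y = meval (($) y) T *s dual_vector 1 x + meval (($) y) X *s dual_vector 2 x
       + meval (($) y) Y *s dual_vector 3 x" if "y \<in> L" for y
      using dual_vector_expansion[OF det(2) that[unfolded L]] by (simp add: sum_3 coordinate_def)
    show "r2 = 0 \<and> r1 = 0 \<and> r0 = 0"
      if "T * (scalar r2 * X^2 + scalar r1 * X * T + scalar r0 * T^2) \<in> Z" for r2 r1 r0
    proof -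
      let ?r = "\<lambda>k::3. if k = 1 then r2 else if k = 2 then r1 else r0"
      have "(\<Sum>k\<in>UNIV. scalar (?r k) * cubic_basis k) =
        T * (scalar r2 * X^2 + scalar r1 * X * T + scalar r0 * T^2)"
        by (simp add: sum_3 cubic_basis_def algebra_simps)
      then have "?r k = 0" for k using basis_independent[OF frame det(1), of ?r k] that by simp
      from this[of 1] this[of 2] this[of 3] show ?thesis by simp
    qed
    show "\<forall>g\<in>forms 3. \<exists>h. g - T * h \<in> Z"
    proof
      fix g :: "5 mpoly" assume g: "g \<in> forms 3"
      define r :: "3 \<Rightarrow> 5 mpoly" where "r k = scalar (normal_coefficient g k x)" for k
      have sum: "(\<Sum>k\<in>UNIV. r k * cubic_basis k) = T * (r 1 * X^2 + r 2 * (X * T) + r 3 * T^2)"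
        by (simp add: sum_3 cubic_basis_def algebra_simps)
      have "g - (\<Sum>k\<in>UNIV. r k * cubic_basis k) \<in> Z"
        unfolding r_def by (rule normal_coefficient_mem[OF frame det(1) g])
      then show "\<exists>h. g - T * h \<in> Z" unfolding sum by blast
    qed
    have "T * plane_chart.quad0 (scalar (normal_coefficient (Y * T^2) 3 x))
       (scalar (normal_coefficient (Y * T^2) 2 x)) (scalar (normal_coefficient (Y * T^2) 1 x)) T X Y =
      Y * T^2 - (\<Sum>k\<in>UNIV. scalar (normal_coefficient (Y * T^2) k x) * cubic_basis k)"
      by (simp add: sum_3 cubic_basis_def plane_chart.quad0_def algebra_simps power2_eq_square)
    then show "T * plane_chart.quad0 (scalar (normal_coefficient (Y * T^2) 3 x))
       (scalar (normal_coefficient (Y * T^2) 2 x)) (scalar (normal_coefficient (Y * T^2) 1 x)) T X Y \<in> Z"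
      using normal_coefficient_mem[OF frame det(1) forms(1)] by simp
    have "plane_chart.cubic (scalar (normal_coefficient (X^3) 3 x))
       (scalar (normal_coefficient (X^3) 2 x)) (scalar (normal_coefficient (X^3) 1 x)) T X =
      X^3 - (\<Sum>k\<in>UNIV. scalar (normal_coefficient (X^3) k x) * cubic_basis k)"
      by (simp add: sum_3 cubic_basis_def plane_chart.cubic_def algebra_simps power2_eq_square power3_eq_cube)
    then show "plane_chart.cubic (scalar (normal_coefficient (X^3) 3 x))
       (scalar (normal_coefficient (X^3) 2 x)) (scalar (normal_coefficient (X^3) 1 x)) T X \<in> Z"
      using normal_coefficient_mem[OF frame det(1) forms(2)] by simp
  qed
qed

text \<open>The polynomial \<open>g\<close> is the numerator of the linkage obstruction times the two determinants
  that make \<open>T, X, Y\<close> and the cubic monomials usable as coordinates. If \<open>Z\<close> is not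
  collinear, then \<open>L\<close> is its span, so both branches of the extended involution say that \<open>Z\<close>
  is its own residual in \<open>L\<close>.\<close>

lemma self_residual_near_Y_is_collinear:
  assumes q: "q \<in> forms 2" and f: "f \<in> forms 3"
    and Y_locus: "(Z0, L0) \<in> Y_locus (surface_ideal q f)" and frame0: "is_frame x0 (Z0, L0)"
    and det0: "det3 (functional_matrix x0) \<noteq> 0" "det3 (vector_matrix x0) \<noteq> 0"
    and Y: "Y \<in> Z0"
  shows "\<exists>g. meval x0 g \<noteq> 0 \<and> (\<forall>x Z L. is_frame x (Z, L) \<and> (Z, L) \<in> fixed_points (surface_ideal q f)
    \<and> meval x g \<noteq> 0 \<longrightarrow> Z \<in> Ind (surface_ideal q f))"
proof -
  let ?S = "surface_ideal q f"
  obtain P where P: "(\<lambda>x. det3 (functional_matrix x)) = (\<lambda>x. meval x P)"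
    by (rule polynomial_functionE[of "\<lambda>x. det3 (functional_matrix x)"])
      (auto simp: polynomial_function_def intro: regular_on_det3 regular_on_functional_matrix)
  obtain Q where Q: "(\<lambda>x. det3 (vector_matrix x)) = (\<lambda>x. meval x Q)"
    by (rule polynomial_functionE[of "\<lambda>x. det3 (vector_matrix x)"])
      (auto simp: polynomial_function_def intro: regular_on_det3 regular_on_vector_matrix)
  note P = fun_cong[OF P] and Q = fun_cong[OF Q]
  define M where "M = P * Q"
  have M: "meval x M \<noteq> 0 \<longleftrightarrow> det3 (functional_matrix x) \<noteq> 0 \<and> det3 (vector_matrix x) \<noteq> 0" for x
    by (simp add: M_def P Q)
  have reg_normal: "regular_on M (normal_coefficient g k)" for g k
    unfolding normal_coefficient_def[abs_def] P M_def
    by (intro regular_on_inverse_left regular_on_sum regular_on_mult regular_on_adj3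
        regular_on_functional_matrix regular_on_frame_functional)
  have reg_dual: "regular_on M (\<lambda>x. dual_vector j x $ i)" for i j
    unfolding dual_vector_def vec_lambda_beta Q M_def
    by (intro regular_on_inverse_right regular_on_sum regular_on_mult regular_on_adj3
        regular_on_vector_matrix regular_on_frame_vector)
  obtain k where k: "\<And>i. regular_on M (k i)" "\<And>x L.
      expands_linear_forms L T X Y (dual_vector 1 x) (dual_vector 2 x) (dual_vector 3 x) \<Longrightarrow>
      q - ternary_quadric (\<lambda>i. k i x) T X Y \<in> linear_subspace_ideal L"
    using regular_quadric_expansion[OF reg_dual[of 1] reg_dual[of 2] reg_dual[of 3] q] by metis
  obtain l where l: "\<And>i. regular_on M (l i)" "\<And>x L.
      expands_linear_forms L T X Y (dual_vector 1 x) (dual_vector 2 x) (dual_vector 3 x) \<Longrightarrow>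
      f - ternary_cubic (\<lambda>i. l i x) T X Y \<in> linear_subspace_ideal L"
    using regular_cubic_expansion[OF reg_dual[of 1] reg_dual[of 2] reg_dual[of 3] f] by metis
  define ob where "ob x = linkage_obstruction
    (normal_coefficient (Y * T^2) 3 x) (normal_coefficient (Y * T^2) 2 x) (normal_coefficient (Y * T^2) 1 x)
    (normal_coefficient (X^3) 3 x) (normal_coefficient (X^3) 2 x) (normal_coefficient (X^3) 1 x)
    (\<lambda>i. k i x) (\<lambda>i. l i x)" for x
  have reg_ob: "regular_on M ob"
    unfolding ob_def[abs_def] by (intro regular_on_linkage_obstruction reg_normal k l)
  have residual: "self_residual_scheme Z L T X Y (dual_vector 1 x) (dual_vector 2 x) (dual_vector 3 x)
    (normal_coefficient (Y * T^2) 3 x) (normal_coefficient (Y * T^2) 2 x) (normal_coefficient (Y * T^2) 1 x)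
    (normal_coefficient (X^3) 3 x) (normal_coefficient (X^3) 2 x) (normal_coefficient (X^3) 1 x)
    q f (k 0 x) (k 1 x) (k 2 x) (k 3 x) (k 4 x) (k 5 x) (l 0 x) (l 1 x) (l 2 x) (l 3 x) (l 4 x)
    (l 5 x) (l 6 x) (l 7 x) (l 8 x) (l 9 x)"
    if blowup: "(Z, L) \<in> blowup_Hilb3 ?S" and frame: "is_frame x (Z, L)"
      and nz: "meval x M \<noteq> 0" and res: "residual ?S L Z = Z" for x Z L
  proof -
    interpret plane_scheme Z L T X Y "dual_vector 1 x" "dual_vector 2 x" "dual_vector 3 x"
      "normal_coefficient (Y * T^2) 3 x" "normal_coefficient (Y * T^2) 2 x" "normal_coefficient (Y * T^2) 1 x"
      "normal_coefficient (X^3) 3 x" "normal_coefficient (X^3) 2 x" "normal_coefficient (X^3) 1 x"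
      using plane_scheme_of_frame[OF blowup frame] nz M by blast
    have exp: "expands_linear_forms L T X Y (dual_vector 1 x) (dual_vector 2 x) (dual_vector 3 x)"
      unfolding expands_linear_forms_def using linear_form_mod_K by blast
    show ?thesis
    proof unfold_locales
      show "?S \<subseteq> Z" using blowup by (simp add: blowup_Hilb3_def Hilb3_def)
    qed (use res k(2)[OF exp] l(2)[OF exp] in \<open>simp_all add: ternary_quadric_def ternary_cubic_def\<close>)
  qed
  have Z0: "(Z0, L0) \<in> blowup_Hilb3 ?S" "residual ?S L0 Z0 = Z0" "meval x0 M \<noteq> 0"
    using Y_locus det0 M by (auto simp: Y_locus_def fixed_points_def exceptional_divisor_def beauville_ext_def)
  have "ob x0 \<noteq> 0"
  proof -
    interpret self_residual_scheme Z0 L0 T X Y "dual_vector 1 x0" "dual_vector 2 x0" "dual_vector 3 x0"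
      "normal_coefficient (Y * T^2) 3 x0" "normal_coefficient (Y * T^2) 2 x0" "normal_coefficient (Y * T^2) 1 x0"
      "normal_coefficient (X^3) 3 x0" "normal_coefficient (X^3) 2 x0" "normal_coefficient (X^3) 1 x0"
      q f "k 0 x0" "k 1 x0" "k 2 x0" "k 3 x0" "k 4 x0" "k 5 x0" "l 0 x0" "l 1 x0" "l 2 x0" "l 3 x0" "l 4 x0"
      "l 5 x0" "l 6 x0" "l 7 x0" "l 8 x0" "l 9 x0"
      by (rule residual[OF Z0(1) frame0 Z0(3,2)])
    have YT: "Y * T^2 \<in> Z0" by (rule ideal_mult_right[OF ideal_Z Y])
    have "Y * T^2 \<in> forms 3"
      using forms_mult[OF linear(3) forms_power[OF linear(1), of 2]] by (simp add: numeral_3_eq_3)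
    with YT have "frame_functional x0 i (Y * T^2) = 0" for i
      using frame0 unfolding is_frame_iff by blast
    then have "normal_coefficient (Y * T^2) j x0 = 0" for j
      by (simp add: normal_coefficient_def)
    then show ?thesis
      unfolding ob_def linkage_obstruction_def by (intro nondegenerate_at_collinear_scheme)
  qed
  from regular_on_nonvanishing[OF reg_ob Z0(3) this] obtain g where
    g: "meval x0 g \<noteq> 0" "\<And>x. meval x g \<noteq> 0 \<Longrightarrow> meval x M \<noteq> 0 \<and> ob x \<noteq> 0" by blast
  have "Z \<in> Ind ?S" if frame: "is_frame x (Z, L)" and fixed: "(Z, L) \<in> fixed_points ?S"
    and nz: "meval x g \<noteq> 0" for x Z L
  proof (rule ccontr)
    assume not_Ind: "Z \<notin> Ind ?S"
    have blowup: "(Z, L) \<in> blowup_Hilb3 ?S" and beauville: "beauville ?S Z = Z"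
      using fixed not_Ind by (auto simp: fixed_points_def beauville_ext_def)
    have nzM: "meval x M \<noteq> 0" "ob x \<noteq> 0" using g(2)[OF nz] by blast+
    interpret plane_scheme Z L T X Y "dual_vector 1 x" "dual_vector 2 x" "dual_vector 3 x"
      "normal_coefficient (Y * T^2) 3 x" "normal_coefficient (Y * T^2) 2 x" "normal_coefficient (Y * T^2) 1 x"
      "normal_coefficient (X^3) 3 x" "normal_coefficient (X^3) 2 x" "normal_coefficient (X^3) 1 x"
      using plane_scheme_of_frame[OF blowup frame] nzM M by blast
    have c: "normal_coefficient (Y * T^2) 1 x \<noteq> 0"
      using linear_span_is_line not_Ind blowup by (auto simp: Ind_def blowup_Hilb3_def)
    have res: "residual ?S L Z = Z"
      using beauville linear_span_eq_plane[OF c] by (simp add: beauville_def)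
    interpret self_residual_scheme Z L T X Y "dual_vector 1 x" "dual_vector 2 x" "dual_vector 3 x"
      "normal_coefficient (Y * T^2) 3 x" "normal_coefficient (Y * T^2) 2 x" "normal_coefficient (Y * T^2) 1 x"
      "normal_coefficient (X^3) 3 x" "normal_coefficient (X^3) 2 x" "normal_coefficient (X^3) 1 x"
      q f "k 0 x" "k 1 x" "k 2 x" "k 3 x" "k 4 x" "k 5 x" "l 0 x" "l 1 x" "l 2 x" "l 3 x" "l 4 x"
      "l 5 x" "l 6 x" "l 7 x" "l 8 x" "l 9 x"
      by (rule residual[OF blowup frame nzM(1) res])
    have "normal_coefficient (Y * T^2) 1 x * ob x = 0"
      unfolding ob_def linkage_obstruction_def using linkage_equations(1)
      by (simp add: C.r2_def algebra_simps)
    with c nzM show False by simp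
  qed
  with g show ?thesis by blast
qed

end

section \<open>Duality and the Hilbert function\<close>

lemma dual_functional:
  fixes B :: "(complex^5) set" and h :: "complex^5 \<Rightarrow> complex"
  assumes "vec.independent B"
  shows "\<exists>\<phi>. \<forall>b\<in>B. meval (($) b) (linear_form \<phi>) = h b"
proof -
  obtain g :: "complex^5 \<Rightarrow> complex^5" where
    g: "Vector_Spaces.linear (*s) (*s) g" "\<forall>b\<in>B. g b = h b *s axis 1 1"
    using vec.linear_independent_extend[OF assms, of "\<lambda>b. h b *s axis 1 1"] by blast
  have "meval (($) b) (linear_form (row 1 (matrix g))) = h b" if "b \<in> B" for b
  proof -
    have "meval (($) b) (linear_form (row 1 (matrix g))) = (matrix g *v b) $ 1"
      by (simp add: meval_linear_form row_def matrix_vector_mult_def)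
    also have "\<dots> = h b" using g that by (simp add: matrix_works axis_def)
    finally show ?thesis .
  qed
  then show ?thesis by blast
qed

lemma separating_functional:
  assumes V: "vec.subspace V" and x: "x \<notin> V"
  obtains \<phi> :: "complex^5" where "\<And>v. v \<in> V \<Longrightarrow> meval (($) v) (linear_form \<phi>) = 0"
    "meval (($) x) (linear_form \<phi>) = 1"
proof -
  obtain B where B: "B \<subseteq> V" "vec.independent B" "V \<subseteq> vec.span B" "card B = vec.dim V"
    by (rule vec.basis_exists)
  have "vec.span B \<subseteq> V" by (rule vec.span_minimal[OF B(1) V])
  then have xB: "x \<notin> vec.span B" using x by blast
  then have "vec.independent (insert x B)" using B(2) by (simp add: vec.independent_insertI)
  from dual_functional[OF this, of "\<lambda>b. if b = x then 1 else 0"] obtain \<phi> where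
    \<phi>: "\<forall>b\<in>insert x B. meval (($) b) (linear_form \<phi>) = (if b = x then 1 else 0)" ..
  have "x \<notin> B" using xB vec.span_base by blast
  have "meval (($) v) (linear_form \<phi>) = 0" if "v \<in> V" for v
  proof (rule forms_1_vanish_on_span[OF linear_form_forms])
    show "v \<in> vec.span B" using B(3) that by blast
    show "meval (($) b) (linear_form \<phi>) = 0" if "b \<in> B" for b
      using \<phi> \<open>x \<notin> B\<close> that by auto
  qed
  moreover have "meval (($) x) (linear_form \<phi>) = 1" using \<phi> by simp
  ultimately show ?thesis using that by blast
qed

text \<open>The bidual of a space of linear forms is the space itself: a form outside of it is
  separated from it by a vector, and this vector is a point of the span.\<close>

lemma linear_form_mem_of_vanishing:
  assumes Z: "is_ideal Z" and g: "g \<in> forms 1"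
    and vanish: "\<And>y. y \<in> linear_span Z \<Longrightarrow> meval (($) y) g = 0"
  shows "g \<in> Z"
proof (rule ccontr)
  assume "g \<notin> Z"
  obtain \<psi> where \<psi>: "g = linear_form \<psi>" using g by (rule forms_1E)
  let ?V = "{\<phi>. linear_form \<phi> \<in> Z}"
  have "linear_form 0 = 0" by (simp add: linear_form_def)
  then have "vec.subspace ?V"
    by (intro vec.subspaceI)
      (simp_all add: linear_form_add linear_form_scale ideal_0[OF Z] ideal_add[OF Z] ideal_scale[OF Z])
  moreover have "\<psi> \<notin> ?V" using \<open>g \<notin> Z\<close> \<psi> by simp
  ultimately obtain y where y: "\<And>\<phi>. \<phi> \<in> ?V \<Longrightarrow> meval (($) \<phi>) (linear_form y) = 0"
    "meval (($) \<psi>) (linear_form y) = 1"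
    using separating_functional by blast
  have swap: "meval (($) \<phi>) (linear_form y) = meval (($) y) (linear_form \<phi>)" for \<phi>
    by (simp add: meval_linear_form mult.commute)
  have "y \<in> linear_span Z"
    unfolding linear_span_def
  proof safe
    fix p assume p: "p \<in> Z" "p \<in> forms 1"
    obtain \<phi> where "p = linear_form \<phi>" using p(2) by (rule forms_1E)
    then show "meval (($) y) p = 0" using y(1)[of \<phi>] p swap by simp
  qed
  then show False using vanish y(2) swap \<psi> by simp
qed

lemma linear_span_subset_of_ideal_subset:
  assumes "vec.subspace L" "linear_subspace_ideal L \<subseteq> Z"
  shows "linear_span Z \<subseteq> L"
proof (rule ccontr)
  assume "\<not> linear_span Z \<subseteq> L"
  then obtain x where x: "x \<in> linear_span Z" "x \<notin> L" by blast
  obtain \<phi> where \<phi>: "\<And>v. v \<in> L \<Longrightarrow> meval (($) v) (linear_form \<phi>) = 0"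
    "meval (($) x) (linear_form \<phi>) = 1"
    using separating_functional[OF assms(1) x(2)] by blast
  have "linear_form \<phi> \<in> Z" using \<phi>(1) assms(2) by (auto simp: linear_subspace_ideal_def)
  then show False using x(1) \<phi>(2) linear_form_forms[of \<phi>] by (auto simp: linear_span_def)
qed

text \<open>A basis of the forms modulo the ideal extends a basis of the forms in the ideal to one of
  all forms.\<close>

lemma hilbert_function_eqI:
  fixes I :: "'v::finite mpoly set" and e :: "nat \<Rightarrow> 'v mpoly"
  assumes I: "is_ideal I" and e: "\<And>i. i < n \<Longrightarrow> e i \<in> forms d"
    and span: "\<And>g. g \<in> forms d \<Longrightarrow> \<exists>c. g - (\<Sum>i<n. scalar (c i) * e i) \<in> I"
    and indep: "\<And>c i. (\<Sum>i<n. scalar (c i) * e i) \<in> I \<Longrightarrow> i < n \<Longrightarrow> c i = 0"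
  shows "hilbert_function I d = n"
proof -
  interpret vs: vector_space "\<lambda>c p. scalar c * p :: 'v mpoly"
    by unfold_locales (simp_all only: distrib_left distrib_right single_add scalar_mult mult.assoc single_one mult_1_left)
  let ?W = "I \<inter> forms d"
  have sub: "vs.subspace (forms d :: 'v mpoly set)"
    by (intro vs.subspaceI forms_0 forms_add forms_smult)
  have subW: "vs.subspace ?W"
    by (intro vs.subspaceI IntI)
      (auto intro: ideal_0[OF I] ideal_add[OF I] ideal_scale[OF I] forms_add forms_smult)
  obtain B where B: "B \<subseteq> ?W" "vs.independent B" "?W \<subseteq> vs.span B" "card B = vs.dim ?W"
    by (rule vs.basis_exists)
  have spanB: "vs.span B \<subseteq> ?W" by (rule vs.span_minimal[OF B(1) subW])
  define Mon where "Mon = (\<lambda>m. Poly_Mapping.single m 1 :: 'v mpoly) ` {m. mono_degree m = d}"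
  have "finite Mon" unfolding Mon_def by (intro finite_imageI finite_monomials_of_degree)
  have "g \<in> vs.span Mon" if "g \<in> forms d" for g
    using that
  proof (induction rule: forms_induct)
    case (single m c)
    have "Poly_Mapping.single m c = scalar c * Poly_Mapping.single m 1" by (simp add: mult_single)
    moreover have "Poly_Mapping.single m 1 \<in> Mon" using single by (simp add: Mon_def)
    ultimately show ?case by (metis vs.span_base vs.span_scale)
  qed (auto intro: vs.span_zero vs.span_add)
  then have "B \<subseteq> vs.span Mon" using B(1) by blast
  then have finB: "finite B" using vs.independent_span_bound[OF \<open>finite Mon\<close> B(2)] by blast
  have comb: "\<exists>c. x = (\<Sum>i<m. scalar (c i) * e i)" if "x \<in> vs.span (e ` {..<m})" for x m
  proof -
    let ?U = "{x. \<exists>c. x = (\<Sum>i<m. scalar (c i) * e i)}"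
    have "vs.subspace ?U"
    proof (rule vs.subspaceI)
      show "0 \<in> ?U" by (rule CollectI, rule exI[of _ "\<lambda>i. 0"]) simp
    next
      fix x y assume "x \<in> ?U" "y \<in> ?U"
      then obtain c c' where "x = (\<Sum>i<m. scalar (c i) * e i)" "y = (\<Sum>i<m. scalar (c' i) * e i)" by blast
      then have "x + y = (\<Sum>i<m. scalar (c i + c' i) * e i)"
        by (simp only: sum.distrib[symmetric] single_add distrib_right)
      then show "x + y \<in> ?U" by (intro CollectI exI[of _ "\<lambda>i. c i + c' i"])
    next
      fix k x assume "x \<in> ?U"
      then obtain c where "x = (\<Sum>i<m. scalar (c i) * e i)" by blast
      then have "scalar k * x = (\<Sum>i<m. scalar (k * c i) * e i)"
        by (simp only: sum_distrib_left scalar_mult mult.assoc)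
      then show "scalar k * x \<in> ?U" by (intro CollectI exI[of _ "\<lambda>i. k * c i"])
    qed
    moreover have "e ` {..<m} \<subseteq> ?U"
    proof safe
      fix j assume j: "j < m"
      have "(\<Sum>i<m. scalar (if i = j then 1 else 0) * e i) = (\<Sum>i<m. if i = j then e i else 0)"
        by (intro sum.cong) (auto simp del: mult_single)
      also have "\<dots> = e j" using j by simp
      finally show "\<exists>c. e j = (\<Sum>i<m. scalar (c i) * e i)"
        by (intro exI[of _ "\<lambda>i. if i = j then 1 else 0"]) (rule sym)
    qed
    ultimately have "vs.span (e ` {..<m}) \<subseteq> ?U" by (intro vs.span_minimal)
    with that show ?thesis by blast
  qed
  have new: "vs.independent (B \<union> e ` {..<m}) \<and> card (B \<union> e ` {..<m}) = card B + m" if "m \<le> n" for m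
    using that
  proof (induction m)
    case 0
    then show ?case using B by simp
  next
    case (Suc m)
    have "e m \<notin> vs.span (B \<union> e ` {..<m})"
    proof
      assume "e m \<in> vs.span (B \<union> e ` {..<m})"
      then obtain y z where yz: "e m = y + z" "y \<in> vs.span B" "z \<in> vs.span (e ` {..<m})"
        unfolding vs.span_Un by blast
      obtain c where c: "z = (\<Sum>i<m. scalar (c i) * e i)" using comb yz(3) by blast
      define c' where "c' i = (if i < m then - c i else if i = m then 1 else 0)" for i
      have "(\<Sum>i<n. scalar (c' i) * e i) = (\<Sum>i<Suc m. scalar (c' i) * e i)"
        by (rule sum.mono_neutral_right) (use Suc in \<open>auto simp: c'_def\<close>)
      also have "\<dots> = (\<Sum>i<m. scalar (c' i) * e i) + e m"
        by (simp add: c'_def)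
      also have "(\<Sum>i<m. scalar (c' i) * e i) = - z"
        unfolding c sum_negf[symmetric] by (intro sum.cong) (auto simp: c'_def single_uminus)
      also have "- z + e m = y" using yz by simp
      finally have "(\<Sum>i<n. scalar (c' i) * e i) \<in> I" using yz spanB by auto
      from indep[OF this, of m] show False using Suc by (simp add: c'_def)
    qed
    moreover from this have "e m \<notin> B \<union> e ` {..<m}"
      using vs.span_base[of "e m" "B \<union> e ` {..<m}"] by fast
    moreover have "B \<union> e ` {..<Suc m} = insert (e m) (B \<union> e ` {..<m})"
      by (auto simp: lessThan_Suc)
    ultimately show ?case using Suc finB by (simp add: vs.independent_insertI)
  qed
  have "vs.span (forms d) = vs.span (B \<union> e ` {..<n})"
  proof
    have "g \<in> vs.span (B \<union> e ` {..<n})" if g: "g \<in> forms d" for g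
    proof -
      obtain c where c: "g - (\<Sum>i<n. scalar (c i) * e i) \<in> I" using span[OF g] by blast
      have "g - (\<Sum>i<n. scalar (c i) * e i) \<in> forms d"
        by (intro forms_diff forms_sum forms_smult e g) simp
      then have "g - (\<Sum>i<n. scalar (c i) * e i) \<in> vs.span (B \<union> e ` {..<n})"
        using c B(3) vs.span_mono[of B "B \<union> e ` {..<n}"] by blast
      moreover have "(\<Sum>i<n. scalar (c i) * e i) \<in> vs.span (B \<union> e ` {..<n})"
        by (intro vs.span_sum vs.span_scale vs.span_base) auto
      ultimately have "g - (\<Sum>i<n. scalar (c i) * e i) + (\<Sum>i<n. scalar (c i) * e i) \<in> vs.span (B \<union> e ` {..<n})"
        by (rule vs.span_add)
      then show ?thesis by simp
    qed
    then show "vs.span (forms d) \<subseteq> vs.span (B \<union> e ` {..<n})"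
      by (intro vs.span_minimal vs.subspace_span) blast
    show "vs.span (B \<union> e ` {..<n}) \<subseteq> vs.span (forms d)"
      by (rule vs.span_mono) (use B e in auto)
  qed
  then have "vs.dim (forms d) = card B + n"
    using vs.dim_eq_card[of "B \<union> e ` {..<n}" "forms d"] new[of n] by simp
  then show ?thesis
    unfolding hilbert_function_def using B(4) by simp
qed

section \<open>Collinear schemes and binary forms\<close>

text \<open>The passage from polynomials in \<open>x = X / T\<close> of degree at most \<open>d\<close> to binary forms of
  degree \<open>d\<close>.\<close>

definition homogenise :: "'v mpoly \<Rightarrow> 'v mpoly \<Rightarrow> nat \<Rightarrow> complex poly \<Rightarrow> 'v mpoly" where
  "homogenise T X d h = (\<Sum>i\<le>d. scalar (coeff h i) * (X^i * T^(d - i)))"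

lemma homogenise_add: "homogenise T X d (h + k) = homogenise T X d h + homogenise T X d k"
  by (simp add: homogenise_def single_add distrib_right sum.distrib)

lemma homogenise_smult: "homogenise T X d (smult c h) = scalar c * homogenise T X d h"
  by (simp only: homogenise_def coeff_smult scalar_mult sum_distrib_left mult.assoc)

lemma homogenise_0 [simp]: "homogenise T X d 0 = 0"
  by (simp add: homogenise_def)

lemma X_homogenise: "X * homogenise T X d h = homogenise T X (Suc d) (pCons 0 h)"
proof -
  have "homogenise T X (Suc d) (pCons 0 h) = (\<Sum>i\<le>d. scalar (coeff h i) * (X^Suc i * T^(d - i)))"
    unfolding homogenise_def by (subst sum.atMost_Suc_shift) simp
  also have "\<dots> = X * homogenise T X d h"
    unfolding homogenise_def sum_distrib_left by (intro sum.cong) (simp_all add: mult_ac)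
  finally show ?thesis ..
qed

lemma T_homogenise:
  assumes "degree h \<le> d"
  shows "T * homogenise T X d h = homogenise T X (Suc d) h"
proof -
  have "homogenise T X (Suc d) h = (\<Sum>i\<le>d. scalar (coeff h i) * (X^i * T^(Suc d - i)))"
    using assms by (simp add: homogenise_def coeff_eq_0)
  also have "\<dots> = T * homogenise T X d h"
    unfolding homogenise_def sum_distrib_left by (intro sum.cong) (simp_all add: Suc_diff_le mult_ac)
  finally show ?thesis ..
qed

lemma T_power_homogenise:
  assumes "degree h \<le> d"
  shows "T ^ m * homogenise T X d h = homogenise T X (m + d) h"
proof (induction m)
  case (Suc m)
  then show ?case using T_homogenise[of h "m + d" T X] assms by (simp add: mult.assoc)
qed simp

lemma homogenise_pCons: "homogenise T X (Suc d) (pCons a h) = scalar a * T ^ Suc d + X * homogenise T X d h"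
proof -
  have "homogenise T X (Suc d) [:a:] = scalar a * T ^ Suc d"
    unfolding homogenise_def by (subst sum.atMost_Suc_shift) simp
  moreover have "pCons a h = [:a:] + pCons 0 h" by simp
  ultimately show ?thesis by (simp only: homogenise_add X_homogenise)
qed

lemma homogenise_mult:
  assumes "degree h \<le> d" "degree k \<le> e"
  shows "homogenise T X (d + e) (h * k) = homogenise T X d h * homogenise T X e k"
  using assms(1)
proof (induction h arbitrary: d)
  case (pCons a h)
  show ?case
  proof (cases d)
    case 0
    then have "h = 0" using pCons.prems by (simp split: if_splits)
    then show ?thesis using 0 by (simp add: homogenise_smult homogenise_def[of T X 0 "[:a:]"])
  next
    case (Suc d')
    have h: "degree h \<le> d'" using pCons.prems Suc by (simp split: if_splits)
    have "pCons a h * k = smult a k + pCons 0 (h * k)" by simp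
    then have "homogenise T X (d + e) (pCons a h * k) =
      scalar a * homogenise T X (d + e) k + X * (homogenise T X d' h * homogenise T X e k)"
      using pCons.IH[OF h] by (simp only: homogenise_add homogenise_smult Suc add_Suc X_homogenise[symmetric])
    also have "homogenise T X (d + e) k = T ^ d * homogenise T X e k"
      by (rule T_power_homogenise[OF assms(2), symmetric])
    finally show ?thesis by (simp add: Suc homogenise_pCons distrib_right mult.assoc)
  qed
qed simp

text \<open>The ideal of a scheme on a line, with \<open>T, X\<close> as coordinates of the line: modulo the ideal,
  only binary forms are left.\<close>

locale binary_coordinates =
  fixes Z :: "5 mpoly set" and T X :: "5 mpoly"
  assumes ideal: "is_ideal Z" and linear: "T \<in> forms 1" "X \<in> forms 1"
    and binary: "\<And>g. g \<in> forms 1 \<Longrightarrow> \<exists>s r. g - (scalar s * T + scalar r * X) \<in> Z"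
begin

lemma binary_normal_form:
  "g \<in> forms d \<Longrightarrow> \<exists>h. degree h \<le> d \<and> g - homogenise T X d h \<in> Z"
proof (induction d arbitrary: g)
  case 0
  have "g - homogenise T X 0 [:Poly_Mapping.lookup g 0:] = 0"
    using forms_0_scalar[OF 0] by (simp add: homogenise_def)
  then show ?case using ideal_0[OF ideal] by (intro exI[of _ "[:Poly_Mapping.lookup g 0:]"]) simp
next
  case (Suc d)
  from Suc.prems show ?case
  proof (induction rule: forms_Suc_induct)
    case zero
    show ?case by (intro exI[of _ 0]) (simp add: ideal_0[OF ideal])
  next
    case (add g g')
    then obtain h h' where "degree h \<le> Suc d" "g - homogenise T X (Suc d) h \<in> Z"
      "degree h' \<le> Suc d" "g' - homogenise T X (Suc d) h' \<in> Z" by blast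
    then have "degree (h + h') \<le> Suc d" "g + g' - homogenise T X (Suc d) (h + h') \<in> Z"
      using ideal_add[OF ideal, of "g - homogenise T X (Suc d) h" "g' - homogenise T X (Suc d) h'"]
      by (simp_all add: degree_add_le homogenise_add algebra_simps)
    then show ?case by blast
  next
    case (mult i g)
    then obtain h where h: "degree h \<le> d" "g - homogenise T X d h \<in> Z" using Suc.IH by blast
    have "var i \<in> forms 1" by (simp add: forms_single)
    then obtain s r where sr: "var i - (scalar s * T + scalar r * X) \<in> Z" using binary by blast
    let ?h = "smult s h + smult r (pCons 0 h)"
    have "var i * g - homogenise T X (Suc d) ?h =
      g * (var i - (scalar s * T + scalar r * X)) + (scalar s * T + scalar r * X) * (g - homogenise T X d h)"
      unfolding homogenise_add homogenise_smult X_homogenise[symmetric] T_homogenise[OF h(1), symmetric]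
      by (simp add: algebra_simps)
    also have "\<dots> \<in> Z" by (intro ideal_add[OF ideal] ideal_scale[OF ideal] sr h)
    finally have "var i * g - homogenise T X (Suc d) ?h \<in> Z" .
    moreover have "degree ?h \<le> Suc d"
      using h(1) by (intro degree_add_le) (auto intro: order.trans[OF degree_smult_le] split: if_splits)
    ultimately show ?case by blast
  qed
qed

lemma monomial_forms: "i \<le> d \<Longrightarrow> X ^ i * T ^ (d - i) \<in> forms d"
  using forms_mult[OF forms_power[OF linear(2), of i] forms_power[OF linear(1), of "d - i"]] by simp

lemma sum_monomials_eq_homogenise:
  assumes "n \<le> Suc d"
  shows "(\<Sum>i<n. scalar (c i) * (X ^ i * T ^ (d - i))) = homogenise T X d (\<Sum>i<n. monom (c i) i)"
proof -
  have "coeff (\<Sum>i<n. monom (c i) i) j = (if j < n then c j else 0)" for j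
    by (simp add: coeff_sum coeff_monom)
  then have "homogenise T X d (\<Sum>i<n. monom (c i) i) =
    (\<Sum>i\<le>d. scalar (if i < n then c i else 0) * (X ^ i * T ^ (d - i)))"
    by (simp add: homogenise_def)
  also have "\<dots> = (\<Sum>i<n. scalar (c i) * (X ^ i * T ^ (d - i)))"
    by (rule sum.mono_neutral_cong_right) (use assms in auto)
  finally show ?thesis ..
qed

lemma hilbert_function_binary:
  assumes n: "n \<le> Suc d"
    and span: "\<And>h. degree h \<le> d \<Longrightarrow> \<exists>k. (\<forall>i\<ge>n. coeff k i = 0) \<and> homogenise T X d h - homogenise T X d k \<in> Z"
    and indep: "\<And>h. (\<forall>i\<ge>n. coeff h i = 0) \<Longrightarrow> homogenise T X d h \<in> Z \<Longrightarrow> h = 0"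
  shows "hilbert_function Z d = n"
    and "\<And>g. g \<in> forms d \<Longrightarrow> \<exists>c. g - (\<Sum>i<n. scalar (c i) * (X ^ i * T ^ (d - i))) \<in> Z"
    and "\<And>c i. (\<Sum>i<n. scalar (c i) * (X ^ i * T ^ (d - i))) \<in> Z \<Longrightarrow> i < n \<Longrightarrow> c i = 0"
proof -
  show *: "\<exists>c. g - (\<Sum>i<n. scalar (c i) * (X ^ i * T ^ (d - i))) \<in> Z" if g: "g \<in> forms d" for g
  proof -
    obtain h where h: "degree h \<le> d" "g - homogenise T X d h \<in> Z" using binary_normal_form[OF g] by blast
    obtain k where k: "\<forall>i\<ge>n. coeff k i = 0" "homogenise T X d h - homogenise T X d k \<in> Z"
      using span[OF h(1)] by blast
    have "k = (\<Sum>i<n. monom (coeff k i) i)"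
      using k(1) by (intro poly_eqI) (simp add: coeff_sum coeff_monom)
    then have sum: "homogenise T X d k = (\<Sum>i<n. scalar (coeff k i) * (X ^ i * T ^ (d - i)))"
      using sum_monomials_eq_homogenise[OF n, of "coeff k"] by simp
    have "g - homogenise T X d k \<in> Z" using ideal_add[OF ideal h(2) k(2)] by simp
    then show ?thesis unfolding sum by (rule exI[of _ "coeff k"])
  qed
  show **: "c i = 0" if "(\<Sum>i<n. scalar (c i) * (X ^ i * T ^ (d - i))) \<in> Z" "i < n" for c i
  proof -
    let ?h = "\<Sum>i<n. monom (c i) i"
    have coeff: "coeff ?h j = (if j < n then c j else 0)" for j
      by (simp add: coeff_sum coeff_monom)
    have "?h = 0"
    proof (rule indep)
      show "\<forall>i\<ge>n. coeff ?h i = 0" unfolding coeff by simp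
      show "homogenise T X d ?h \<in> Z" using that(1) unfolding sum_monomials_eq_homogenise[OF n] .
    qed
    then have "coeff ?h i = 0" by simp
    then show ?thesis using that(2) unfolding coeff by simp
  qed
  show "hilbert_function Z d = n"
  proof (rule hilbert_function_eqI[where e = "\<lambda>i. X ^ i * T ^ (d - i)", OF ideal])
    show "X ^ i * T ^ (d - i) \<in> forms d" if "i < n" for i
      by (rule monomial_forms) (use that n in simp)
  qed (fact * **)+
qed

text \<open>Otherwise all binary forms of degree \<open>d\<close> would be independent, and the Hilbert function
  would be \<open>d + 1\<close>.\<close>

lemma binary_relation_exists:
  assumes "\<forall>\<^sub>F d in sequentially. hilbert_function Z d = m"
  shows "\<exists>d h. h \<noteq> 0 \<and> degree h \<le> d \<and> homogenise T X d h \<in> Z"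
proof (rule ccontr)
  assume none: "\<not> ?thesis"
  have "hilbert_function Z d = Suc d" for d
  proof (rule hilbert_function_binary(1))
    fix h :: "complex poly" assume "degree h \<le> d"
    then show "\<exists>k. (\<forall>i\<ge>Suc d. coeff k i = 0) \<and> homogenise T X d h - homogenise T X d k \<in> Z"
      by (intro exI[of _ h]) (auto simp: coeff_eq_0 ideal_0[OF ideal])
  next
    fix h :: "complex poly" assume "\<forall>i\<ge>Suc d. coeff h i = 0" "homogenise T X d h \<in> Z"
    moreover from this(1) have "degree h \<le> d" by (intro degree_le) auto
    ultimately show "h = 0" using none by blast
  qed simp
  with assms have "\<forall>\<^sub>F d in sequentially. Suc d = m" by simp
  then obtain N where "\<And>d. d \<ge> N \<Longrightarrow> Suc d = m" by (auto simp: eventually_sequentially)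
  from this[of N] this[of "Suc N"] show False by simp
qed

text \<open>If \<open>T\<close> has no zeros on the scheme, the ideal corresponds to an ideal of univariate
  polynomials. It is generated by a polynomial of minimal degree \<open>n\<close>; division with
  remainder gives normal forms, so the Hilbert function is eventually \<open>n\<close>, and therefore
  \<open>n = m\<close>.\<close>

lemma normal_form_length:
  assumes hilbert: "\<forall>\<^sub>F d in sequentially. hilbert_function Z d = m"
    and cancel: "\<And>g. T * g \<in> Z \<Longrightarrow> g \<in> Z"
  shows "g \<in> forms m \<Longrightarrow> \<exists>c. g - (\<Sum>i<m. scalar (c i) * (X ^ i * T ^ (m - i))) \<in> Z"
    and "(\<Sum>i<m. scalar (c i) * (X ^ i * T ^ (m - i))) \<in> Z \<Longrightarrow> i < m \<Longrightarrow> c i = 0"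
proof -
  have power_cancel: "g \<in> Z" if "T ^ k * g \<in> Z" for k g
    using that by (induction k) (auto simp: mult.assoc intro: cancel)
  have lower: "homogenise T X (degree h) h \<in> Z" if "degree h \<le> d" "homogenise T X d h \<in> Z" for d h
    using power_cancel[of "d - degree h" "homogenise T X (degree h) h"] that
    by (simp add: T_power_homogenise)
  \<comment> \<open>Degrees of polynomials whose homogenisation is in the ideal.\<close>
  define R where "R n \<longleftrightarrow> (\<exists>h. h \<noteq> 0 \<and> degree h = n \<and> homogenise T X n h \<in> Z)" for n
  define n where "n = (LEAST n. R n)"
  have "\<exists>n. R n" using binary_relation_exists[OF hilbert] lower unfolding R_def by blast
  then have "R n" unfolding n_def by (rule LeastI_ex)
  then obtain P where P: "P \<noteq> 0" "degree P = n" "homogenise T X n P \<in> Z" unfolding R_def by blast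
  have indep: "h = 0" if h: "\<forall>i\<ge>n. coeff h i = 0" "n \<le> Suc d" "homogenise T X d h \<in> Z" for h d
  proof (rule ccontr)
    assume "h \<noteq> 0"
    then have "coeff h (degree h) \<noteq> 0" by simp
    then have less: "degree h < n" using h(1) by (meson not_le)
    then have "R (degree h)" using lower[of h d] h \<open>h \<noteq> 0\<close> unfolding R_def by fastforce
    then have "n \<le> degree h" unfolding n_def by (rule Least_le)
    with less show False by simp
  qed
  have span: "\<exists>k. (\<forall>i\<ge>n. coeff k i = 0) \<and> homogenise T X d h - homogenise T X d k \<in> Z"
    if "degree h \<le> d" for h d
  proof (cases "degree h < n")
    case True
    then show ?thesis by (intro exI[of _ h]) (auto simp: coeff_eq_0 ideal_0[OF ideal])
  next
    case False
    have "degree (h div P) \<le> d - n"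
    proof (cases "h div P = 0")
      case False
      have "degree (P * (h div P)) \<le> max (degree h) (degree (h mod P))"
        using degree_diff_le_max[of h "h mod P"] by (simp add: minus_mod_eq_mult_div)
      also have "\<dots> = degree h"
        using degree_mod_less[OF P(1), of h] \<open>\<not> degree h < n\<close> P(2) by auto
      finally show ?thesis using that P False by (simp add: degree_mult_eq)
    qed simp
    then have "homogenise T X (n + (d - n)) (P * (h div P)) = homogenise T X n P * homogenise T X (d - n) (h div P)"
      using P by (intro homogenise_mult) auto
    moreover have "n + (d - n) = d" using False that by simp
    ultimately have "homogenise T X d (P * (h div P)) \<in> Z"
      using ideal_mult_right[OF ideal P(3)] by simp
    moreover have "h = P * (h div P) + h mod P" by simp
    then have "homogenise T X d h - homogenise T X d (h mod P) = homogenise T X d (P * (h div P))"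
      by (metis add_diff_cancel_right' homogenise_add)
    moreover have "\<forall>i\<ge>n. coeff (h mod P) i = 0"
      using degree_mod_less[of P h] P by (auto intro: coeff_eq_0)
    ultimately show ?thesis by (intro exI[of _ "h mod P"]) simp
  qed
  have "hilbert_function Z d = n" if "n \<le> d" for d
    by (rule hilbert_function_binary(1)[OF _ span indep]) (use that in auto)
  moreover obtain N where "\<And>d. d \<ge> N \<Longrightarrow> hilbert_function Z d = m"
    using hilbert by (auto simp: eventually_sequentially)
  ultimately have "n = m" by (metis max.cobounded1 max.cobounded2)
  then have nm: "n \<le> Suc m" "n \<le> m" by simp_all
  note basis = hilbert_function_binary(2,3)[OF nm(1) span indep[OF _ nm(1)]]
  show "g \<in> forms m \<Longrightarrow> \<exists>c. g - (\<Sum>i<m. scalar (c i) * (X ^ i * T ^ (m - i))) \<in> Z"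
    using basis(1) \<open>n = m\<close> by blast
  show "(\<Sum>i<m. scalar (c i) * (X ^ i * T ^ (m - i))) \<in> Z \<Longrightarrow> i < m \<Longrightarrow> c i = 0"
    using basis(2) \<open>n = m\<close> by blast
qed

end

section \<open>A frame adapted to a collinear scheme\<close>

lemma adapted_basis:
  assumes L: "is_plane L" and l: "is_line l" "l \<subseteq> L"
  obtains e0 e1 e2 where "vec.independent {e0, e1, e2}" "e0 \<noteq> e1" "e0 \<noteq> e2" "e1 \<noteq> e2"
    "l = vec.span {e0, e1}" "L = vec.span {e0, e1, e2}"
proof -
  have sub: "vec.subspace L" "vec.subspace l" and dim: "vec.dim L = 3" "vec.dim l = 2"
    using L l by (auto simp: is_plane_def is_line_def)
  obtain B where B: "B \<subseteq> l" "vec.independent B" "l \<subseteq> vec.span B" "card B = vec.dim l"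
    by (rule vec.basis_exists)
  obtain e0 e1 where e: "B = {e0, e1}" "e0 \<noteq> e1" using B(4) dim by (auto simp: card_2_iff)
  have span: "vec.span B = l" using B(3) vec.span_minimal[OF B(1) sub(2)] by blast
  have "\<not> L \<subseteq> l"
  proof
    assume "L \<subseteq> l"
    then have "vec.dim L \<le> vec.dim l" by (rule vec.dim_subset)
    with dim show False by simp
  qed
  then obtain e2 where e2: "e2 \<in> L" "e2 \<notin> l" by blast
  then have ne: "e2 \<noteq> e0" "e2 \<noteq> e1" using B(1) e by auto
  have ind: "vec.independent (insert e2 B)"
    by (rule vec.independent_insertI) (use e2 span B in auto)
  have "insert e2 B \<subseteq> L" using e2 B(1) l(2) by blast
  moreover have "vec.dim L \<le> card (insert e2 B)" using ne e dim by simp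
  ultimately have "L \<subseteq> vec.span (insert e2 B)"
    using ind by (intro vec.card_ge_dim_independent)
  moreover have "vec.span (insert e2 B) \<subseteq> L"
    using \<open>insert e2 B \<subseteq> L\<close> sub(1) by (rule vec.span_minimal)
  moreover have "insert e2 B = {e0, e1, e2}" using e by auto
  ultimately show ?thesis using that[of e0 e1 e2] ind e ne span by auto
qed

text \<open>A nonzero binary form in the ideal has finitely many zeros on the line. If
  \<open>T - \<sigma> X\<close> avoids them, then a power of \<open>X\<close> is divisible by it modulo the ideal,
  hence all forms of some degree are, and it can be cancelled.\<close>

lemma (in binary_coordinates) transversal_coordinate:
  assumes hilbert: "\<forall>\<^sub>F d in sequentially. hilbert_function Z d = m"
    and saturated: "saturation Z = Z"
  shows "\<exists>\<sigma>. \<forall>g. (T - scalar \<sigma> * X) * g \<in> Z \<longrightarrow> g \<in> Z"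
proof -
  obtain d h where h: "h \<noteq> 0" "degree h \<le> d" "homogenise T X d h \<in> Z"
    using binary_relation_exists[OF hilbert] by blast
  \<comment> \<open>The value of \<open>?Q\<close> at \<open>\<sigma>\<close> is the coefficient of \<open>X^d\<close> after the
    substitution \<open>T = T' + \<sigma> X\<close>.\<close>
  let ?Q = "\<Sum>i\<le>d. monom (coeff h i) (d - i)"
  have "coeff ?Q (d - degree h) = (\<Sum>i\<le>d. if i = degree h then coeff h i else 0)"
    unfolding coeff_sum coeff_monom using h(2) by (intro sum.cong) auto
  also have "\<dots> \<noteq> 0" using h by simp
  finally have "?Q \<noteq> 0" by auto
  then obtain \<sigma> where "poly ?Q \<sigma> \<noteq> 0" using poly_all_0_iff_0 by blast
  then have Q: "(\<Sum>i\<le>d. coeff h i * \<sigma> ^ (d - i)) \<noteq> 0" (is "?q \<noteq> 0")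
    by (simp add: poly_sum poly_monom)
  define T' where "T' = T - scalar \<sigma> * X"
  have "T' dvd T ^ k - (scalar \<sigma> * X) ^ k" for k
    unfolding T'_def power_diff_sumr2 by (rule dvd_triv_left)
  then have "T' dvd (\<Sum>i\<le>d. scalar (coeff h i) * X ^ i * (T ^ (d - i) - (scalar \<sigma> * X) ^ (d - i)))"
    by (intro dvd_sum dvd_mult)
  also have "\<dots> = homogenise T X d h - scalar ?q * X ^ d"
  proof -
    have "scalar ?q * X ^ d = (\<Sum>i\<le>d. scalar (coeff h i) * X ^ i * (scalar \<sigma> * X) ^ (d - i))"
    proof -
      have "scalar ?q * X ^ d = (\<Sum>i\<le>d. scalar (coeff h i) * scalar \<sigma> ^ (d - i) * X ^ d)"
        by (simp only: scalar_sum scalar_mult scalar_power sum_distrib_right)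
      also have "\<dots> = (\<Sum>i\<le>d. scalar (coeff h i) * X ^ i * (scalar \<sigma> * X) ^ (d - i))"
      proof (intro sum.cong refl)
        fix i assume "i \<in> {..d}"
        then have "X ^ d = X ^ i * X ^ (d - i)" by (simp add: power_add[symmetric])
        then show "scalar (coeff h i) * scalar \<sigma> ^ (d - i) * X ^ d =
            scalar (coeff h i) * X ^ i * (scalar \<sigma> * X) ^ (d - i)"
          by (simp only: power_mult_distrib mult_ac)
      qed
      finally show ?thesis .
    qed
    then show ?thesis
      by (simp add: homogenise_def right_diff_distrib sum_subtractf mult.assoc)
  qed
  finally obtain r where r: "homogenise T X d h - scalar ?q * X ^ d = T' * r" by (auto elim: dvdE)
  have linear': "T' \<in> forms 1" unfolding T'_def by (intro forms_diff forms_smult linear)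
  interpret T': binary_coordinates Z T' X
  proof
    show "\<exists>s r. g - (scalar s * T' + scalar r * X) \<in> Z" if g: "g \<in> forms 1" for g
    proof -
      obtain s r where sr: "g - (scalar s * T + scalar r * X) \<in> Z" using binary[OF g] by blast
      have "scalar s * T + scalar r * X = scalar s * T' + scalar (r + s * \<sigma>) * X"
        unfolding T'_def single_add scalar_mult by algebra
      with sr have mem: "g - (scalar s * T' + scalar (r + s * \<sigma>) * X) \<in> Z" by simp
      show ?thesis by (rule exI[of _ s], rule exI[of _ "r + s * \<sigma>"], rule mem)
    qed
  qed (fact ideal linear' linear)+
  have X: "X ^ d - T' * (scalar (- 1 / ?q) * r) \<in> Z"
  proof -
    have *: "scalar (1 / ?q) * scalar ?q = (1 :: 5 mpoly)" using Q by (simp add: mult_single)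
    have "X ^ d - T' * (scalar (- 1 / ?q) * r) = scalar (1 / ?q) * (scalar ?q * X ^ d + T' * r)"
    proof -
      have "scalar (- 1 / ?q) = - (scalar (1 / ?q) :: 5 mpoly)" by (simp add: single_uminus)
      then have "X ^ d - T' * (scalar (- 1 / ?q) * r) = 1 * X ^ d + scalar (1 / ?q) * (T' * r)"
        by (simp add: algebra_simps)
      then show ?thesis unfolding *[symmetric] by (simp only: distrib_left mult.assoc)
    qed
    also have "\<dots> = scalar (1 / ?q) * homogenise T X d h" unfolding r[symmetric] by simp
    also have "\<dots> \<in> Z" by (intro ideal_scale[OF ideal] h)
    finally show ?thesis .
  qed
  have cover: "\<forall>g\<in>forms d. \<exists>k. g - T' * k \<in> Z"
  proof
    fix g :: "5 mpoly" assume "g \<in> forms d"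
    then obtain h' where h': "g - homogenise T' X d h' \<in> Z" using T'.binary_normal_form by blast
    have "T' dvd (\<Sum>i<d. scalar (coeff h' i) * (X ^ i * T' ^ (d - i)))"
      by (intro dvd_sum dvd_mult dvd_power) auto
    then obtain k where k: "(\<Sum>i<d. scalar (coeff h' i) * (X ^ i * T' ^ (d - i))) = T' * k"
      by (auto elim: dvdE)
    have "homogenise T' X d h' = T' * k + scalar (coeff h' d) * X ^ d"
      unfolding homogenise_def k[symmetric] lessThan_Suc_atMost[symmetric] by simp
    then have "g - T' * (k + scalar (coeff h' d) * (scalar (- 1 / ?q) * r)) =
      (g - homogenise T' X d h') + scalar (coeff h' d) * (X ^ d - T' * (scalar (- 1 / ?q) * r))"
      by (simp add: algebra_simps)
    also have "\<dots> \<in> Z" by (intro ideal_add[OF ideal] ideal_scale[OF ideal] h' X)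
    finally show "\<exists>k. g - T' * k \<in> Z" by blast
  qed
  have "g \<in> Z" if "T' * g \<in> Z" for g
    by (rule saturated_cancel[OF ideal saturated cover that])
  then show ?thesis unfolding T'_def by blast
qed

text \<open>The functionals of the frame are the coordinates with respect to the basis, so their
  common kernel is the space of cubic equations and their matrix is the identity.\<close>

lemma (in plane_coordinates) frame_of_basis:
  assumes Z: "is_ideal Z"
    and span: "\<And>g. g \<in> forms 3 \<Longrightarrow> \<exists>c. g - (\<Sum>k\<in>UNIV. scalar (c k) * cubic_basis k) \<in> Z"
    and indep: "\<And>c k. (\<Sum>k\<in>UNIV. scalar (c k) * cubic_basis k) \<in> Z \<Longrightarrow> c k = 0"
    and L: "L = vec.span (range e)"
  shows "\<exists>x. is_frame x (Z, L) \<and> frame_vector x = e \<and> det3 (functional_matrix x) = 1"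
proof -
  let ?s = "\<lambda>c. \<Sum>k\<in>UNIV. scalar (c k) * cubic_basis k"
  have "\<forall>g. \<exists>c. g \<in> forms 3 \<longrightarrow> g - ?s c \<in> Z" using span by blast
  from choice[OF this] obtain N where N: "\<And>g. g \<in> forms 3 \<Longrightarrow> g - ?s (N g) \<in> Z" by blast
  define x :: "frame_index \<Rightarrow> complex" where
    "x = case_sum (\<lambda>(k, m). N (Poly_Mapping.single m 1) k) (\<lambda>(k, j). e k $ j)"
  have vector: "frame_vector x = e"
    by (rule ext) (simp add: x_def frame_vector_def vec_eq_iff)
  have unique: "c = c'" if "g - ?s c \<in> Z" "g - ?s c' \<in> Z" for g c c'
  proof
    fix k
    have "?s (\<lambda>k. c' k - c k) = (g - ?s c) - (g - ?s c')"
      by (simp add: single_diff left_diff_distrib sum_subtractf)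
    also have "\<dots> \<in> Z" by (rule ideal_diff[OF Z that])
    finally have "c' k - c k = 0" by (rule indep)
    then show "c k = c' k" by simp
  qed
  have functional: "(\<lambda>k. frame_functional x k g) = c" if g: "g \<in> forms 3" and c: "g - ?s c \<in> Z" for g c
  proof (rule unique[OF _ c])
    have eq: "?s (\<lambda>k. frame_functional x k g) =
      (\<Sum>m\<in>Poly_Mapping.keys g. scalar (Poly_Mapping.lookup g m) * ?s (N (Poly_Mapping.single m 1)))"
    proof -
      have hom: "scalar (\<Sum>m\<in>A. N (Poly_Mapping.single m 1) k * Poly_Mapping.lookup g m) =
        (\<Sum>m\<in>A. scalar (Poly_Mapping.lookup g m) * scalar (N (Poly_Mapping.single m 1) k) :: 5 mpoly)" for A k
        by (induction A rule: infinite_finite_induct) (simp_all add: single_add mult_single mult.commute)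
      have "?s (\<lambda>k. frame_functional x k g) = (\<Sum>k\<in>UNIV. \<Sum>m\<in>Poly_Mapping.keys g.
        scalar (Poly_Mapping.lookup g m) * (scalar (N (Poly_Mapping.single m 1) k) * cubic_basis k))"
        unfolding frame_functional_def x_def sum.case prod.case hom sum_distrib_right mult.assoc ..
      also have "\<dots> = (\<Sum>m\<in>Poly_Mapping.keys g. scalar (Poly_Mapping.lookup g m) * ?s (N (Poly_Mapping.single m 1)))"
        unfolding sum_distrib_left by (rule sum.swap)
      finally show ?thesis .
    qed
    have "g = (\<Sum>m\<in>Poly_Mapping.keys g. scalar (Poly_Mapping.lookup g m) * Poly_Mapping.single m 1)"
      by (simp add: mult_single mpoly_eq_sum_monomials[symmetric])
    then have "g - ?s (\<lambda>k. frame_functional x k g) = (\<Sum>m\<in>Poly_Mapping.keys g.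
      scalar (Poly_Mapping.lookup g m) * (Poly_Mapping.single m 1 - ?s (N (Poly_Mapping.single m 1))))"
      unfolding eq right_diff_distrib sum_subtractf by (rule arg_cong)
    also have "\<dots> \<in> Z"
      using g by (intro ideal_sum[OF Z] ideal_scale[OF Z] N forms_single) (simp add: forms_def)
    finally show "g - ?s (\<lambda>k. frame_functional x k g) \<in> Z" .
  qed
  have zero: "?s (\<lambda>k. 0) = 0" by simp
  have "g \<in> Z \<longleftrightarrow> (\<forall>k. frame_functional x k g = 0)" if g: "g \<in> forms 3" for g
  proof
    assume "g \<in> Z"
    then have "g - ?s (\<lambda>k. 0) \<in> Z" by simp
    from functional[OF g this] show "\<forall>k. frame_functional x k g = 0" by (auto dest: fun_cong)
  next
    assume "\<forall>k. frame_functional x k g = 0"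
    then have "N g = (\<lambda>k. 0)" using functional[OF g N[OF g]] by auto
    then show "g \<in> Z" using N[OF g] by simp
  qed
  then have "is_frame x (Z, L)" unfolding is_frame_iff vector L by blast
  moreover have "functional_matrix x = (\<lambda>i k. if i = k then 1 else 0)"
  proof (intro ext)
    fix i k
    have "?s (\<lambda>j. if j = k then 1 else 0) = (\<Sum>j\<in>UNIV. if j = k then cubic_basis j else 0)"
      by (intro sum.cong) auto
    then have "cubic_basis k - ?s (\<lambda>j. if j = k then 1 else 0) \<in> Z" using ideal_0[OF Z] by simp
    from fun_cong[OF functional[OF cubic_basis_forms this], of i]
    show "functional_matrix x i k = (if i = k then 1 else 0)" by (simp add: functional_matrix_def)
  qed
  ultimately show ?thesis using vector by (auto simp: det3_identity)
qed

text \<open>The forms dual to a basis of \<open>L\<close> that extends one of the line are corrected by a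
  transversal coordinate, which does not change the determinant on the basis.\<close>

lemma adapted_frame:
  assumes "(Z, L) \<in> exceptional_divisor S"
  obtains T X Y x where "plane_coordinates T X Y" "is_frame x (Z, L)" "Y \<in> Z"
    "det3 (plane_coordinates.functional_matrix T X x) \<noteq> 0"
    "det3 (plane_coordinates.vector_matrix T X Y x) \<noteq> 0"
proof -
  have closed: "homogeneous_ideal Z" "saturation Z = Z"
    and hilbert: "\<forall>\<^sub>F d in sequentially. hilbert_function Z d = 3"
    and L: "is_plane L" "linear_subspace_ideal L \<subseteq> Z" and l: "is_line (linear_span Z)"
    using assms by (auto simp: exceptional_divisor_def blowup_Hilb3_def Ind_def Hilb3_def
        finite_length_scheme_def closed_subscheme_def)
  have Z: "is_ideal Z" using closed(1) by (simp add: homogeneous_ideal_def)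
  have "linear_span Z \<subseteq> L"
    by (rule linear_span_subset_of_ideal_subset[OF _ L(2)]) (use L in \<open>simp add: is_plane_def\<close>)
  then obtain e0 e1 e2 where e: "vec.independent {e0, e1, e2}" "e0 \<noteq> e1" "e0 \<noteq> e2" "e1 \<noteq> e2"
    "linear_span Z = vec.span {e0, e1}" "L = vec.span {e0, e1, e2}"
    using adapted_basis[OF L(1) l] by metis
  obtain \<phi>0 where \<phi>0: "\<forall>b\<in>{e0, e1, e2}. meval (($) b) (linear_form \<phi>0) = (if b = e0 then 1 else 0)"
    using dual_functional[OF e(1), of "\<lambda>b. if b = e0 then 1 else 0"] by blast
  obtain \<phi>1 where \<phi>1: "\<forall>b\<in>{e0, e1, e2}. meval (($) b) (linear_form \<phi>1) = (if b = e1 then 1 else 0)"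
    using dual_functional[OF e(1), of "\<lambda>b. if b = e1 then 1 else 0"] by blast
  obtain \<phi>2 where \<phi>2: "\<forall>b\<in>{e0, e1, e2}. meval (($) b) (linear_form \<phi>2) = (if b = e2 then 1 else 0)"
    using dual_functional[OF e(1), of "\<lambda>b. if b = e2 then 1 else 0"] by blast
  define P X Y where PXY: "P = linear_form \<phi>0" "X = linear_form \<phi>1" "Y = linear_form \<phi>2"
  have forms_PXY: "P \<in> forms 1" "X \<in> forms 1" "Y \<in> forms 1" unfolding PXY by (rule linear_form_forms)+
  have dual: "meval (($) e0) P = 1" "meval (($) e1) P = 0" "meval (($) e2) P = 0"
    "meval (($) e0) X = 0" "meval (($) e1) X = 1" "meval (($) e2) X = 0"
    "meval (($) e0) Y = 0" "meval (($) e1) Y = 0" "meval (($) e2) Y = 1"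
    using \<phi>0 \<phi>1 \<phi>2 e(2-4) unfolding PXY by auto
  have vanish: "g \<in> Z" if g: "g \<in> forms 1" "meval (($) e0) g = 0" "meval (($) e1) g = 0" for g
  proof (rule linear_form_mem_of_vanishing[OF Z g(1)])
    fix y assume "y \<in> linear_span Z"
    then show "meval (($) y) g = 0"
      using forms_1_vanish_on_span[OF g(1), of "{e0, e1}" y] g(2,3) by (auto simp: e(5))
  qed
  have Y: "Y \<in> Z" by (rule vanish) (fact forms_PXY dual)+
  have binary: "\<exists>s r. g - (scalar s * P + scalar r * X) \<in> Z" if g: "g \<in> forms 1" for g
  proof (intro exI vanish)
    show "g - (scalar (meval (($) e0) g) * P + scalar (meval (($) e1) g) * X) \<in> forms 1"
      by (intro forms_diff forms_add forms_smult forms_PXY g)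
  qed (simp_all add: dual)
  interpret P: binary_coordinates Z P X
    by unfold_locales (fact Z forms_PXY binary)+
  obtain \<sigma> where cancel: "\<And>g. (P - scalar \<sigma> * X) * g \<in> Z \<Longrightarrow> g \<in> Z"
    using P.transversal_coordinate[OF hilbert closed(2)] by blast
  define T where "T = P - scalar \<sigma> * X"
  have T: "T \<in> forms 1" unfolding T_def by (intro forms_diff forms_smult forms_PXY)
  interpret binary_coordinates Z T X
  proof
    show "\<exists>s r. g - (scalar s * T + scalar r * X) \<in> Z" if g: "g \<in> forms 1" for g
    proof -
      obtain s r where sr: "g - (scalar s * P + scalar r * X) \<in> Z" using binary[OF g] by blast
      have "scalar s * P + scalar r * X = scalar s * T + scalar (r + s * \<sigma>) * X"
        unfolding T_def single_add scalar_mult by algebra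
      with sr have mem: "g - (scalar s * T + scalar (r + s * \<sigma>) * X) \<in> Z" by simp
      show ?thesis by (rule exI[of _ s], rule exI[of _ "r + s * \<sigma>"], rule mem)
    qed
  qed (fact Z T forms_PXY)+
  interpret plane_coordinates T X Y by unfold_locales (fact T forms_PXY)+
  have cancel: "g \<in> Z" if "T * g \<in> Z" for g using cancel that unfolding T_def .
  have spanning: "\<exists>c. g - (\<Sum>i<3. scalar (c i) * (X ^ i * T ^ (3 - i))) \<in> Z" if "g \<in> forms 3" for g
    by (rule normal_form_length(1)[OF hilbert _ that]) (rule cancel)
  have independent: "c i = 0" if "(\<Sum>i<3. scalar (c i) * (X ^ i * T ^ (3 - i))) \<in> Z" "i < 3" for c i
    by (rule normal_form_length(2)[OF hilbert _ that]) (rule cancel)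
  have sum_basis: "(\<Sum>k\<in>UNIV. scalar (c k) * cubic_basis k) =
     (\<Sum>i<3. scalar (if i = 0 then c 3 else if i = 1 then c 2 else c 1) * (X ^ i * T ^ (3 - i)))" for c
    by (simp add: sum_3 cubic_basis_def eval_nat_numeral algebra_simps)
  define e where "e k = (if k = 1 then e0 else if k = 2 then e1 else e2)" for k :: 3
  have range_e: "range e = {e0, e1, e2}"
    unfolding UNIV_3 e_def by auto
  have "\<exists>x. is_frame x (Z, L) \<and> frame_vector x = e \<and> det3 (functional_matrix x) = 1"
  proof (rule frame_of_basis[OF Z])
    fix g :: "5 mpoly" assume "g \<in> forms 3"
    then obtain c where c: "g - (\<Sum>i<3. scalar (c i) * (X ^ i * T ^ (3 - i))) \<in> Z" using spanning by blast
    define c' where "c' k = (if k = 1 then c 2 else if k = 2 then c 1 else c 0)" for k :: 3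
    have "(\<Sum>k\<in>UNIV. scalar (c' k) * cubic_basis k) = (\<Sum>i<3. scalar (c i) * (X ^ i * T ^ (3 - i)))"
      unfolding sum_basis by (intro sum.cong) (auto simp: c'_def eval_nat_numeral less_Suc_eq)
    then show "\<exists>c. g - (\<Sum>k\<in>UNIV. scalar (c k) * cubic_basis k) \<in> Z" using c by (intro exI[of _ c']) simp
  next
    fix c :: "3 \<Rightarrow> complex" and k :: 3
    assume "(\<Sum>k\<in>UNIV. scalar (c k) * cubic_basis k) \<in> Z"
    note zero = independent[OF this[unfolded sum_basis]]
    show "c k = 0" using zero[of 0] zero[of 1] zero[of 2] exhaust_3[of k] by auto
  next
    show "L = vec.span (range e)" using range_e \<open>L = vec.span {e0, e1, e2}\<close> by simp
  qed
  then obtain x where x: "is_frame x (Z, L)" "frame_vector x = e" "det3 (functional_matrix x) = 1" by blast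
  have "det3 (vector_matrix x) = 1"
    unfolding det3_def sum_3 adj3_def cyc_simps vector_matrix_def x(2) e_def coordinate_def
    by (simp add: T_def dual)
  with x Y that[OF plane_coordinates_axioms] show ?thesis by simp
qed

section \<open>Disjointness of the two loci\<close>

theorem proposition2p1:
  shows "\<exists>G. general_locus G \<noteq> {} \<and>
    (\<forall>(q, f) \<in> general_locus G. K3_degree6 q f \<longrightarrow>
       X_locus (surface_ideal q f) \<inter> Y_locus (surface_ideal q f) = {})"
proof -
  have disjoint: "X_locus (surface_ideal q f) \<inter> Y_locus (surface_ideal q f) = {}"
    if q: "q \<in> forms 2" and f: "f \<in> forms 3" for q f
  proof (rule ccontr)
    let ?S = "surface_ideal q f"
    assume "X_locus ?S \<inter> Y_locus ?S \<noteq> {}"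
    then obtain Z0 L0 where X: "(Z0, L0) \<in> X_locus ?S" and Y: "(Z0, L0) \<in> Y_locus ?S" by auto
    have E: "(Z0, L0) \<in> exceptional_divisor ?S" using Y by (simp add: Y_locus_def)
    obtain T X Y' x0 where coords: "plane_coordinates T X Y'" and frame: "is_frame x0 (Z0, L0)"
      and "Y' \<in> Z0" "det3 (plane_coordinates.functional_matrix T X x0) \<noteq> 0"
      "det3 (plane_coordinates.vector_matrix T X Y' x0) \<noteq> 0"
      using adapted_frame[OF E] by metis
    then obtain g where g: "meval x0 g \<noteq> 0" "\<And>x Z L. is_frame x (Z, L) \<Longrightarrow> (Z, L) \<in> fixed_points ?S
      \<Longrightarrow> meval x g \<noteq> 0 \<Longrightarrow> Z \<in> Ind ?S"
      using plane_coordinates.self_residual_near_Y_is_collinear[OF coords q f Y frame] by blast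
    let ?U = "{p \<in> blowup_Hilb3 ?S. \<exists>x. is_frame x p \<and> meval x g \<noteq> 0}"
    have U: "openin (zariski_blowup ?S) ?U"
      unfolding zariski_blowup_def by (rule topology_generated_by_Basis) blast
    have "(Z0, L0) \<in> ?U"
      using E frame g(1) by (auto simp: exceptional_divisor_def)
    moreover have "\<forall>V. (Z0, L0) \<in> V \<and> openin (zariski_blowup ?S) V \<longrightarrow>
        (\<exists>p. p \<in> fixed_points ?S - Y_locus ?S \<and> p \<in> V)"
      using X unfolding X_locus_def in_closure_of by (rule conjunct2)
    ultimately have "\<exists>p. p \<in> fixed_points ?S - Y_locus ?S \<and> p \<in> ?U"
      using U by (elim allE[of _ ?U]) (rule mp, assumption, rule conjI)
    then obtain p where p: "p \<in> fixed_points ?S - Y_locus ?S" "p \<in> ?U" by (elim exE conjE)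
    obtain Z L where ZL: "p = (Z, L)" by (cases p)
    from p(2) obtain x where "is_frame x (Z, L)" "meval x g \<noteq> 0" unfolding ZL by auto
    moreover have "(Z, L) \<in> fixed_points ?S" using p(1) ZL by simp
    ultimately have "Z \<in> Ind ?S" by (intro g(2))
    then have "p \<in> Y_locus ?S"
      using p ZL by (auto simp: Y_locus_def exceptional_divisor_def)
    then show False using p(1) by blast
  qed
  \<comment> \<open>The constant polynomial 1 has a nonempty locus that contains all pairs of a
    quadric and a cubic.\<close>
  have "(0, 0) \<in> general_locus 1" by (simp add: general_locus_def)
  then have "general_locus 1 \<noteq> {}" by blast
  moreover have "\<forall>(q, f) \<in> general_locus 1. K3_degree6 q f \<longrightarrow>
      X_locus (surface_ideal q f) \<inter> Y_locus (surface_ideal q f) = {}"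
    using disjoint by (auto simp: general_locus_def)
  ultimately show ?thesis by blast
qed

end
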